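(* Let $(\mathcal{P},\omega)$ be a symplectic manifold, $H\in\mathcal{C}^\infty(\mathcal{P})$, and $\mathcal{M}\subset\mathcal{P}$ a coisotropic submanifold such that for every $z\in\mathcal{M}$ all critical points of the restriction of $H$ to the fibre $[z]$ are nondegenerate. Let $\varphi_h$ be a symplectic method for which SHAKE and RATTLE are well defined on the open set $O\subset\mathcal{M}$, $O\supset\mathcal{M}^H$, for $0<|h|<h_0$, and fix such an $h$. Then: (a) the SHAKE map $S_h$, regarded as a mapping $\widetilde{\mathcal{M}}^H\to\widetilde{\mathcal{M}}^H$, is symplectic, i.e. it preserves the pull-back of $\omega$ to $\widetilde{\mathcal{M}}^H$; (b) the RATTLE map $R_h$, regarded as a mapping $\mathcal{M}^H\to\mathcal{M}^H$, is symplectic, i.e. it preserves the pull-back of $\omega$ to $\mathcal{M}^H$.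
   Context: $X_H$ is the Hamiltonian vector field, $\omega(X_H,\cdot)=\mathrm{d}H$; $\nu$ is the pull-back of $\omega$ to $\mathcal{M}$. $\mathcal{M}$ is coisotropic if $T\mathcal{M}^{\perp}\subset T\mathcal{M}$, $\perp$ being the $\omega$-orthogonal complement. $\ker\nu$ (of constant dimension) is integrable and the fibre $[x]$ is the leaf through $x$. The hidden constraint set is $\mathcal{M}^H=\{z\in\mathcal{M}:\mathrm{d}(H|_{\mathcal{M}})(z)\in\nu(T_z\mathcal{M})\}$, $\nu(T_z\mathcal{M})=\{\nu_z(u,\cdot):u\in T_z\mathcal{M}\}$; under the hypotheses it is a submanifold on which $\nu$ pulls back to a symplectic form. A critical point is nondegenerate if its Hessian is nonsingular. A method is a family of diffeomorphisms $\varphi_h\colon\mathcal{P}\to\mathcal{P}$, for $h$ in an open interval around $0$, smooth in $(h,z)$, with $\varphi_0=\mathrm{id}$ and $\frac{\partial}{\partial h}\varphi_h|_{h=0}=X_H$; it is symplectic if $\varphi_h^*\omega=\omega$ for all $h$. For $O\subset\mathcal{M}$ open and $z\in O$, the local fibre $[z]_O$ is the connected component (in the leaf topology) of $[z]\cap O$ containing $z$. SHAKE and RATTLE are well defined on an open set $O\supset\mathcal{M}^H$, for $0<|h|<h_0$, if: (i) for every $x\in O$, $[x]_O\cap\mathcal{M}^H$ is a single point $\Pi(x)$, and $\Pi$ is smooth; (ii) for every $0<|h|<h_0$ and $z\in O$ there is exactly one $z^+\in[z]_O$ with $\varphi_h(z^+)\in\mathcal{M}$; the map $\Gamma_h\colon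 O\to O$, $\Gamma_h(z)=z^+$, is smooth, and $\varphi_h(\Gamma_h(O))\subset O$. The SHAKE map is $S_h=\varphi_h\circ\Gamma_h\colon O\to O$, the RATTLE map is $R_h=\Pi\circ S_h$, and the modified hidden constraint set is $\widetilde{\mathcal{M}}^H=\varphi_h\circ\Gamma_h(O)=S_h(O)$, which is a submanifold of $\mathcal{M}$, symplectic with the pull-back of $\nu$. *)

theory Defs
  imports "HOL-Analysis.Analysis"
begin

fun Ck_on :: "nat \<Rightarrow> 'a::euclidean_space set \<Rightarrow> ('a \<Rightarrow> 'b::euclidean_space) \<Rightarrow> bool" where
  "Ck_on 0 U f \<longleftrightarrow> continuous_on U f"
| "Ck_on (Suc k) U f \<longleftrightarrow> (\<forall>x\<in>U. f differentiable (at x)) \<and>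
     (\<forall>v. Ck_on k U (\<lambda>x. frechet_derivative f (at x) v))"

text \<open>Only used for open \<open>U\<close>.\<close>

definition smooth_on :: "'a::euclidean_space set \<Rightarrow> ('a \<Rightarrow> 'b::euclidean_space) \<Rightarrow> bool" where
  "smooth_on U f \<longleftrightarrow> (\<forall>k. Ck_on k U f)"

text \<open>A manifold is a (Hausdorff, second countable) type \<open>'p\<close> with a smooth atlas; a chart is its
  domain together with the coordinate map, whose values off the domain are irrelevant.\<close>

type_synonym ('p, 'e) chart = "'p set \<times> ('p \<Rightarrow> 'e)"

definition chart_inv :: "('p, 'e) chart \<Rightarrow> 'e \<Rightarrow> 'p" where
  "chart_inv c = inv_into (fst c) (snd c)"

definition chart_img :: "('p, 'e) chart \<Rightarrow> 'e set" where
  "chart_img c = snd c ` fst c"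

definition is_chart :: "('p::topological_space, 'e::euclidean_space) chart \<Rightarrow> bool" where
  "is_chart c \<longleftrightarrow> open (fst c) \<and> open (chart_img c) \<and>
     homeomorphism (fst c) (chart_img c) (snd c) (chart_inv c)"

definition smooth_transition ::
    "('p, 'e::euclidean_space) chart \<Rightarrow> ('p, 'e) chart \<Rightarrow> bool" where
  "smooth_transition c d \<longleftrightarrow> smooth_on (snd c ` (fst c \<inter> fst d)) (snd d \<circ> chart_inv c)"

definition smooth_atlas ::
    "('p::{t2_space, second_countable_topology}, 'e::euclidean_space) chart set \<Rightarrow> bool" where
  "smooth_atlas A \<longleftrightarrow> (\<forall>c\<in>A. is_chart c) \<and> (\<Union>c\<in>A. fst c) = UNIV \<and>
     (\<forall>c\<in>A. \<forall>d\<in>A. smooth_transition c d)"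

text \<open>The charts of the maximal atlas:\<close>

definition smooth_chart ::
    "('p::topological_space, 'e::euclidean_space) chart set \<Rightarrow> ('p, 'e) chart \<Rightarrow> bool" where
  "smooth_chart A c \<longleftrightarrow> is_chart c \<and> (\<forall>d\<in>A. smooth_transition c d \<and> smooth_transition d c)"

definition std_atlas :: "('e, 'e) chart set" where
  "std_atlas = {(UNIV, id)}"

definition prod_atlas ::
    "('p, 'e) chart set \<Rightarrow> ('q, 'f) chart set \<Rightarrow> ('p \<times> 'q, 'e \<times> 'f) chart set" where
  "prod_atlas A B =
     {(fst c \<times> fst d, \<lambda>(p, q). (snd c p, snd d q)) | c d. c \<in> A \<and> d \<in> B}"

text \<open>Smoothness of a map on an arbitrary subset \<open>S\<close> of a manifold means that the map locally extends
  to a smooth map of the ambient manifold. If \<open>S\<close> is an embedded submanifold, or relatively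
  open in one, this is smoothness for its own manifold structure.\<close>

definition smooth_map_on :: "('p::topological_space, 'e::euclidean_space) chart set \<Rightarrow>
    ('q::topological_space, 'f::euclidean_space) chart set \<Rightarrow> 'p set \<Rightarrow> ('p \<Rightarrow> 'q) \<Rightarrow> bool" where
  "smooth_map_on A B S f \<longleftrightarrow>
     (\<forall>p\<in>S. \<forall>c\<in>A. \<forall>d\<in>B. p \<in> fst c \<and> f p \<in> fst d \<longrightarrow>
        (\<exists>U F. open U \<and> snd c p \<in> U \<and> smooth_on U F \<and>
           (\<forall>x \<in> S \<inter> fst c. snd c x \<in> U \<longrightarrow> f x \<in> fst d \<and> F (snd c x) = snd d (f x))))"

definition diffeomorphism :: "('p::topological_space, 'e::euclidean_space) chart set \<Rightarrow>
    ('p \<Rightarrow> 'p) \<Rightarrow> bool" where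
  "diffeomorphism A f \<longleftrightarrow> bij f \<and> smooth_map_on A A UNIV f \<and> smooth_map_on A A UNIV (inv f)"

text \<open>The tangent space at \<open>p\<close> is identified with the model space \<open>'e\<close> by the coordinates of one
  chart at \<open>p\<close>, fixed once and for all. Fields of tensors are therefore functions whose value
  at \<open>p\<close> lives on \<open>'e\<close>; as the chosen chart jumps with \<open>p\<close>, their smoothness has to be expressed
  after a change of coordinates to a common chart.\<close>

definition chart_at :: "('p, 'e) chart set \<Rightarrow> 'p \<Rightarrow> ('p, 'e) chart" where
  "chart_at A p = (SOME c. c \<in> A \<and> p \<in> fst c)"

definition velocity :: "('p, 'e::euclidean_space) chart set \<Rightarrow> (real \<Rightarrow> 'p) \<Rightarrow> real \<Rightarrow> 'e" where
  "velocity A \<gamma> t = vector_derivative (snd (chart_at A (\<gamma> t)) \<circ> \<gamma>) (at t)"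

definition curve_in :: "('p::topological_space, 'e::euclidean_space) chart set \<Rightarrow> 'p set \<Rightarrow> 'p \<Rightarrow>
    (real \<Rightarrow> 'p) \<Rightarrow> bool" where
  "curve_in A S x \<gamma> \<longleftrightarrow> \<gamma> 0 = x \<and>
     (\<exists>e>0. smooth_map_on std_atlas A {-e<..<e} \<gamma> \<and> \<gamma> ` {-e<..<e} \<subseteq> S)"

text \<open>\<open>T\<^sub>xS\<close>, for a submanifold \<open>S\<close>:\<close>

definition tangent_space :: "('p::topological_space, 'e::euclidean_space) chart set \<Rightarrow> 'p set \<Rightarrow>
    'p \<Rightarrow> 'e set" where
  "tangent_space A S x = {velocity A \<gamma> 0 | \<gamma>. curve_in A S x \<gamma>}"

definition slice_chart :: "('p::topological_space, 'e::euclidean_space) chart set \<Rightarrow> 'p set \<Rightarrow>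
    ('p, 'e) chart \<Rightarrow> 'e set \<Rightarrow> bool" where
  "slice_chart A S c L \<longleftrightarrow>
     smooth_chart A c \<and> subspace L \<and> snd c ` (S \<inter> fst c) = chart_img c \<inter> L"

definition embedded_submanifold :: "('p::topological_space, 'e::euclidean_space) chart set \<Rightarrow>
    'p set \<Rightarrow> bool" where
  "embedded_submanifold A S \<longleftrightarrow>
     (\<exists>k. \<forall>x\<in>S. \<exists>c L. slice_chart A S c L \<and> x \<in> fst c \<and> dim L = k)"

definition differential :: "('p, 'e::euclidean_space) chart set \<Rightarrow> ('p \<Rightarrow> real) \<Rightarrow> 'p \<Rightarrow> 'e \<Rightarrow> real" where
  "differential A H x = frechet_derivative (H \<circ> chart_inv (chart_at A x)) (at (snd (chart_at A x) x))"

definition hessian :: "('e::euclidean_space \<Rightarrow> real) \<Rightarrow> 'e \<Rightarrow> 'e \<Rightarrow> 'e \<Rightarrow> real" where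
  "hessian f y u v =
     frechet_derivative (\<lambda>y'. frechet_derivative f (at y') v) (at y) u"

definition critical_point :: "('p::topological_space, 'e::euclidean_space) chart set \<Rightarrow> 'p set \<Rightarrow>
    ('p \<Rightarrow> real) \<Rightarrow> 'p \<Rightarrow> bool" where
  "critical_point A N H x \<longleftrightarrow> (\<forall>u \<in> tangent_space A N x. differential A H x u = 0)"

text \<open>For a critical point \<open>x\<close> of \<open>H\<close> restricted to the submanifold \<open>N\<close>. The coordinates of \<open>N\<close>
  are those of a slice chart of \<open>N\<close>, in which \<open>N\<close> is an open subset of \<open>L\<close>; nonsingularity of
  the Hessian at a critical point does not depend on their choice.\<close>

definition nondegenerate_critical_point ::
    "('p::topological_space, 'e::euclidean_space) chart set \<Rightarrow> 'p set \<Rightarrow> ('p \<Rightarrow> real) \<Rightarrow> 'p \<Rightarrow> bool" where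
  "nondegenerate_critical_point A N H x \<longleftrightarrow>
     (\<forall>c L. slice_chart A N c L \<and> x \<in> fst c \<longrightarrow>
        (\<forall>u\<in>L. (\<forall>v\<in>L. hessian (H \<circ> chart_inv c) (snd c x) u v = 0) \<longrightarrow> u = 0))"

text \<open>\<open>\<omega> p\<close> is a bilinear form on the tangent space at \<open>p\<close>; the following is its coordinate
  expression at the point with coordinates \<open>y\<close> in the chart \<open>c\<close>.\<close>

definition form_in_chart :: "('p, 'e::euclidean_space) chart set \<Rightarrow> ('p \<Rightarrow> 'e \<Rightarrow> 'e \<Rightarrow> real) \<Rightarrow>
    ('p, 'e) chart \<Rightarrow> 'e \<Rightarrow> 'e \<Rightarrow> 'e \<Rightarrow> real" where
  "form_in_chart A \<omega> c y u v =
     (let p = chart_inv c y;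
          T = frechet_derivative (snd (chart_at A p) \<circ> chart_inv c) (at y)
      in \<omega> p (T u) (T v))"

definition smooth_2form :: "('p, 'e::euclidean_space) chart set \<Rightarrow> ('p \<Rightarrow> 'e \<Rightarrow> 'e \<Rightarrow> real) \<Rightarrow> bool" where
  "smooth_2form A \<omega> \<longleftrightarrow>
     (\<forall>p. bilinear (\<omega> p) \<and> (\<forall>u. \<omega> p u u = 0)) \<and>
     (\<forall>c\<in>A. \<forall>u v. smooth_on (chart_img c) (\<lambda>y. form_in_chart A \<omega> c y u v))"

text \<open>\<open>d\<omega> = 0\<close>, evaluated on constant vector fields \<open>u\<close>, \<open>v\<close>, \<open>w\<close> in a chart:\<close>

definition closed_2form :: "('p, 'e::euclidean_space) chart set \<Rightarrow> ('p \<Rightarrow> 'e \<Rightarrow> 'e \<Rightarrow> real) \<Rightarrow> bool" where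
  "closed_2form A \<omega> \<longleftrightarrow> (\<forall>c\<in>A. \<forall>y \<in> chart_img c. \<forall>u v w.
     frechet_derivative (\<lambda>y. form_in_chart A \<omega> c y v w) (at y) u +
     frechet_derivative (\<lambda>y. form_in_chart A \<omega> c y w u) (at y) v +
     frechet_derivative (\<lambda>y. form_in_chart A \<omega> c y u v) (at y) w = 0)"

definition symplectic_manifold ::
    "('p::{t2_space, second_countable_topology}, 'e::euclidean_space) chart set \<Rightarrow>
     ('p \<Rightarrow> 'e \<Rightarrow> 'e \<Rightarrow> real) \<Rightarrow> bool" where
  "symplectic_manifold A \<omega> \<longleftrightarrow> smooth_atlas A \<and> smooth_2form A \<omega> \<and> closed_2form A \<omega> \<and>
     (\<forall>p u. (\<forall>v. \<omega> p u v = 0) \<longrightarrow> u = 0)"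

text \<open>\<open>f\<close> maps the submanifold \<open>S\<close> smoothly into itself and preserves the pull-back of \<open>\<omega>\<close> to \<open>S\<close>.
  Tangent vectors of \<open>S\<close> are given as velocities of curves in \<open>S\<close>, and the tangent map of \<open>f\<close>
  sends the velocity of \<open>\<gamma>\<close> to that of \<open>f \<circ> \<gamma>\<close>.\<close>

definition symplectic_map_on :: "('p::topological_space, 'e::euclidean_space) chart set \<Rightarrow>
    ('p \<Rightarrow> 'e \<Rightarrow> 'e \<Rightarrow> real) \<Rightarrow> 'p set \<Rightarrow> ('p \<Rightarrow> 'p) \<Rightarrow> bool" where
  "symplectic_map_on A \<omega> S f \<longleftrightarrow> f ` S \<subseteq> S \<and> smooth_map_on A A S f \<and>
     (\<forall>x\<in>S. \<forall>\<gamma> \<delta>. curve_in A S x \<gamma> \<and> curve_in A S x \<delta> \<longrightarrow>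
        \<omega> (f x) (velocity A (f \<circ> \<gamma>) 0) (velocity A (f \<circ> \<delta>) 0)
          = \<omega> x (velocity A \<gamma> 0) (velocity A \<delta> 0))"

definition hamiltonian_vf :: "('p, 'e::euclidean_space) chart set \<Rightarrow> ('p \<Rightarrow> 'e \<Rightarrow> 'e \<Rightarrow> real) \<Rightarrow>
    ('p \<Rightarrow> real) \<Rightarrow> 'p \<Rightarrow> 'e" where
  "hamiltonian_vf A \<omega> H z = (THE X. \<forall>u. \<omega> z X u = differential A H z u)"

definition is_method :: "('p::topological_space, 'e::euclidean_space) chart set \<Rightarrow>
    ('p \<Rightarrow> 'e \<Rightarrow> 'e \<Rightarrow> real) \<Rightarrow> ('p \<Rightarrow> real) \<Rightarrow> real set \<Rightarrow> (real \<Rightarrow> 'p \<Rightarrow> 'p) \<Rightarrow> bool" where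
  "is_method A \<omega> H I \<phi> \<longleftrightarrow> open I \<and> is_interval I \<and> 0 \<in> I \<and>
     (\<forall>h\<in>I. diffeomorphism A (\<phi> h)) \<and>
     smooth_map_on (prod_atlas std_atlas A) A (I \<times> UNIV) (\<lambda>(h, z). \<phi> h z) \<and>
     \<phi> 0 = id \<and>
     (\<forall>z. velocity A (\<lambda>h. \<phi> h z) 0 = hamiltonian_vf A \<omega> H z)"

definition symplectic_method :: "('p::topological_space, 'e::euclidean_space) chart set \<Rightarrow>
    ('p \<Rightarrow> 'e \<Rightarrow> 'e \<Rightarrow> real) \<Rightarrow> ('p \<Rightarrow> real) \<Rightarrow> real set \<Rightarrow> (real \<Rightarrow> 'p \<Rightarrow> 'p) \<Rightarrow> bool" where
  "symplectic_method A \<omega> H I \<phi> \<longleftrightarrow>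
     is_method A \<omega> H I \<phi> \<and> (\<forall>h\<in>I. symplectic_map_on A \<omega> UNIV (\<phi> h))"

definition coisotropic :: "('p::topological_space, 'e::euclidean_space) chart set \<Rightarrow>
    ('p \<Rightarrow> 'e \<Rightarrow> 'e \<Rightarrow> real) \<Rightarrow> 'p set \<Rightarrow> bool" where
  "coisotropic A \<omega> M \<longleftrightarrow> embedded_submanifold A M \<and>
     (\<forall>z\<in>M. {u. \<forall>v \<in> tangent_space A M z. \<omega> z u v = 0} \<subseteq> tangent_space A M z)"

text \<open>\<open>ker \<nu>\<^sub>z\<close>, where \<open>\<nu>\<^sub>z\<close> is the restriction of \<open>\<omega> z\<close> to \<open>T\<^sub>zM\<close>:\<close>

definition ker_form :: "('p::topological_space, 'e::euclidean_space) chart set \<Rightarrow>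
    ('p \<Rightarrow> 'e \<Rightarrow> 'e \<Rightarrow> real) \<Rightarrow> 'p set \<Rightarrow> 'p \<Rightarrow> 'e set" where
  "ker_form A \<omega> M z =
     {u \<in> tangent_space A M z. \<forall>v \<in> tangent_space A M z. \<omega> z u v = 0}"

definition integral_manifold :: "('p::topological_space, 'e::euclidean_space) chart set \<Rightarrow>
    ('p \<Rightarrow> 'e \<Rightarrow> 'e \<Rightarrow> real) \<Rightarrow> 'p set \<Rightarrow> 'p set \<Rightarrow> bool" where
  "integral_manifold A \<omega> M N \<longleftrightarrow> embedded_submanifold A N \<and> N \<subseteq> M \<and>
     (\<forall>y\<in>N. tangent_space A N y = ker_form A \<omega> M y)"

text \<open>The leaf topology on \<open>M\<close>: the embedded integral manifolds of \<open>ker \<nu>\<close> (such as the plaques of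
  foliation charts) are its basic open sets, and the leaves are its connected components. A leaf
  is in general only immersed in \<open>M\<close>; its embedded open pieces are integral manifolds.\<close>

definition leaf_topology :: "('p::topological_space, 'e::euclidean_space) chart set \<Rightarrow>
    ('p \<Rightarrow> 'e \<Rightarrow> 'e \<Rightarrow> real) \<Rightarrow> 'p set \<Rightarrow> 'p topology" where
  "leaf_topology A \<omega> M = topology_generated_by {N. integral_manifold A \<omega> M N}"

definition fibre :: "('p::topological_space, 'e::euclidean_space) chart set \<Rightarrow>
    ('p \<Rightarrow> 'e \<Rightarrow> 'e \<Rightarrow> real) \<Rightarrow> 'p set \<Rightarrow> 'p \<Rightarrow> 'p set" where
  "fibre A \<omega> M z = connected_component_of_set (leaf_topology A \<omega> M) z"

definition local_fibre :: "('p::topological_space, 'e::euclidean_space) chart set \<Rightarrow>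
    ('p \<Rightarrow> 'e \<Rightarrow> 'e \<Rightarrow> real) \<Rightarrow> 'p set \<Rightarrow> 'p set \<Rightarrow> 'p \<Rightarrow> 'p set" where
  "local_fibre A \<omega> M W z =
     connected_component_of_set (subtopology (leaf_topology A \<omega> M) (fibre A \<omega> M z \<inter> W)) z"

text \<open>Being critical and nondegenerate is local, so the restriction of \<open>H\<close> to a fibre is
  studied on the embedded open pieces of that fibre.\<close>

definition fibrewise_nondegenerate :: "('p::topological_space, 'e::euclidean_space) chart set \<Rightarrow>
    ('p \<Rightarrow> 'e \<Rightarrow> 'e \<Rightarrow> real) \<Rightarrow> 'p set \<Rightarrow> ('p \<Rightarrow> real) \<Rightarrow> bool" where
  "fibrewise_nondegenerate A \<omega> M H \<longleftrightarrow>
     (\<forall>z\<in>M. \<forall>N. integral_manifold A \<omega> M N \<and> N \<subseteq> fibre A \<omega> M z \<longrightarrow>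
        (\<forall>x\<in>N. critical_point A N H x \<longrightarrow> nondegenerate_critical_point A N H x))"

definition hidden_constraint_set :: "('p::topological_space, 'e::euclidean_space) chart set \<Rightarrow>
    ('p \<Rightarrow> 'e \<Rightarrow> 'e \<Rightarrow> real) \<Rightarrow> 'p set \<Rightarrow> ('p \<Rightarrow> real) \<Rightarrow> 'p set" where
  "hidden_constraint_set A \<omega> M H =
     {z \<in> M. \<exists>u \<in> tangent_space A M z. \<forall>v \<in> tangent_space A M z. differential A H z v = \<omega> z u v}"

definition hidden_proj :: "('p::topological_space, 'e::euclidean_space) chart set \<Rightarrow>
    ('p \<Rightarrow> 'e \<Rightarrow> 'e \<Rightarrow> real) \<Rightarrow> 'p set \<Rightarrow> ('p \<Rightarrow> real) \<Rightarrow> 'p set \<Rightarrow> 'p \<Rightarrow> 'p" where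
  "hidden_proj A \<omega> M H W x =
     (THE y. y \<in> local_fibre A \<omega> M W x \<inter> hidden_constraint_set A \<omega> M H)"

definition shake_shift :: "('p::topological_space, 'e::euclidean_space) chart set \<Rightarrow>
    ('p \<Rightarrow> 'e \<Rightarrow> 'e \<Rightarrow> real) \<Rightarrow> 'p set \<Rightarrow> 'p set \<Rightarrow> ('p \<Rightarrow> 'p) \<Rightarrow> 'p \<Rightarrow> 'p" where
  "shake_shift A \<omega> M W \<phi>h z = (THE z'. z' \<in> local_fibre A \<omega> M W z \<and> \<phi>h z' \<in> M)"

definition shake_map :: "('p::topological_space, 'e::euclidean_space) chart set \<Rightarrow>
    ('p \<Rightarrow> 'e \<Rightarrow> 'e \<Rightarrow> real) \<Rightarrow> 'p set \<Rightarrow> 'p set \<Rightarrow> ('p \<Rightarrow> 'p) \<Rightarrow> 'p \<Rightarrow> 'p" where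
  "shake_map A \<omega> M W \<phi>h = \<phi>h \<circ> shake_shift A \<omega> M W \<phi>h"

definition rattle_map :: "('p::topological_space, 'e::euclidean_space) chart set \<Rightarrow>
    ('p \<Rightarrow> 'e \<Rightarrow> 'e \<Rightarrow> real) \<Rightarrow> 'p set \<Rightarrow> ('p \<Rightarrow> real) \<Rightarrow> 'p set \<Rightarrow> ('p \<Rightarrow> 'p) \<Rightarrow> 'p \<Rightarrow> 'p" where
  "rattle_map A \<omega> M H W \<phi>h = hidden_proj A \<omega> M H W \<circ> shake_map A \<omega> M W \<phi>h"

definition modified_hidden_set :: "('p::topological_space, 'e::euclidean_space) chart set \<Rightarrow>
    ('p \<Rightarrow> 'e \<Rightarrow> 'e \<Rightarrow> real) \<Rightarrow> 'p set \<Rightarrow> 'p set \<Rightarrow> ('p \<Rightarrow> 'p) \<Rightarrow> 'p set" where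
  "modified_hidden_set A \<omega> M W \<phi>h = shake_map A \<omega> M W \<phi>h ` W"

definition shake_rattle_well_defined ::
    "('p::topological_space, 'e::euclidean_space) chart set \<Rightarrow> ('p \<Rightarrow> 'e \<Rightarrow> 'e \<Rightarrow> real) \<Rightarrow> 'p set \<Rightarrow>
     ('p \<Rightarrow> real) \<Rightarrow> (real \<Rightarrow> 'p \<Rightarrow> 'p) \<Rightarrow> 'p set \<Rightarrow> real \<Rightarrow> bool" where
  "shake_rattle_well_defined A \<omega> M H \<phi> W h0 \<longleftrightarrow>
     openin (top_of_set M) W \<and> hidden_constraint_set A \<omega> M H \<subseteq> W \<and>
     (\<forall>x\<in>W. \<exists>!y. y \<in> local_fibre A \<omega> M W x \<inter> hidden_constraint_set A \<omega> M H) \<and>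
     smooth_map_on A A W (hidden_proj A \<omega> M H W) \<and>
     (\<forall>h. 0 < \<bar>h\<bar> \<and> \<bar>h\<bar> < h0 \<longrightarrow>
        (\<forall>z\<in>W. \<exists>!z'. z' \<in> local_fibre A \<omega> M W z \<and> \<phi> h z' \<in> M) \<and>
        smooth_map_on A A W (shake_shift A \<omega> M W (\<phi> h)) \<and>
        \<phi> h ` shake_shift A \<omega> M W (\<phi> h) ` W \<subseteq> W)"

end

theory Submission
  imports Defs
begin

text \<open>Write \<open>K\<close> for the kernel of \<open>\<nu>\<close>. In a slice chart of \<open>M\<close>, \<open>K\<close> is spanned along \<open>M\<close> by
  the fields \<open>X\<close> for which \<open>\<omega>(X, \<cdot>)\<close> is a constant covector annihilating \<open>TM\<close>. The projection \<open>\<pi>\<close>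
  onto the hidden constraint set is constant on local fibres, so \<open>\<eta> = \<pi>\<^sup>*\<omega> - \<omega>\<close> is a closed form
  with \<open>i\<^sub>X\<eta> = 0\<close> along \<open>M\<close>, hence \<open>L\<^sub>X\<eta> = 0\<close>: along a curve in a leaf the coefficients of \<open>\<eta>\<close> on \<open>TM\<close>
  solve a linear differential equation, and \<open>\<eta>\<close> vanishes on a whole local fibre if it vanishes at one of its points.
  At a hidden point \<open>y\<close> it does vanish, since nondegeneracy makes the hidden set transverse to the leaf and
  \<open>\<pi>\<close> fixes it, so that \<open>d\<pi> u - u\<close> lies in \<open>K\<close> for every \<open>u\<close> tangent to \<open>M\<close>. Thus \<open>\<pi>\<close> preserves
  \<open>\<nu>\<close>, and so does \<open>\<Gamma>\<close>, because \<open>\<pi> \<circ> \<Gamma> = \<pi>\<close>; the maps \<open>S = \<phi> \<circ> \<Gamma>\<close> and \<open>R = \<pi> \<circ> S\<close> follow.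

  Neither Frobenius' theorem nor flows are needed: that the fibres meet the hidden set already provides an
  integral manifold through every point of \<open>W\<close>.\<close>

section \<open>Calculus of smooth maps\<close>

text \<open>The field \<open>X\<close> has to lie in \<open>K\<close> on all of \<open>M\<close>
  near a curve, not only on the curve, since its derivative enters the Lie derivative. Freezing the
  covector of the velocity while the base point moves achieves this: in a slice chart the
  annihilator of \<open>TM\<close> is one fixed subspace, and coisotropy places every vector that
  corresponds to it inside \<open>TM\<close>. A local fibre is only a connected component of an
  abstract topology, and no path between two of its points is at hand. Hence transport is done along
  segments inside single plaques, and the property of being preserved is spread by local constancy.
  For this the plaques must be connected in a topology generated by all integral manifolds, which is
  the uniqueness half of Frobenius' theorem: integral manifolds through a common point agree near
  it. Only the derivative of \<pi> at one hidden point is required, so the hidden set is not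
  parametrized there. Points of it close to a given direction are found by a fixed point argument,
  and the derivative is read off from the fact that \<pi> fixes them.\<close>

abbreviation fd :: "('a::real_normed_vector \<Rightarrow> 'b::real_normed_vector) \<Rightarrow> 'a \<Rightarrow> 'a \<Rightarrow> 'b" where
  "fd f x \<equiv> frechet_derivative f (at x)"

lemma fd_eqI: "(f has_derivative f') (at x) \<Longrightarrow> fd f x = f'"
  using frechet_derivative_at by metis

lemma Ck_on_cong:
  assumes "open U" "\<And>x. x \<in> U \<Longrightarrow> f x = g x" "Ck_on k U f"
  shows "Ck_on k U g"
  using assms(2,3)
proof (induction k arbitrary: f g)
  case 0
  then show ?case by (simp cong: continuous_on_cong)
next
  case (Suc k)
  have der: "(g has_derivative fd f x) (at x)" if "x \<in> U" for x
    using Suc.prems that assms(1)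
    by (auto intro!: has_derivative_transform_within_open[of f _ x UNIV U g] simp: frechet_derivative_works)
  have "fd g x = fd f x" if "x \<in> U" for x
    using der[OF that] by (rule fd_eqI)
  then have "Ck_on k U (\<lambda>x. fd g x v)" for v
    using Suc.prems Suc.IH[of "\<lambda>x. fd f x v" "\<lambda>x. fd g x v"] by auto
  moreover have "g differentiable (at x)" if "x \<in> U" for x
    using der[OF that] differentiableI by blast
  ultimately show ?case by simp
qed

text \<open>\<open>Ck_on (Suc k)\<close> speaks only of first derivatives, so monotonicity in
  \<open>k\<close> is pushed down to level zero, where differentiability gives continuity.\<close>

lemma Ck_on_SucD: "Ck_on (Suc k) U f \<Longrightarrow> Ck_on k U f"
proof (induction k arbitrary: f)
  case 0
  then show ?case
    by (simp add: continuous_at_imp_continuous_on differentiable_imp_continuous_within)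
next
  case (Suc k)
  then show ?case by simp
qed

lemma Ck_on_subset: "Ck_on k U f \<Longrightarrow> V \<subseteq> U \<Longrightarrow> Ck_on k V f"
  by (induction k arbitrary: f) (auto intro: continuous_on_subset)

lemma Ck_on_local:
  assumes "\<And>x. x \<in> U \<Longrightarrow> \<exists>V. open V \<and> x \<in> V \<and> Ck_on k V f"
  shows "Ck_on k U f"
  using assms
proof (induction k arbitrary: f)
  case 0
  have "isCont f x" if "x \<in> U" for x
    using 0[OF that] by (auto simp: continuous_on_eq_continuous_at)
  then show ?case by (simp add: continuous_at_imp_continuous_on)
next
  case (Suc k)
  have "Ck_on k U (\<lambda>x. fd f x v)" for v
  proof (rule Suc.IH)
    show "\<exists>V. open V \<and> x \<in> V \<and> Ck_on k V (\<lambda>x. fd f x v)" if "x \<in> U" for x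
      using Suc.prems[OF that] by auto
  qed
  moreover have "f differentiable (at x)" if "x \<in> U" for x
    using Suc.prems[OF that] by auto
  ultimately show ?case by simp
qed

lemma Ck_on_const: "Ck_on k U (\<lambda>x. c)"
  by (induction k arbitrary: c) auto

lemma Ck_on_linear: "bounded_linear A \<Longrightarrow> Ck_on k U A"
proof (cases k)
  case 0
  assume "bounded_linear A"
  then show ?thesis using 0 by (simp add: linear_continuous_on)
next
  case (Suc j)
  assume A: "bounded_linear A"
  then have "fd A x = A" for x
    by (intro fd_eqI bounded_linear_imp_has_derivative)
  then show ?thesis using Suc A
    by (simp add: Ck_on_const bounded_linear_imp_differentiable)
qed

lemma Ck_on_bounded_linear_compose:
  assumes "bounded_linear A" "Ck_on k U f" "open U"
  shows "Ck_on k U (\<lambda>x. A (f x))"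
  using assms(2)
proof (induction k arbitrary: f)
  case 0
  then show ?case using assms(1)
    by (simp add: bounded_linear.continuous_on)
next
  case (Suc k)
  have der: "((\<lambda>x. A (f x)) has_derivative (\<lambda>v. A (fd f x v))) (at x)" if "x \<in> U" for x
    using Suc.prems that
    by (intro bounded_linear.has_derivative[OF assms(1)]) (auto simp: frechet_derivative_works)
  have "Ck_on k U (\<lambda>x. A (fd f x v))" for v
    using Suc by auto
  then have "Ck_on k U (\<lambda>x. fd (\<lambda>x. A (f x)) x v)" for v
    by (rule Ck_on_cong[OF \<open>open U\<close>, rotated]) (simp add: fd_eqI[OF der])
  then show ?case using der differentiableI by fastforce
qed

lemma Ck_on_add:
  assumes "Ck_on k U f" "Ck_on k U g" "open U"
  shows "Ck_on k U (\<lambda>x. f x + g x)"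
  using assms(1,2)
proof (induction k arbitrary: f g)
  case 0
  then show ?case by (simp add: continuous_on_add)
next
  case (Suc k)
  have der: "((\<lambda>x. f x + g x) has_derivative (\<lambda>v. fd f x v + fd g x v)) (at x)" if "x \<in> U" for x
    using Suc.prems that by (intro has_derivative_add) (auto simp: frechet_derivative_works)
  have "Ck_on k U (\<lambda>x. fd f x v + fd g x v)" for v
    using Suc by auto
  then have "Ck_on k U (\<lambda>x. fd (\<lambda>x. f x + g x) x v)" for v
    by (rule Ck_on_cong[OF \<open>open U\<close>, rotated]) (simp add: fd_eqI[OF der])
  then show ?case using der differentiableI by fastforce
qed

lemma Ck_on_scaleR:
  fixes f :: "'a::euclidean_space \<Rightarrow> real"
  assumes "Ck_on k U f" "Ck_on k U g" "open U"
  shows "Ck_on k U (\<lambda>x. f x *\<^sub>R g x)"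
  using assms(1,2)
proof (induction k arbitrary: f g)
  case 0
  then show ?case by (simp add: continuous_on_scaleR)
next
  case (Suc k)
  have der: "((\<lambda>x. f x *\<^sub>R g x) has_derivative (\<lambda>v. f x *\<^sub>R fd g x v + fd f x v *\<^sub>R g x)) (at x)"
    if "x \<in> U" for x
    using Suc.prems that by (intro has_derivative_scaleR) (auto simp: frechet_derivative_works)
  have "Ck_on k U (\<lambda>x. f x *\<^sub>R fd g x v + fd f x v *\<^sub>R g x)" for v
    using Suc.prems Ck_on_SucD[OF Suc.prems(1)] Ck_on_SucD[OF Suc.prems(2)]
    by (intro Ck_on_add Suc.IH assms(3)) auto
  then have "Ck_on k U (\<lambda>x. fd (\<lambda>x. f x *\<^sub>R g x) x v)" for v
    by (rule Ck_on_cong[OF \<open>open U\<close>, rotated]) (simp add: fd_eqI[OF der])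
  then show ?case using der differentiableI by fastforce
qed

lemma Ck_on_sum:
  assumes "\<And>i. i \<in> I \<Longrightarrow> Ck_on k U (f i)" "open U"
  shows "Ck_on k U (\<lambda>x. \<Sum>i\<in>I. f i x)"
  using assms
  by (induction I rule: infinite_finite_induct) (auto intro: Ck_on_const Ck_on_add)

text \<open>Turns a linear map whose argument varies as well into a finite sum of products, so that
  values at fixed basis vectors are all that has to be differentiated.\<close>

lemma linear_Basis_expand:
  fixes f :: "'a::euclidean_space \<Rightarrow> 'b::real_vector"
  assumes "linear f"
  shows "f v = (\<Sum>b\<in>Basis. (v \<bullet> b) *\<^sub>R f b)"
proof -
  have "f v = f (\<Sum>b\<in>Basis. (v \<bullet> b) *\<^sub>R b)" by (simp add: euclidean_representation)
  also have "\<dots> = (\<Sum>b\<in>Basis. (v \<bullet> b) *\<^sub>R f b)"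
    using assms by (simp add: linear_sum linear_scale)
  finally show ?thesis .
qed

lemma Ck_on_compose:
  fixes g :: "'a::euclidean_space \<Rightarrow> 'b::euclidean_space"
  assumes "Ck_on k V f" "Ck_on k U g" "open U" "open V" "g ` U \<subseteq> V"
  shows "Ck_on k U (\<lambda>x. f (g x))"
  using assms(1,2)
proof (induction k arbitrary: f)
  case 0
  then show ?case
    using assms continuous_on_compose2 by fastforce
next
  case (Suc k)
  have der: "((\<lambda>x. f (g x)) has_derivative (\<lambda>v. fd f (g x) (fd g x v))) (at x)" if "x \<in> U" for x
    using Suc.prems that assms(5) has_derivative_compose[of g "fd g x" x UNIV f "fd f (g x)"]
    by (auto simp: frechet_derivative_works)
  have lin: "linear (fd f (g x))" if "x \<in> U" for x
    using Suc.prems that assms(5) by (intro linear_frechet_derivative) auto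
  \<comment> \<open>The induction hypothesis covers the outer derivative in a fixed direction only,
    but the direction \<open>fd g x v\<close> moves with \<open>x\<close>; the expansion moves this
    dependence into scalar factors.\<close>
  have "Ck_on k U (\<lambda>x. \<Sum>b\<in>Basis. (fd g x v \<bullet> b) *\<^sub>R fd f (g x) b)" for v
  proof (intro Ck_on_sum Ck_on_scaleR assms(3))
    fix b :: 'b
    show "Ck_on k U (\<lambda>x. fd g x v \<bullet> b)"
      using Suc.prems assms(3) by (intro Ck_on_bounded_linear_compose[OF bounded_linear_inner_left]) auto
    show "Ck_on k U (\<lambda>x. fd f (g x) b)"
      using Suc.prems Ck_on_SucD[OF Suc.prems(2)] by (intro Suc.IH[of "\<lambda>y. fd f y b"]) auto
  qed
  then have "Ck_on k U (\<lambda>x. fd (\<lambda>x. f (g x)) x v)" for v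
    by (rule Ck_on_cong[OF \<open>open U\<close>, rotated])
       (simp add: fd_eqI[OF der] linear_Basis_expand[OF lin, symmetric])
  then show ?case using der differentiableI by fastforce
qed

lemma smooth_on_cong:
  "open U \<Longrightarrow> (\<And>x. x \<in> U \<Longrightarrow> f x = g x) \<Longrightarrow> smooth_on U f \<Longrightarrow> smooth_on U g"
  unfolding smooth_on_def by (blast intro: Ck_on_cong)

lemma smooth_on_subset: "smooth_on U f \<Longrightarrow> V \<subseteq> U \<Longrightarrow> smooth_on V f"
  unfolding smooth_on_def by (blast intro: Ck_on_subset)

lemma smooth_on_local:
  "(\<And>x. x \<in> U \<Longrightarrow> \<exists>V. open V \<and> x \<in> V \<and> smooth_on V f) \<Longrightarrow> smooth_on U f"
  unfolding smooth_on_def by (intro allI Ck_on_local) blast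

lemma smooth_on_const: "smooth_on U (\<lambda>x. c)"
  unfolding smooth_on_def by (simp add: Ck_on_const)

lemma smooth_on_linear: "bounded_linear A \<Longrightarrow> smooth_on U A"
  unfolding smooth_on_def by (simp add: Ck_on_linear)

lemma smooth_on_bounded_linear_compose:
  "bounded_linear A \<Longrightarrow> smooth_on U f \<Longrightarrow> open U \<Longrightarrow> smooth_on U (\<lambda>x. A (f x))"
  unfolding smooth_on_def by (simp add: Ck_on_bounded_linear_compose)

lemma smooth_on_add:
  "smooth_on U f \<Longrightarrow> smooth_on U g \<Longrightarrow> open U \<Longrightarrow> smooth_on U (\<lambda>x. f x + g x)"
  unfolding smooth_on_def by (simp add: Ck_on_add)

lemma smooth_on_scaleR:
  "smooth_on U f \<Longrightarrow> smooth_on U g \<Longrightarrow> open U \<Longrightarrow> smooth_on U (\<lambda>x. f x *\<^sub>R g x)"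
  unfolding smooth_on_def by (simp add: Ck_on_scaleR)

lemma smooth_on_sum:
  "(\<And>i. i \<in> I \<Longrightarrow> smooth_on U (f i)) \<Longrightarrow> open U \<Longrightarrow> smooth_on U (\<lambda>x. \<Sum>i\<in>I. f i x)"
  unfolding smooth_on_def by (simp add: Ck_on_sum)

lemma smooth_on_compose:
  "smooth_on V f \<Longrightarrow> smooth_on U g \<Longrightarrow> open U \<Longrightarrow> open V \<Longrightarrow> g ` U \<subseteq> V \<Longrightarrow> smooth_on U (\<lambda>x. f (g x))"
  unfolding smooth_on_def by (blast intro: Ck_on_compose)

lemma smooth_on_imp_differentiable: "smooth_on U f \<Longrightarrow> x \<in> U \<Longrightarrow> f differentiable (at x)"
  unfolding smooth_on_def using Ck_on.simps(2) by blast

lemma smooth_on_has_derivative: "smooth_on U f \<Longrightarrow> x \<in> U \<Longrightarrow> (f has_derivative fd f x) (at x)"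
  using smooth_on_imp_differentiable frechet_derivative_works by blast

lemma smooth_on_imp_continuous_on: "smooth_on U f \<Longrightarrow> continuous_on U f"
  unfolding smooth_on_def using Ck_on.simps(1) by blast

lemma smooth_on_fd: "smooth_on U f \<Longrightarrow> smooth_on U (\<lambda>x. fd f x v)"
  unfolding smooth_on_def using Ck_on.simps(2) by blast

lemma smooth_on_linear_fd: "smooth_on U f \<Longrightarrow> x \<in> U \<Longrightarrow> linear (fd f x)"
  using smooth_on_imp_differentiable linear_frechet_derivative by blast

lemma smooth_on_linear_family:
  assumes "open U" "\<And>x. x \<in> U \<Longrightarrow> linear (A x)" "\<And>b. smooth_on U (\<lambda>x. A x b)" "smooth_on U f"
  shows "smooth_on U (\<lambda>x. A x (f x))"
proof -
  have "smooth_on U (\<lambda>x. \<Sum>b\<in>Basis. (f x \<bullet> b) *\<^sub>R A x b)"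
    using assms
    by (intro smooth_on_sum smooth_on_scaleR
        smooth_on_bounded_linear_compose[OF bounded_linear_inner_left]) auto
  then show ?thesis
    by (rule smooth_on_cong[OF assms(1), rotated]) (simp add: linear_Basis_expand[OF assms(2), symmetric])
qed

lemma smooth_on_bilinear_family:
  assumes "open U" "\<And>x. x \<in> U \<Longrightarrow> bilinear (B x)" "\<And>b c. smooth_on U (\<lambda>x. B x b c)"
    "smooth_on U f" "smooth_on U g"
  shows "smooth_on U (\<lambda>x. B x (f x) (g x))"
proof -
  have "smooth_on U (\<lambda>x. B x b (g x))" for b
    by (rule smooth_on_linear_family[OF assms(1) _ assms(3,5)]) (use assms(2) in \<open>simp add: bilinear_def\<close>)
  then show ?thesis
    by (intro smooth_on_linear_family[where A="\<lambda>x u. B x u (g x)", OF assms(1) _ _ assms(4)])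
       (use assms(2) in \<open>auto simp: bilinear_def\<close>)
qed

text \<open>The product rule for evaluation; the first term differentiates the family with the
  argument frozen at \<open>f x\<close>. Differentiability in each fixed direction suffices because
  the basis is finite.\<close>

lemma has_derivative_linear_family:
  fixes A :: "'a::euclidean_space \<Rightarrow> 'b::euclidean_space \<Rightarrow> 'c::euclidean_space"
  assumes "open U" "x \<in> U" "\<And>x. x \<in> U \<Longrightarrow> linear (A x)" "\<And>b. (\<lambda>y. A y b) differentiable (at x)"
    "(f has_derivative f') (at x)"
  shows "((\<lambda>y. A y (f y)) has_derivative (\<lambda>u. fd (\<lambda>y. A y (f x)) x u + A x (f' u))) (at x)"
proof -
  have d: "((\<lambda>y. A y b) has_derivative fd (\<lambda>y. A y b) x) (at x)" for b
    using assms(4) frechet_derivative_works by blast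
  have 1: "((\<lambda>y. \<Sum>b\<in>Basis. (f y \<bullet> b) *\<^sub>R A y b) has_derivative
     (\<lambda>u. \<Sum>b\<in>Basis. (f x \<bullet> b) *\<^sub>R fd (\<lambda>y. A y b) x u + (f' u \<bullet> b) *\<^sub>R A x b)) (at x)"
    by (intro has_derivative_sum has_derivative_scaleR has_derivative_inner_left assms(5) d)
  have 2: "((\<lambda>y. \<Sum>b\<in>Basis. (w \<bullet> b) *\<^sub>R A y b) has_derivative
     (\<lambda>u. \<Sum>b\<in>Basis. (w \<bullet> b) *\<^sub>R fd (\<lambda>y. A y b) x u)) (at x)" for w
    by (intro has_derivative_sum has_derivative_scaleR_right d)
  have d3: "((\<lambda>y. A y w) has_derivative (\<lambda>u. \<Sum>b\<in>Basis. (w \<bullet> b) *\<^sub>R fd (\<lambda>y. A y b) x u)) (at x)" for w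
    by (rule has_derivative_transform_within_open[OF 2 assms(1,2)])
       (simp add: linear_Basis_expand[OF assms(3), symmetric])
  have 3: "fd (\<lambda>y. A y w) x u = (\<Sum>b\<in>Basis. (w \<bullet> b) *\<^sub>R fd (\<lambda>y. A y b) x u)" for w u
    by (rule fun_cong[OF fd_eqI[OF d3]])
  have "((\<lambda>y. A y (f y)) has_derivative
     (\<lambda>u. \<Sum>b\<in>Basis. (f x \<bullet> b) *\<^sub>R fd (\<lambda>y. A y b) x u + (f' u \<bullet> b) *\<^sub>R A x b)) (at x)"
    by (rule has_derivative_transform_within_open[OF 1 assms(1,2)])
       (simp add: linear_Basis_expand[OF assms(3), symmetric])
  then show ?thesis
    by (simp add: sum.distrib 3[symmetric] linear_Basis_expand[OF assms(3)[OF assms(2)], symmetric])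
qed

lemma has_derivative_bilinear_family:
  fixes B :: "'a::euclidean_space \<Rightarrow> 'b::euclidean_space \<Rightarrow> 'b \<Rightarrow> real"
  assumes "open U" "x \<in> U" "\<And>x. x \<in> U \<Longrightarrow> bilinear (B x)"
    "\<And>b c. (\<lambda>y. B y b c) differentiable (at x)"
    "(f has_derivative f') (at x)" "(g has_derivative g') (at x)"
  shows "((\<lambda>y. B y (f y) (g y)) has_derivative
    (\<lambda>u. fd (\<lambda>y. B y (f x) (g x)) x u + B x (f' u) (g x) + B x (f x) (g' u))) (at x)"
proof -
  have 1: "((\<lambda>y. B y b (g y)) has_derivative (\<lambda>u. fd (\<lambda>y. B y b (g x)) x u + B x b (g' u))) (at x)" for b
    by (rule has_derivative_linear_family[where A="\<lambda>y. B y b", OF assms(1,2) _ assms(4,6)])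
       (use assms(3) in \<open>simp add: bilinear_def\<close>)
  have "((\<lambda>y. B y (f y) (g y)) has_derivative
    (\<lambda>u. fd (\<lambda>y. B y (f x) (g y)) x u + B x (f' u) (g x))) (at x)"
    by (rule has_derivative_linear_family[where A="\<lambda>y v. B y v (g y)", OF assms(1,2) _ _ assms(5)])
       (use assms(3) differentiableI[OF 1] in \<open>auto simp: bilinear_def\<close>)
  then show ?thesis
    by (simp add: fd_eqI[OF 1] algebra_simps)
qed

section \<open>Symmetry of second derivatives\<close>

text \<open>The mean value theorem is applied twice: to \<open>g\<close>, the increment of
  \<open>f\<close> along \<open>v\<close> as a function of the step along \<open>u\<close>, and then
  to the resulting derivative as a function of the step along \<open>v\<close>.\<close>

lemma second_difference_mean_value:
  fixes f :: "'a::euclidean_space \<Rightarrow> real"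
  assumes f: "smooth_on U f" and h: "0 < h"
    and U: "\<And>s t. 0 \<le> s \<Longrightarrow> s \<le> h \<Longrightarrow> 0 \<le> t \<Longrightarrow> t \<le> h \<Longrightarrow> x + s *\<^sub>R u + t *\<^sub>R v \<in> U"
  obtains s t where "0 < s" "s < h" "0 < t" "t < h"
    "f (x + h *\<^sub>R u + h *\<^sub>R v) - f (x + h *\<^sub>R u) - f (x + h *\<^sub>R v) + f x
      = h\<^sup>2 * fd (\<lambda>y. fd f y u) (x + s *\<^sub>R u + t *\<^sub>R v) v"
proof -
  define g where "g s = f (x + s *\<^sub>R u + h *\<^sub>R v) - f (x + s *\<^sub>R u)" for s
  have along: "((\<lambda>s. F (y + s *\<^sub>R w)) has_real_derivative fd F (y + s *\<^sub>R w) w) (at s)"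
    if F: "smooth_on U F" "y + s *\<^sub>R w \<in> U" for F :: "'a \<Rightarrow> real" and y w s
  proof -
    have "((\<lambda>s. F (y + s *\<^sub>R w)) has_derivative (\<lambda>r. fd F (y + s *\<^sub>R w) (r *\<^sub>R w))) (at s)"
      by (rule has_derivative_compose[where g=F and f="\<lambda>s. y + s *\<^sub>R w", OF _ smooth_on_has_derivative[OF F]])
         (auto intro!: derivative_eq_intros)
    moreover have "fd F (y + s *\<^sub>R w) (r *\<^sub>R w) = r * fd F (y + s *\<^sub>R w) w" for r
      using linear_scale[OF smooth_on_linear_fd[OF F]] by simp
    ultimately show ?thesis
      by (simp add: has_field_derivative_def mult_commute_abs)
  qed
  have dg: "(g has_real_derivative (fd f (x + s *\<^sub>R u + h *\<^sub>R v) u - fd f (x + s *\<^sub>R u) u)) (at s)"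
    if "0 \<le> s" "s \<le> h" for s
    unfolding g_def
    using along[OF f, of "x + h *\<^sub>R v" s u] along[OF f, of x s u] U[of s h] U[of s 0] that h
    by (intro DERIV_diff) (simp_all add: algebra_simps)
  obtain s where s: "0 < s" "s < h"
    and gs: "g h - g 0 = (h - 0) * (fd f (x + s *\<^sub>R u + h *\<^sub>R v) u - fd f (x + s *\<^sub>R u) u)"
    using MVT2[OF h dg] by blast
  have dk: "((\<lambda>t. fd f (x + s *\<^sub>R u + t *\<^sub>R v) u) has_real_derivative
      fd (\<lambda>y. fd f y u) (x + s *\<^sub>R u + t *\<^sub>R v) v) (at t)" if "0 \<le> t" "t \<le> h" for t
    using along[OF smooth_on_fd[OF f], of "x + s *\<^sub>R u" t v u] U[of s t] s that by simp
  obtain t where t: "0 < t" "t < h"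
    and ht: "fd f (x + s *\<^sub>R u + h *\<^sub>R v) u - fd f (x + s *\<^sub>R u + 0 *\<^sub>R v) u
      = (h - 0) * fd (\<lambda>y. fd f y u) (x + s *\<^sub>R u + t *\<^sub>R v) v"
    using MVT2[OF h dk] by blast
  show thesis
    using that[OF s t] gs ht by (simp add: g_def power2_eq_square algebra_simps)
qed

text \<open>The second difference is symmetric in \<open>u\<close> and \<open>v\<close>; divided by
  the square of the step it is a value of either mixed derivative at a nearby point, and continuity
  of both forces equality at \<open>x\<close>.\<close>

lemma fd_commute_real:
  fixes f :: "'a::euclidean_space \<Rightarrow> real"
  assumes f: "smooth_on U f" and "open U" "x \<in> U"
  shows "fd (\<lambda>y. fd f y u) x v = fd (\<lambda>y. fd f y v) x u"
proof (rule ccontr)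
  define a where "a = (\<lambda>y. fd (\<lambda>y. fd f y u) y v)"
  define b where "b = (\<lambda>y. fd (\<lambda>y. fd f y v) y u)"
  assume "\<not> ?thesis"
  then have ne: "a x \<noteq> b x" by (simp add: a_def b_def)
  define e where "e = \<bar>a x - b x\<bar> / 2"
  have e: "e > 0" using ne by (simp add: e_def)
  have "isCont a x" "isCont b x"
    using smooth_on_imp_continuous_on[OF smooth_on_fd[OF smooth_on_fd[OF f]]] assms(2,3)
    by (auto simp: a_def b_def continuous_on_eq_continuous_at)
  then obtain d1 d2 where d: "d1 > 0" "d2 > 0"
    "\<And>y. dist y x < d1 \<Longrightarrow> \<bar>a y - a x\<bar> < e" "\<And>y. dist y x < d2 \<Longrightarrow> \<bar>b y - b x\<bar> < e"
    using e unfolding continuous_at_eps_delta dist_real_def by metis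
  obtain r where r: "r > 0" "ball x r \<subseteq> U"
    using assms(2,3) openE by blast
  \<comment> \<open>With this step all points of the parallelogram lie in \<open>U\<close> and
    within both continuity radii; the summand 1 keeps the denominator positive.\<close>
  define h where "h = min r (min d1 d2) / (norm u + norm v + 1)"
  have pos: "norm u + norm v + 1 > 0" by (smt (verit) norm_ge_zero)
  have h: "h > 0" using r d pos by (simp add: h_def)
  have near: "norm (s *\<^sub>R p + t *\<^sub>R q) < min r (min d1 d2)"
    if "0 \<le> s" "s \<le> h" "0 \<le> t" "t \<le> h" "{p, q} = {u, v}" for s t p q
  proof -
    have "norm (s *\<^sub>R p + t *\<^sub>R q) \<le> s * norm p + t * norm q"
      using norm_triangle_ineq[of "s *\<^sub>R p" "t *\<^sub>R q"] that by simp
    also have "\<dots> \<le> h * norm p + h * norm q"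
      using that by (intro add_mono mult_right_mono) auto
    also have "\<dots> = h * (norm u + norm v)"
      using that(5) by (auto simp: doubleton_eq_iff algebra_simps)
    also have "\<dots> < h * (norm u + norm v + 1)" using h by simp
    also have "\<dots> = min r (min d1 d2)" using pos by (simp add: h_def)
    finally show ?thesis .
  qed
  have inU: "x + s *\<^sub>R p + t *\<^sub>R q \<in> U"
    if "0 \<le> s" "s \<le> h" "0 \<le> t" "t \<le> h" "{p, q} = {u, v}" for s t p q
  proof -
    have "dist (x + s *\<^sub>R p + t *\<^sub>R q) x < r"
      using near[OF that] by (simp add: dist_norm add.assoc)
    then show ?thesis using r(2) by (auto simp: dist_commute)
  qed
  obtain s t where st: "0 < s" "s < h" "0 < t" "t < h"
    and 1: "f (x + h *\<^sub>R u + h *\<^sub>R v) - f (x + h *\<^sub>R u) - f (x + h *\<^sub>R v) + f x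
      = h\<^sup>2 * a (x + s *\<^sub>R u + t *\<^sub>R v)"
    unfolding a_def by (rule second_difference_mean_value[OF f h, of x u v]) (auto intro: inU)
  obtain s' t' where st': "0 < s'" "s' < h" "0 < t'" "t' < h"
    and 2: "f (x + h *\<^sub>R v + h *\<^sub>R u) - f (x + h *\<^sub>R v) - f (x + h *\<^sub>R u) + f x
      = h\<^sup>2 * b (x + s' *\<^sub>R v + t' *\<^sub>R u)"
    unfolding b_def by (rule second_difference_mean_value[OF f h, of x v u]) (auto intro: inU)
  have "h\<^sup>2 * a (x + s *\<^sub>R u + t *\<^sub>R v) = h\<^sup>2 * b (x + s' *\<^sub>R v + t' *\<^sub>R u)"
    using 1 2 by (simp add: algebra_simps)
  then have "a (x + s *\<^sub>R u + t *\<^sub>R v) = b (x + s' *\<^sub>R v + t' *\<^sub>R u)"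
    using h by simp
  moreover have "\<bar>a (x + s *\<^sub>R u + t *\<^sub>R v) - a x\<bar> < e"
    using near[of s t u v] st by (intro d(3)) (auto simp: dist_norm add.assoc)
  moreover have "\<bar>b (x + s' *\<^sub>R v + t' *\<^sub>R u) - b x\<bar> < e"
    using near[of s' t' v u] st' by (intro d(4)) (auto simp: dist_norm add.assoc)
  ultimately show False unfolding e_def by (auto simp: field_simps abs_if split: if_splits)
qed

lemma fd_commute:
  fixes f :: "'a::euclidean_space \<Rightarrow> 'b::euclidean_space"
  assumes f: "smooth_on U f" and "open U" "x \<in> U"
  shows "fd (\<lambda>y. fd f y u) x v = fd (\<lambda>y. fd f y v) x u"
proof (rule euclidean_eqI)
  fix b :: 'b
  have comp: "fd (\<lambda>y. g y \<bullet> b) y w = fd g y w \<bullet> b" if "smooth_on U g" "y \<in> U" for g y w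
    by (rule fun_cong[OF fd_eqI[OF has_derivative_inner_left[OF smooth_on_has_derivative[OF that]]]])
  have *: "fd (\<lambda>y. fd f y u) x v \<bullet> b = fd (\<lambda>y. fd (\<lambda>z. f z \<bullet> b) y u) x v" for u v
  proof -
    have "fd (\<lambda>y. fd f y u) x v \<bullet> b = fd (\<lambda>y. fd f y u \<bullet> b) x v"
      by (simp add: comp[OF smooth_on_fd[OF f] assms(3)])
    also have "fd (\<lambda>y. fd f y u \<bullet> b) x = fd (\<lambda>y. fd (\<lambda>z. f z \<bullet> b) y u) x"
      using has_derivative_inner_left[OF smooth_on_has_derivative[OF smooth_on_fd[OF f] assms(3)]]
      by (intro frechet_derivative_transform_within_open[OF _ assms(2,3)])
         (auto simp: comp[OF f] differentiable_def)
    finally show ?thesis .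
  qed
  show "fd (\<lambda>y. fd f y u) x v \<bullet> b = fd (\<lambda>y. fd f y v) x u \<bullet> b"
    unfolding *
    by (rule fd_commute_real[OF smooth_on_bounded_linear_compose[OF bounded_linear_inner_left f] assms(2,3)])
       (rule assms(2))
qed

section \<open>Orthogonal projections and derivatives along subspaces\<close>

lemma mem_orthogonal_comp: "b \<in> L\<^sup>\<bottom> \<longleftrightarrow> (\<forall>l\<in>L. b \<bullet> l = 0)"
  by (simp add: orthogonal_comp_def orthogonal_def inner_commute)

lemma orthogonal_projection:
  fixes L :: "'a::euclidean_space set"
  assumes "subspace L"
  obtains P where "linear P" "\<And>x. P x \<in> L" "\<And>x. x \<in> L \<Longrightarrow> P x = x" "\<And>x. x - P x \<in> L\<^sup>\<bottom>"
    "\<And>x. norm (P x) \<le> norm x"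
proof -
  obtain B where B: "B \<subseteq> L" "pairwise orthogonal B" "\<And>x. x \<in> B \<Longrightarrow> norm x = 1"
    "independent B" "span B = L"
    using orthonormal_basis_subspace[OF assms] by metis
  have fin: "finite B" using B(4) independent_imp_finite by blast
  have ortho: "b \<bullet> c = (if b = c then 1 else 0)" if "b \<in> B" "c \<in> B" for b c
    using B(2,3) that by (auto simp: pairwise_def orthogonal_def norm_eq_1)
  define P where "P x = (\<Sum>b\<in>B. (x \<bullet> b) *\<^sub>R b)" for x
  have lin: "linear P"
    unfolding P_def by (intro linear_compose_sum ballI linearI) (simp_all add: algebra_simps)
  have PL: "P x \<in> L" for x
    unfolding P_def using B(1) assms by (intro subspace_sum subspace_scale) auto
  have Pb: "P x \<bullet> c = x \<bullet> c" if "c \<in> B" for x c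
  proof -
    have "P x \<bullet> c = (\<Sum>b\<in>B. (x \<bullet> b) * (b \<bullet> c))"
      by (simp add: P_def inner_sum_left)
    also have "\<dots> = (\<Sum>b\<in>B. if b = c then x \<bullet> b else 0)"
      using that by (intro sum.cong) (auto simp: ortho)
    also have "\<dots> = x \<bullet> c" using fin that by simp
    finally show ?thesis .
  qed
  have orth: "x - P x \<in> L\<^sup>\<bottom>" for x
  proof -
    have "orthogonal (x - P x) l" if "l \<in> span B" for l
      by (rule orthogonal_to_span[OF that]) (simp add: orthogonal_def Pb inner_diff_left)
    then show ?thesis
      using B(5) by (auto simp: mem_orthogonal_comp orthogonal_def)
  qed
  have id: "P x = x" if "x \<in> L" for x
  proof -
    have "(x - P x) \<bullet> (x - P x) = 0"
      using orth[of x] PL[of x] that assms by (auto simp: mem_orthogonal_comp subspace_diff)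
    then show ?thesis by simp
  qed
  have le: "norm (P x) \<le> norm x" for x
  proof -
    have "(x - P x) \<bullet> P x = 0" using orth[of x] PL[of x] by (simp add: mem_orthogonal_comp)
    then have "(norm (P x))\<^sup>2 + (norm (x - P x))\<^sup>2 = (norm x)\<^sup>2"
      by (simp add: power2_norm_eq_inner algebra_simps inner_commute)
    then have "(norm (P x))\<^sup>2 \<le> (norm x)\<^sup>2"
      by (smt (verit) zero_le_power2)
    then show ?thesis by (simp add: abs_le_square_iff[symmetric])
  qed
  show thesis by (rule that[OF lin PL id orth le])
qed

text \<open>Pairing \<open>g\<close> with the component of \<open>g'\<close> orthogonal to
  \<open>L\<close> gives a function that vanishes near 0, while its derivative is the squared norm
  of that component.\<close>

lemma has_vector_derivative_in_subspace:
  fixes g :: "real \<Rightarrow> 'a::euclidean_space"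
  assumes "(g has_vector_derivative g') (at 0)" "subspace L" "e > 0" "\<And>t. \<bar>t\<bar> < e \<Longrightarrow> g t \<in> L"
  shows "g' \<in> L"
proof -
  obtain P where P: "P g' \<in> L" "g' - P g' \<in> L\<^sup>\<bottom>"
    using orthogonal_projection[OF assms(2)] by metis
  let ?w = "g' - P g'"
  have "((\<lambda>t. g t \<bullet> ?w) has_vector_derivative g' \<bullet> ?w) (at 0)"
    by (rule bounded_linear.has_vector_derivative[OF bounded_linear_inner_left assms(1)])
  moreover have "((\<lambda>t. g t \<bullet> ?w) has_vector_derivative 0) (at 0)"
    by (rule has_vector_derivative_transform_within_open[where f = "\<lambda>t. 0" and S = "ball 0 e"])
       (use assms(3,4) P(2) in \<open>auto simp: mem_orthogonal_comp inner_commute\<close>)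
  ultimately have "g' \<bullet> ?w = 0" by (rule vector_derivative_unique_at)
  moreover have "P g' \<bullet> ?w = 0" using P by (simp add: mem_orthogonal_comp inner_commute)
  ultimately have "?w \<bullet> ?w = 0" by (simp only: inner_diff_left)
  then show ?thesis using P(1) by simp
qed

lemma has_vector_derivative_along_line:
  assumes "(f has_derivative f') (at x)"
  shows "((\<lambda>t. f (x + t *\<^sub>R u)) has_vector_derivative f' u) (at 0)"
proof -
  have "((\<lambda>t. f (x + t *\<^sub>R u)) has_derivative (\<lambda>r. f' (r *\<^sub>R u))) (at 0)"
    by (rule has_derivative_compose[where g = f and f = "\<lambda>t. x + t *\<^sub>R u"])
       (use assms in \<open>auto intro!: derivative_eq_intros\<close>)
  then show ?thesis
    using linear_scale[OF has_derivative_linear[OF assms]] by (simp add: has_vector_derivative_def)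
qed

lemma line_in_open:
  fixes U :: "'a::real_normed_vector set"
  assumes "open U" "x \<in> U"
  obtains e where "e > 0" "\<And>t. \<bar>t\<bar> < e \<Longrightarrow> x + t *\<^sub>R v \<in> U"
proof -
  have "open ((\<lambda>t::real. x + t *\<^sub>R v) -` U)"
    using continuous_open_preimage[OF _ open_UNIV assms(1), of "\<lambda>t::real. x + t *\<^sub>R v"]
    by (simp add: continuous_intros)
  moreover have "0 \<in> (\<lambda>t::real. x + t *\<^sub>R v) -` U" using assms(2) by simp
  ultimately obtain e where "e > 0" "ball 0 e \<subseteq> (\<lambda>t::real. x + t *\<^sub>R v) -` U" using openE by blast
  then show thesis by (intro that[of e]) auto
qed

lemma has_derivative_in_subspace:
  fixes f :: "'a::euclidean_space \<Rightarrow> 'b::euclidean_space"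
  assumes "(f has_derivative f') (at x)" "subspace L" "open U" "x \<in> U" "x \<in> S" "u \<in> S" "subspace S"
    "\<And>y. y \<in> U \<Longrightarrow> y \<in> S \<Longrightarrow> f y \<in> L"
  shows "f' u \<in> L"
proof -
  obtain e where e: "e > 0" "\<And>t. \<bar>t\<bar> < e \<Longrightarrow> x + t *\<^sub>R u \<in> U"
    using line_in_open[OF assms(3,4)] by metis
  show ?thesis
    by (rule has_vector_derivative_in_subspace[OF has_vector_derivative_along_line[OF assms(1)] assms(2) e(1)])
       (intro assms(8) e(2) subspace_add[OF assms(7)] subspace_scale[OF assms(7)] assms(5,6))
qed

lemma subspace_0_set: "subspace {0::'a::real_vector}"
  by (simp add: subspace_def)

lemma has_derivative_zero_along_subspace:
  fixes f :: "'a::euclidean_space \<Rightarrow> 'b::euclidean_space"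
  assumes "(f has_derivative f') (at x)" "open U" "x \<in> U" "x \<in> S" "u \<in> S" "subspace S"
    "\<And>y. y \<in> U \<Longrightarrow> y \<in> S \<Longrightarrow> f y = 0"
  shows "f' u = 0"
  using has_derivative_in_subspace[OF assms(1) subspace_0_set assms(2-6)] assms(7) by simp

subsection \<open>Gronwall\<close>

text \<open>For the energy \<open>e\<close>, the sum of squares, Cauchy-Schwarz turns the bound into
  \<open>e' t \<le> K * e t\<close>, so \<open>e t * exp (- K * t)\<close> does not increase, and it
  starts at 0.\<close>

lemma gronwall_zero_family:
  fixes f :: "'i \<Rightarrow> real \<Rightarrow> real"
  assumes J: "finite J"
    and der: "\<And>j t. j \<in> J \<Longrightarrow> t \<in> {0..1} \<Longrightarrow> (f j has_real_derivative f' j t) (at t)"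
    and bound: "\<And>j t. j \<in> J \<Longrightarrow> t \<in> {0..1} \<Longrightarrow> \<bar>f' j t\<bar> \<le> C * (\<Sum>k\<in>J. \<bar>f k t\<bar>)"
    and init: "\<And>j. j \<in> J \<Longrightarrow> f j 0 = 0"
    and "j \<in> J" "t \<in> {0..1}"
  shows "f j t = 0"
proof -
  \<comment> \<open>\<open>C\<close> carries no sign condition, but multiplying inequalities by it
    requires a nonnegative constant.\<close>
  define C' where "C' = max C 0"
  define n where "n = real (card J)"
  \<comment> \<open>The 2 comes from differentiating squares, and \<open>n\<close> from bounding the
    square of a sum of \<open>n\<close> terms by \<open>n\<close> times the sum of their
    squares.\<close>
  define K where "K = 2 * C' * n"
  define e where "e t = (\<Sum>j\<in>J. (f j t)\<^sup>2)" for t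
  define e' where "e' t = (\<Sum>j\<in>J. 2 * f j t * f' j t)" for t
  have de: "(e has_real_derivative e' t) (at t)" if "t \<in> {0..1}" for t
    unfolding e_def e'_def
    by (rule DERIV_sum) (auto intro!: derivative_eq_intros der that)
  have le: "e' t \<le> K * e t" if t: "t \<in> {0..1}" for t
  proof -
    define s where "s = (\<Sum>k\<in>J. \<bar>f k t\<bar>)"
    have s: "s \<ge> 0" unfolding s_def by (intro sum_nonneg) auto
    have "e' t \<le> (\<Sum>j\<in>J. 2 * \<bar>f j t\<bar> * (C' * s))"
      unfolding e'_def
    proof (rule sum_mono)
      fix j assume j: "j \<in> J"
      have "\<bar>f' j t\<bar> \<le> C * s" using bound[OF j t] by (simp add: s_def)
      also have "\<dots> \<le> C' * s" using s by (auto simp: C'_def intro: mult_right_mono)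
      finally have "\<bar>f j t\<bar> * \<bar>f' j t\<bar> \<le> \<bar>f j t\<bar> * (C' * s)"
        by (intro mult_left_mono) auto
      then show "2 * f j t * f' j t \<le> 2 * \<bar>f j t\<bar> * (C' * s)"
        using abs_ge_self[of "f j t * f' j t"] by (simp add: abs_mult)
    qed
    also have "\<dots> = 2 * C' * s\<^sup>2"
      by (simp add: s_def power2_eq_square sum_distrib_left sum_distrib_right algebra_simps)
    also have "\<dots> \<le> 2 * C' * (n * e t)"
      unfolding s_def e_def n_def
      using sum_squared_le_sum_of_squares[of "\<lambda>k. \<bar>f k t\<bar>" J]
      by (intro mult_left_mono) (auto simp: C'_def mult.commute)
    finally show ?thesis by (simp add: K_def mult.assoc)
  qed
  have "e t * exp (- K * t) \<le> e 0 * exp (- K * 0)"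
  proof (rule DERIV_nonpos_imp_nonincreasing[where f = "\<lambda>t. e t * exp (- K * t)"])
    show "0 \<le> t" using assms(6) by simp
    fix x assume x: "0 \<le> x" "x \<le> t"
    then have x1: "x \<in> {0..1}" using assms(6) by auto
    have "((\<lambda>t. e t * exp (- K * t)) has_real_derivative (e' x - K * e x) * exp (- K * x)) (at x)"
      by (auto intro!: derivative_eq_intros de x1 simp: algebra_simps)
    moreover have "(e' x - K * e x) * exp (- K * x) \<le> 0"
      using le[OF x1] by (simp add: mult_le_0_iff)
    ultimately show "\<exists>y. ((\<lambda>t. e t * exp (- K * t)) has_real_derivative y) (at x) \<and> y \<le> 0" by blast
  qed
  moreover have "e 0 = 0" using init by (simp add: e_def)
  ultimately have "e t \<le> 0" by (simp add: mult_le_0_iff)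
  moreover have "(f j t)\<^sup>2 \<le> e t"
    unfolding e_def using J assms(5) by (intro member_le_sum) auto
  ultimately show ?thesis by (smt (verit) zero_eq_power2 zero_le_power2)
qed

lemma gronwall_zero:
  fixes f :: "real \<Rightarrow> 'a::euclidean_space"
  assumes der: "\<And>t. t \<in> {0..1} \<Longrightarrow> (f has_vector_derivative f' t) (at t)"
    and bound: "\<And>t. t \<in> {0..1} \<Longrightarrow> norm (f' t) \<le> C * norm (f t)"
    and "f 0 = 0" "t \<in> {0..1}"
  shows "f t = 0"
proof (rule euclidean_eqI)
  fix b :: 'a assume b: "b \<in> Basis"
  have "f t \<bullet> b = 0"
  proof (rule gronwall_zero_family[where J = Basis and f = "\<lambda>b t. f t \<bullet> b" and j = b and t = t and f' = "\<lambda>b t. f' t \<bullet> b" and C = "max C 0"])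
    fix t b assume t: "t \<in> {0..1::real}" and b: "b \<in> (Basis :: 'a set)"
    show "((\<lambda>t. f t \<bullet> b) has_real_derivative f' t \<bullet> b) (at t)"
      using bounded_linear.has_vector_derivative[OF bounded_linear_inner_left der[OF t]]
      by (simp add: has_real_derivative_iff_has_vector_derivative)
    have "\<bar>f' t \<bullet> b\<bar> \<le> norm (f' t)" using b by (simp add: Basis_le_norm)
    also have "\<dots> \<le> max C 0 * norm (f t)"
      using bound[OF t] by (smt (verit) mult_right_mono norm_ge_zero)
    also have "\<dots> \<le> max C 0 * (\<Sum>b\<in>Basis. \<bar>f t \<bullet> b\<bar>)"
      by (intro mult_left_mono norm_le_l1) auto
    finally show "\<bar>f' t \<bullet> b\<bar> \<le> max C 0 * (\<Sum>b\<in>Basis. \<bar>f t \<bullet> b\<bar>)" .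
  qed (use assms b in auto)
  then show "f t \<bullet> b = 0 \<bullet> b" by simp
qed

subsection \<open>Inverting a smooth family of linear maps\<close>

text \<open>Since \<open>f x = 0\<close>, the term with a derivative of \<open>g\<close> is absent
  and continuity of \<open>g\<close> suffices. This allows the inverse family to be differentiated
  when only its continuity is known.\<close>

lemma has_derivative_scaleR_zero:
  fixes f :: "'a::real_normed_vector \<Rightarrow> real" and g :: "'a \<Rightarrow> 'b::real_normed_vector"
  assumes f: "(f has_derivative f') (at x)" and "f x = 0" and g: "isCont g x"
  shows "((\<lambda>y. f y *\<^sub>R g y) has_derivative (\<lambda>u. f' u *\<^sub>R g x)) (at x)"
proof -
  have "bounded_linear f'" using f by (rule has_derivative_bounded_linear)
  have 1: "((\<lambda>y. f y *\<^sub>R g x) has_derivative (\<lambda>u. f' u *\<^sub>R g x)) (at x)"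
    using has_derivative_scaleR_left[OF f] .
  have 2: "((\<lambda>y. f y *\<^sub>R (g y - g x)) has_derivative (\<lambda>u. 0)) (at x)"
    unfolding has_derivative_at2
  proof (intro conjI)
    show "bounded_linear (\<lambda>u. 0 :: 'b)" by simp
    obtain K where K: "\<And>u. norm (f' u) \<le> norm u * K"
      using bounded_linear.bounded[OF \<open>bounded_linear f'\<close>] by blast
    have lim: "((\<lambda>y. (norm (f y - f' (y - x)) / norm (y - x) + K) * norm (g y - g x)) \<longlongrightarrow> (0 + K) * 0) (at x)"
    proof (intro tendsto_intros)
      show "((\<lambda>y. norm (f y - f' (y - x)) / norm (y - x)) \<longlongrightarrow> 0) (at x)"
      proof -
        have "((\<lambda>y. (1 / norm (y - x)) *\<^sub>R (f y - (f x + f' (y - x)))) \<longlongrightarrow> 0) (at x)"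
          using f unfolding has_derivative_at2 by blast
        from tendsto_norm_zero[OF this] show ?thesis
          using assms(2) by simp
      qed
      show "((\<lambda>y. norm (g y - g x)) \<longlongrightarrow> 0) (at x)"
        using g by (intro tendsto_norm_zero) (simp add: isCont_def LIM_zero)
    qed
    then have lim0: "((\<lambda>y. (norm (f y - f' (y - x)) / norm (y - x) + K) * norm (g y - g x)) \<longlongrightarrow> 0) (at x)"
      by (simp only: mult_zero_right)
    show "((\<lambda>y. (1 / norm (y - x)) *\<^sub>R (f y *\<^sub>R (g y - g x) - (f x *\<^sub>R (g x - g x) + 0))) \<longlongrightarrow> 0) (at x)"
    proof (rule Lim_null_comparison[OF _ lim0])
      show "\<forall>\<^sub>F y in at x. norm ((1 / norm (y - x)) *\<^sub>R (f y *\<^sub>R (g y - g x) - (f x *\<^sub>R (g x - g x) + 0)))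
          \<le> (norm (f y - f' (y - x)) / norm (y - x) + K) * norm (g y - g x)"
      proof (rule eventually_at_topological[THEN iffD2], intro exI[of _ UNIV] conjI ballI impI)
        fix y assume "y \<noteq> x"
        then have pos: "norm (y - x) > 0" by simp
        have "norm (f y) \<le> norm (f y - f' (y - x)) + norm (f' (y - x))"
          by (metis diff_add_cancel norm_triangle_ineq)
        also have "\<dots> \<le> norm (f y - f' (y - x)) + norm (y - x) * K" using K by simp
        finally have "norm (f y) / norm (y - x) \<le> norm (f y - f' (y - x)) / norm (y - x) + K"
          using pos by (simp add: field_simps)
        then have "norm (f y) / norm (y - x) * norm (g y - g x)
            \<le> (norm (f y - f' (y - x)) / norm (y - x) + K) * norm (g y - g x)"
          by (rule mult_right_mono) simp
        then show "norm ((1 / norm (y - x)) *\<^sub>R (f y *\<^sub>R (g y - g x) - (f x *\<^sub>R (g x - g x) + 0)))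
          \<le> (norm (f y - f' (y - x)) / norm (y - x) + K) * norm (g y - g x)"
          by simp
      qed auto
    qed
  qed
  show ?thesis
    using has_derivative_add[OF 1 2] by (simp add: scaleR_diff_right)
qed

locale invertible_family =
  fixes U :: "'a::euclidean_space set" and J :: "'a \<Rightarrow> 'a \<Rightarrow> 'a"
  assumes open_U: "open U"
    and linear_J: "x \<in> U \<Longrightarrow> linear (J x)"
    and inj_J: "x \<in> U \<Longrightarrow> inj (J x)"
    and smooth_J: "smooth_on U (\<lambda>x. J x v)"
begin

definition Jinv :: "'a \<Rightarrow> 'a \<Rightarrow> 'a" where
  "Jinv x = inv (J x)"

lemma J_Jinv [simp]: "x \<in> U \<Longrightarrow> J x (Jinv x b) = b"
  unfolding Jinv_def
  by (rule surj_f_inv_f[OF linear_injective_imp_surjective[OF linear_J inj_J]]) auto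

lemma Jinv_J [simp]: "x \<in> U \<Longrightarrow> Jinv x (J x b) = b"
  unfolding Jinv_def by (rule inv_f_f[OF inj_J])

lemma linear_Jinv: "x \<in> U \<Longrightarrow> linear (Jinv x)"
  unfolding Jinv_def by (rule inj_linear_imp_inv_linear[OF linear_J inj_J])

text \<open>The resolvent identity: with \<open>v = Jinv x0 b\<close> the argument on the right is
  \<open>J x v - J x0 v\<close>, which is small near \<open>x0\<close>.\<close>

lemma Jinv_diff: "x \<in> U \<Longrightarrow> x0 \<in> U \<Longrightarrow> Jinv x b - Jinv x0 b = - Jinv x (J x (Jinv x0 b) - b)"
  using linear_diff[OF linear_Jinv, of x "J x (Jinv x0 b)" b] by simp

text \<open>A lower bound \<open>m\<close> for \<open>J x0\<close> gives the lower bound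
  \<open>m / 2\<close> for \<open>J x\<close> near \<open>x0\<close>; the inverses are then
  uniformly bounded and the resolvent identity yields the limit.\<close>

lemma isCont_Jinv:
  assumes x0: "x0 \<in> U"
  shows "isCont (\<lambda>x. Jinv x b) x0"
proof -
  obtain m where m: "m > 0" "\<And>v. m * norm v \<le> norm (J x0 v)"
    using linear_inj_bounded_below_pos[OF linear_J[OF x0] inj_J[OF x0]] by blast
  have contJ: "isCont (\<lambda>x. J x v) x0" for v
    using smooth_on_imp_continuous_on[OF smooth_J] x0 open_U by (simp add: continuous_on_eq_continuous_at)
  have "((\<lambda>x. \<Sum>c\<in>Basis. norm (J x c - J x0 c)) \<longlongrightarrow> (\<Sum>c\<in>(Basis::'a set). 0)) (at x0)"
    using contJ by (intro tendsto_sum tendsto_norm_zero) (simp add: isCont_def LIM_zero)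
  then have "\<forall>\<^sub>F x in at x0. (\<Sum>c\<in>Basis. norm (J x c - J x0 c)) < m / 2"
    using m(1) by (intro order_tendstoD) auto
  moreover have "\<forall>\<^sub>F x in at x0. x \<in> U" using eventually_at_in_open'[OF open_U x0] .
  ultimately have ev: "\<forall>\<^sub>F x in at x0. norm (Jinv x b - Jinv x0 b) \<le> 2 / m * norm (J x (Jinv x0 b) - b)"
  proof eventually_elim
    case (elim x)
    have "m / 2 * norm v \<le> norm (J x v)" for v
    proof -
      have "J x v - J x0 v = (\<Sum>c\<in>Basis. (v \<bullet> c) *\<^sub>R (J x c - J x0 c))"
        using linear_Basis_expand[OF linear_J[OF elim(2)], of v] linear_Basis_expand[OF linear_J[OF x0], of v]
        by (simp add: scaleR_diff_right sum_subtractf)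
      then have "norm (J x v - J x0 v) \<le> (\<Sum>c\<in>Basis. norm v * norm (J x c - J x0 c))"
        by (simp only:) (intro sum_norm_le, auto intro!: mult_right_mono Basis_le_norm)
      also have "\<dots> \<le> norm v * (m / 2)"
        using elim(1) unfolding sum_distrib_left[symmetric] by (intro mult_left_mono) auto
      finally have "norm (J x v - J x0 v) \<le> norm v * (m / 2)" .
      moreover have "norm (J x0 v) \<le> norm (J x v) + norm (J x v - J x0 v)"
        by (metis norm_minus_commute norm_triangle_sub add.commute)
      ultimately show ?thesis using m(2)[of v] by (simp add: field_simps)
    qed
    from this[of "Jinv x (J x (Jinv x0 b) - b)"] show ?case
      using m(1) elim(2) x0 by (simp add: Jinv_diff field_simps)
  qed
  have "((\<lambda>x. 2 / m * norm (J x (Jinv x0 b) - b)) \<longlongrightarrow> 2 / m * 0) (at x0)"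
    using contJ[of "Jinv x0 b"] x0
    by (intro tendsto_mult_left tendsto_norm_zero) (simp add: isCont_def LIM_zero)
  then have "((\<lambda>x. Jinv x b - Jinv x0 b) \<longlongrightarrow> 0) (at x0)"
    using Lim_null_comparison[OF ev] by simp
  then show ?thesis by (simp add: isCont_def LIM_zero_iff)
qed

text \<open>In the resolvent identity the coordinates of \<open>J x ?v - b\<close> vanish at
  \<open>x0\<close> and multiply the vectors \<open>Jinv x c\<close>, known only to be continuous;
  the product rule with a vanishing factor applies to each summand.\<close>

lemma has_derivative_Jinv:
  assumes x0: "x0 \<in> U"
  shows "((\<lambda>x. Jinv x b) has_derivative (\<lambda>u. - Jinv x0 (fd (\<lambda>x. J x (Jinv x0 b)) x0 u))) (at x0)"
proof -
  let ?v = "Jinv x0 b"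
  have g: "((\<lambda>x. (J x ?v - b) \<bullet> c) has_derivative (\<lambda>u. fd (\<lambda>x. J x ?v) x0 u \<bullet> c)) (at x0)" for c
    using smooth_on_has_derivative[OF smooth_J x0, of ?v]
    by (intro has_derivative_inner_left) (auto intro!: derivative_eq_intros)
  have 1: "((\<lambda>x. b' - (\<Sum>c\<in>Basis. ((J x ?v - b) \<bullet> c) *\<^sub>R Jinv x c)) has_derivative
      (\<lambda>u. 0 - (\<Sum>c\<in>Basis. (fd (\<lambda>x. J x ?v) x0 u \<bullet> c) *\<^sub>R Jinv x0 c))) (at x0)" for b'
    using x0
    by (intro has_derivative_diff has_derivative_const has_derivative_sum has_derivative_scaleR_zero g isCont_Jinv)
       auto
  have "((\<lambda>x. Jinv x b) has_derivative
      (\<lambda>u. 0 - (\<Sum>c\<in>Basis. (fd (\<lambda>x. J x ?v) x0 u \<bullet> c) *\<^sub>R Jinv x0 c))) (at x0)"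
  proof (rule has_derivative_transform_within_open[OF 1[of ?v] open_U x0])
    fix x assume x: "x \<in> U"
    have "Jinv x b = ?v - Jinv x (J x ?v - b)"
      using Jinv_diff[OF x x0, of b] by (simp add: algebra_simps)
    then show "?v - (\<Sum>c\<in>Basis. ((J x ?v - b) \<bullet> c) *\<^sub>R Jinv x c) = Jinv x b"
      by (simp add: linear_Basis_expand[OF linear_Jinv[OF x], of "J x ?v - b"])
  qed
  then show ?thesis
    by (simp add: linear_Basis_expand[OF linear_Jinv[OF x0], symmetric])
qed

text \<open>A bootstrap: the derivative is a sum of products of \<open>Jinv\<close> with derivatives
  of \<open>J\<close>, so each order of differentiability of \<open>Jinv\<close> yields the
  next.\<close>

lemma smooth_Jinv: "smooth_on U (\<lambda>x. Jinv x b)"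
proof -
  have "Ck_on k U (\<lambda>x. Jinv x b)" for k
  proof (induction k arbitrary: b)
    case 0
    then show ?case by (simp add: continuous_at_imp_continuous_on isCont_Jinv)
  next
    case (Suc k)
    have J: "Ck_on k U (\<lambda>x. fd (\<lambda>x. J x c) x u)" for c u
      using smooth_on_fd[OF smooth_J] by (simp add: smooth_on_def)
    have D: "fd (\<lambda>x. J x v) x u = (\<Sum>c\<in>Basis. (v \<bullet> c) *\<^sub>R fd (\<lambda>x. J x c) x u)" if x: "x \<in> U" for x u v
    proof -
      have d: "((\<lambda>x. \<Sum>c\<in>Basis. (v \<bullet> c) *\<^sub>R J x c) has_derivative
          (\<lambda>u. \<Sum>c\<in>Basis. (v \<bullet> c) *\<^sub>R fd (\<lambda>x. J x c) x u)) (at x)"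
        by (intro has_derivative_sum has_derivative_scaleR_right smooth_on_has_derivative[OF smooth_J x])
      have "((\<lambda>x. J x v) has_derivative (\<lambda>u. \<Sum>c\<in>Basis. (v \<bullet> c) *\<^sub>R fd (\<lambda>x. J x c) x u)) (at x)"
        by (rule has_derivative_transform_within_open[OF d open_U x])
           (simp add: linear_Basis_expand[OF linear_J, symmetric])
      then show ?thesis by (rule fun_cong[OF fd_eqI])
    qed
    have "Ck_on k U (\<lambda>x. \<Sum>d\<in>Basis. ((\<Sum>c\<in>Basis. (Jinv x b \<bullet> c) *\<^sub>R fd (\<lambda>x. J x c) x u) \<bullet> d) *\<^sub>R
        - Jinv x d)" for u
      by (intro Ck_on_sum Ck_on_scaleR Suc.IH open_U
          Ck_on_bounded_linear_compose[OF bounded_linear_inner_left]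
          Ck_on_bounded_linear_compose[OF bounded_linear_minus[OF bounded_linear_ident]] J)
    then have "Ck_on k U (\<lambda>x. fd (\<lambda>x. Jinv x b) x u)" for u
      by (rule Ck_on_cong[OF open_U, rotated])
         (simp add: fd_eqI[OF has_derivative_Jinv] D[symmetric] sum_negf
            linear_Basis_expand[OF linear_Jinv, symmetric])
    then show ?case
      using differentiableI[OF has_derivative_Jinv] by simp
  qed
  then show ?thesis by (simp add: smooth_on_def)
qed

end

section \<open>Closed two-forms on open sets\<close>

definition closed_form_on :: "'a::euclidean_space set \<Rightarrow> ('a \<Rightarrow> 'a \<Rightarrow> 'a \<Rightarrow> real) \<Rightarrow> bool" where
  "closed_form_on U \<theta> \<longleftrightarrow>
     (\<forall>x\<in>U. bilinear (\<theta> x) \<and> (\<forall>u. \<theta> x u u = 0)) \<and>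
     (\<forall>u v. smooth_on U (\<lambda>x. \<theta> x u v)) \<and>
     (\<forall>x\<in>U. \<forall>u v w. fd (\<lambda>y. \<theta> y v w) x u + fd (\<lambda>y. \<theta> y w u) x v + fd (\<lambda>y. \<theta> y u v) x w = 0)"

lemma closed_form_onD:
  assumes "closed_form_on U \<theta>"
  shows "x \<in> U \<Longrightarrow> bilinear (\<theta> x)" "x \<in> U \<Longrightarrow> \<theta> x u u = 0" "smooth_on U (\<lambda>x. \<theta> x u v)"
    "x \<in> U \<Longrightarrow> fd (\<lambda>y. \<theta> y v w) x u + fd (\<lambda>y. \<theta> y w u) x v + fd (\<lambda>y. \<theta> y u v) x w = 0"
  using assms by (auto simp: closed_form_on_def)

lemma bilinear_alternating_antisym:
  fixes B :: "'a::real_vector \<Rightarrow> 'a \<Rightarrow> real"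
  assumes "bilinear B" "\<And>u. B u u = 0"
  shows "B u v = - B v u"
  using assms(2)[of "u + v"] assms(2)[of u] assms(2)[of v]
  by (simp add: bilinear_ladd[OF assms(1)] bilinear_radd[OF assms(1)])

lemma closed_form_on_antisym: "closed_form_on U \<theta> \<Longrightarrow> x \<in> U \<Longrightarrow> \<theta> x u v = - \<theta> x v u"
  by (rule bilinear_alternating_antisym) (auto dest: closed_form_onD)

lemma closed_form_on_subset: "closed_form_on U \<theta> \<Longrightarrow> V \<subseteq> U \<Longrightarrow> closed_form_on V \<theta>"
  unfolding closed_form_on_def by (blast intro: smooth_on_subset)

lemma closed_form_on_cong:
  assumes "open U" "\<And>x u v. x \<in> U \<Longrightarrow> \<theta> x u v = \<eta> x u v" "closed_form_on U \<theta>"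
  shows "closed_form_on U \<eta>"
proof -
  have sm: "smooth_on U (\<lambda>x. \<eta> x u v)" for u v
    using smooth_on_cong[OF assms(1) assms(2) closed_form_onD(3)[OF assms(3)]] .
  have "fd (\<lambda>y. \<theta> y u v) x = fd (\<lambda>y. \<eta> y u v) x" if "x \<in> U" for x u v
    by (rule frechet_derivative_transform_within_open[OF
          smooth_on_imp_differentiable[OF closed_form_onD(3)[OF assms(3)] that] assms(1) that assms(2)])
  moreover have "\<theta> x = \<eta> x" if "x \<in> U" for x
    using assms(2)[OF that] by (intro ext)
  ultimately show ?thesis
    using assms(3) sm unfolding closed_form_on_def by simp
qed

lemma closed_form_on_local:
  assumes "\<And>x. x \<in> U \<Longrightarrow> \<exists>V. open V \<and> x \<in> V \<and> closed_form_on V \<theta>"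
  shows "closed_form_on U \<theta>"
proof -
  have "smooth_on U (\<lambda>x. \<theta> x u v)" for u v
  proof (rule smooth_on_local)
    fix x assume "x \<in> U"
    from assms[OF this] show "\<exists>V. open V \<and> x \<in> V \<and> smooth_on V (\<lambda>x. \<theta> x u v)"
      using closed_form_onD(3) by blast
  qed
  then show ?thesis
    using assms unfolding closed_form_on_def by blast
qed

lemma closed_form_on_diff:
  assumes "closed_form_on U \<theta>" "closed_form_on U \<eta>" "open U"
  shows "closed_form_on U (\<lambda>x u v. \<theta> x u v - \<eta> x u v)"
proof -
  have sm: "smooth_on U (\<lambda>x. \<theta> x u v)" "smooth_on U (\<lambda>x. \<eta> x u v)" for u v
    using assms by (auto simp: closed_form_on_def)
  have fd: "fd (\<lambda>x. \<theta> x u v - \<eta> x u v) x w = fd (\<lambda>x. \<theta> x u v) x w - fd (\<lambda>x. \<eta> x u v) x w"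
    if "x \<in> U" for x u v w
    by (rule fun_cong[OF fd_eqI[OF has_derivative_diff[OF
      smooth_on_has_derivative[OF sm(1) that] smooth_on_has_derivative[OF sm(2) that]]]])
  have "smooth_on U (\<lambda>x. \<theta> x u v + (- 1) *\<^sub>R \<eta> x u v)" for u v
    by (intro smooth_on_add smooth_on_scaleR smooth_on_const sm assms(3))
  then have "smooth_on U (\<lambda>x. \<theta> x u v - \<eta> x u v)" for u v by simp
  moreover have "bilinear (\<lambda>u v. \<theta> x u v - \<eta> x u v)" if "x \<in> U" for x
    using closed_form_onD(1)[OF assms(1) that] closed_form_onD(1)[OF assms(2) that]
    unfolding bilinear_def by (auto intro: linear_compose_sub)
  ultimately show ?thesis
    using assms(1,2) unfolding closed_form_on_def
    by (auto simp: fd) (smt (verit, best))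
qed

text \<open>Differentiating the pulled back form produces second derivatives of \<open>F\<close>. In
  the cyclic sum they cancel in pairs, by their symmetry and the antisymmetry of \<theta>; what
  remains is closedness of \<theta>.\<close>

lemma closed_form_on_pullback:
  fixes F :: "'a::euclidean_space \<Rightarrow> 'b::euclidean_space"
  assumes \<theta>: "closed_form_on V \<theta>" and F: "smooth_on U F" and "open U" "open V" "F ` U \<subseteq> V"
  shows "closed_form_on U (\<lambda>x u v. \<theta> (F x) (fd F x u) (fd F x v))"
proof -
  have FV: "F x \<in> V" if "x \<in> U" for x using that assms(5) by blast
  have bil: "bilinear (\<theta> (F x))" if "x \<in> U" for x using closed_form_onD(1)[OF \<theta> FV[OF that]] .
  have sm: "smooth_on U (\<lambda>x. \<theta> (F x) u v)" for u v
    by (rule smooth_on_compose[OF closed_form_onD(3)[OF \<theta>] F assms(3-5)])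
  have 1: "smooth_on U (\<lambda>x. \<theta> (F x) (fd F x u) (fd F x v))" for u v
    by (rule smooth_on_bilinear_family[OF assms(3) bil sm smooth_on_fd[OF F] smooth_on_fd[OF F]])
  have 2: "bilinear (\<lambda>u v. \<theta> (F x) (fd F x u) (fd F x v))" if "x \<in> U" for x
    using bil[OF that] smooth_on_linear_fd[OF F that]
    unfolding bilinear_def by (auto intro: linear_compose[unfolded o_def])
  have 3: "fd (\<lambda>y. \<theta> (F y) (fd F y v) (fd F y w)) x u =
      fd (\<lambda>z. \<theta> z (fd F x v) (fd F x w)) (F x) (fd F x u)
      + \<theta> (F x) (fd (\<lambda>y. fd F y v) x u) (fd F x w) + \<theta> (F x) (fd F x v) (fd (\<lambda>y. fd F y w) x u)"
    if x: "x \<in> U" for x u v w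
  proof -
    have d: "((\<lambda>y. \<theta> (F y) (fd F y v) (fd F y w)) has_derivative
      (\<lambda>u. fd (\<lambda>y. \<theta> (F y) (fd F x v) (fd F x w)) x u
        + \<theta> (F x) (fd (\<lambda>y. fd F y v) x u) (fd F x w) + \<theta> (F x) (fd F x v) (fd (\<lambda>y. fd F y w) x u))) (at x)"
      by (rule has_derivative_bilinear_family[where B = "\<lambda>y. \<theta> (F y)", OF assms(3) x bil
            smooth_on_imp_differentiable[OF sm x]
            smooth_on_has_derivative[OF smooth_on_fd[OF F] x]
            smooth_on_has_derivative[OF smooth_on_fd[OF F] x]])
    have "fd (\<lambda>y. \<theta> (F y) (fd F x v) (fd F x w)) x = (\<lambda>u. fd (\<lambda>z. \<theta> z (fd F x v) (fd F x w)) (F x) (fd F x u))"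
      by (rule fd_eqI, rule has_derivative_compose[where g = "\<lambda>z. \<theta> z (fd F x v) (fd F x w)" and f = F])
         (use smooth_on_has_derivative[OF F x] smooth_on_has_derivative[OF closed_form_onD(3)[OF \<theta>] FV[OF x]] in auto)
    then show ?thesis using fun_cong[OF fd_eqI[OF d], of u] by simp
  qed
  have 4: "fd (\<lambda>y. \<theta> (F y) (fd F y v) (fd F y w)) x u + fd (\<lambda>y. \<theta> (F y) (fd F y w) (fd F y u)) x v
      + fd (\<lambda>y. \<theta> (F y) (fd F y u) (fd F y v)) x w = 0" if x: "x \<in> U" for x u v w
    unfolding 3[OF x]
    using closed_form_onD(4)[OF \<theta> FV[OF x], of "fd F x v" "fd F x w" "fd F x u"]
      closed_form_on_antisym[OF \<theta> FV[OF x], of "fd F x u"]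
      closed_form_on_antisym[OF \<theta> FV[OF x], of "fd F x v"]
      closed_form_on_antisym[OF \<theta> FV[OF x], of "fd F x w"]
      fd_commute[OF F assms(3) x, of u v] fd_commute[OF F assms(3) x, of v w] fd_commute[OF F assms(3) x, of w u]
    by (smt (verit))
  show ?thesis
    unfolding closed_form_on_def using 1 2 4 closed_form_onD(2)[OF \<theta> FV] by auto
qed

text \<open>The Lie derivative of \<open>\<eta>|\<^sub>L\<close> along \<open>X\<close> vanishes, because \<open>i\<^sub>X\<eta> = 0\<close> and \<open>d\<eta> = 0\<close>.\<close>

lemma lie_derivative_closed_form:
  fixes \<eta> :: "'a::euclidean_space \<Rightarrow> 'a \<Rightarrow> 'a \<Rightarrow> real"
  assumes \<eta>: "closed_form_on U \<eta>" and "open U" "subspace L" and x: "x \<in> U" "x \<in> L"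
    and X: "(X has_derivative X') (at x)"
    and kill: "\<And>y v. y \<in> U \<Longrightarrow> y \<in> L \<Longrightarrow> v \<in> L \<Longrightarrow> \<eta> y (X y) v = 0"
    and uv: "u \<in> L" "v \<in> L"
  shows "fd (\<lambda>y. \<eta> y u v) x (X x) = - \<eta> x (X' u) v - \<eta> x u (X' v)"
proof -
  have bil: "bilinear (\<eta> y)" if "y \<in> U" for y using closed_form_onD(1)[OF \<eta> that] .
  have diff: "(\<lambda>y. \<eta> y a b) differentiable (at x)" for a b
    using smooth_on_imp_differentiable[OF closed_form_onD(3)[OF \<eta>] x(1)] .
  \<comment> \<open>The identity \<open>\<eta> y (X y) b = 0\<close> is available only on
    \<open>L\<close>, so it is differentiated only in directions \<open>a\<close> of
    \<open>L\<close>.\<close>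
  have zero: "fd (\<lambda>y. \<eta> y (X x) b) x a + \<eta> x (X' a) b = 0" if "a \<in> L" "b \<in> L" for a b
  proof -
    have "((\<lambda>y. \<eta> y (X y) b) has_derivative
       (\<lambda>u. fd (\<lambda>y. \<eta> y (X x) b) x u + \<eta> x (X' u) b + \<eta> x (X x) 0)) (at x)"
      by (rule has_derivative_bilinear_family[where B = \<eta> and f = X and g = "\<lambda>y. b", OF assms(2) x(1) bil diff X])
         auto
    from has_derivative_zero_along_subspace[OF this assms(2) x that(1) assms(3)] kill that(2)
    show ?thesis by (simp add: bilinear_rzero[OF bil[OF x(1)]])
  qed
  have anti: "fd (\<lambda>y. \<eta> y v (X x)) x u = - fd (\<lambda>y. \<eta> y (X x) v) x u"
  proof -
    have "((\<lambda>y. - \<eta> y (X x) v) has_derivative (\<lambda>u. - fd (\<lambda>y. \<eta> y (X x) v) x u)) (at x)"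
      using diff[of "X x" v] by (intro has_derivative_minus) (simp add: frechet_derivative_works)
    then have "((\<lambda>y. \<eta> y v (X x)) has_derivative (\<lambda>u. - fd (\<lambda>y. \<eta> y (X x) v) x u)) (at x)"
      by (rule has_derivative_transform_within_open[OF _ assms(2) x(1)])
         (simp add: closed_form_on_antisym[OF \<eta>, of _ v])
    then show ?thesis by (rule fun_cong[OF fd_eqI])
  qed
  show ?thesis
    using closed_form_onD(4)[OF \<eta> x(1), of u v "X x"] zero[OF uv] zero[OF uv(2,1)] anti
      closed_form_on_antisym[OF \<eta> x(1), of "X' v" u] by linarith
qed

section \<open>Coisotropic subspaces of a chart\<close>

text \<open>\<open>J x v \<bullet> w\<close> is the symplectic form, and \<open>{k. J x k \<in> L\<^sup>\<bottom>}\<close> the kernel of its restriction to \<open>L\<close>.\<close>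

locale coisotropic_chart = invertible_family U J for U :: "'a::euclidean_space set" and J +
  fixes L :: "'a set"
  assumes subspace_L: "subspace L"
    and skew: "x \<in> U \<Longrightarrow> J x v \<bullet> w = - (J x w \<bullet> v)"
    and coisotropic: "x \<in> U \<Longrightarrow> x \<in> L \<Longrightarrow> J x k \<in> L\<^sup>\<bottom> \<Longrightarrow> k \<in> L"
begin

text \<open>At each time the velocity is extended to a field lying in the kernel along
  \<open>L\<close>. The Lie derivative formula then expresses the time derivatives of the numbers
  \<open>\<eta> (c t) a b\<close>, with \<open>a\<close> and \<open>b\<close> in an orthonormal
  basis of \<open>L\<close>, linearly through the same numbers, and Gronwall's estimate
  applies.\<close>

lemma closed_form_transport:
  assumes \<eta>: "closed_form_on U \<eta>"
    and kill: "\<And>y k v. y \<in> U \<Longrightarrow> y \<in> L \<Longrightarrow> J y k \<in> L\<^sup>\<bottom> \<Longrightarrow> v \<in> L \<Longrightarrow> \<eta> y k v = 0"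
    and c: "\<And>t. t \<in> {0..1} \<Longrightarrow> (c has_vector_derivative c' t) (at t)"
    and cont: "continuous_on {0..1} c'"
    and cL: "\<And>t. t \<in> {0..1} \<Longrightarrow> c t \<in> U" "\<And>t. t \<in> {0..1} \<Longrightarrow> c t \<in> L"
    and ker: "\<And>t. t \<in> {0..1} \<Longrightarrow> J (c t) (c' t) \<in> L\<^sup>\<bottom>"
    and init: "\<And>u v. u \<in> L \<Longrightarrow> v \<in> L \<Longrightarrow> \<eta> (c 0) u v = 0"
    and uv: "u \<in> L" "v \<in> L"
  shows "\<eta> (c 1) u v = 0"
proof -
  obtain B where B: "B \<subseteq> L" "pairwise orthogonal B" "\<And>x. x \<in> B \<Longrightarrow> norm x = 1"
    "independent B" "span B = L"
    using orthonormal_basis_subspace[OF subspace_L] by metis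
  have fin: "finite B" using B(4) independent_imp_finite by blast
  have expand: "w = (\<Sum>e\<in>B. (w \<bullet> e) *\<^sub>R e)" if "w \<in> L" for w
    using that B by (intro orthonormal_basis_expand[symmetric] fin) auto
  have bil: "bilinear (\<eta> y)" if "y \<in> U" for y using closed_form_onD(1)[OF \<eta> that] .
  have contc: "continuous_on {0..1} c"
    by (intro continuous_at_imp_continuous_on ballI has_vector_derivative_continuous[OF c])
  define \<beta> where "\<beta> t = J (c t) (c' t)" for t
  \<comment> \<open>For fixed \<open>t\<close> the covector is kept while the point moves: along
    \<open>L\<close> the value stays in the kernel, hence in \<open>L\<close> by coisotropy, and at
    \<open>c t\<close> it is the velocity.\<close>
  define X where "X t y = Jinv y (\<beta> t)" for t y
  have contcomp: "continuous_on {0..1} (\<lambda>t. g (c t))" if "smooth_on U g" for g :: "'a \<Rightarrow> 'a"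
    using continuous_on_compose2[OF smooth_on_imp_continuous_on[OF that] contc] cL(1) by blast
  have cont\<beta>: "continuous_on {0..1} \<beta>"
  proof -
    have "continuous_on {0..1} (\<lambda>t. \<Sum>b\<in>Basis. (c' t \<bullet> b) *\<^sub>R J (c t) b)"
      by (intro continuous_intros cont contcomp smooth_J)
    then show ?thesis
      by (rule continuous_on_eq) (simp add: \<beta>_def linear_Basis_expand[OF linear_J[OF cL(1)], symmetric])
  qed
  have dX: "(X t has_derivative (\<lambda>w. \<Sum>b\<in>Basis. (\<beta> t \<bullet> b) *\<^sub>R fd (\<lambda>y. Jinv y b) (c t) w)) (at (c t))"
    if t: "t \<in> {0..1}" for t
  proof -
    have 1: "((\<lambda>y. \<Sum>b\<in>Basis. (\<beta> t \<bullet> b) *\<^sub>R Jinv y b) has_derivative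
       (\<lambda>w. \<Sum>b\<in>Basis. (\<beta> t \<bullet> b) *\<^sub>R fd (\<lambda>y. Jinv y b) (c t) w)) (at (c t))"
      by (intro has_derivative_sum has_derivative_scaleR_right smooth_on_has_derivative[OF smooth_Jinv cL(1)[OF t]])
    show ?thesis
      by (rule has_derivative_transform_within_open[OF 1 open_U cL(1)[OF t]])
         (simp add: X_def linear_Basis_expand[OF linear_Jinv, symmetric])
  qed
  define X' where "X' t w = (\<Sum>b\<in>Basis. (\<beta> t \<bullet> b) *\<^sub>R fd (\<lambda>y. Jinv y b) (c t) w)" for t w
  note dX = dX[folded X'_def]
  have XL: "X t y \<in> L" if "t \<in> {0..1}" "y \<in> U" "y \<in> L" for t y
    using ker[OF that(1)] that(2) by (intro coisotropic[OF that(2,3)]) (simp add: X_def \<beta>_def)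
  \<comment> \<open>This closes the system of equations: only values of \<eta> with both arguments
    in \<open>L\<close> occur on the right-hand side.\<close>
  have X'L: "X' t w \<in> L" if "t \<in> {0..1}" "w \<in> L" for t w
    using has_derivative_in_subspace[OF dX[OF that(1)] subspace_L open_U cL(1)[OF that(1)] cL(2)[OF that(1)] that(2) subspace_L XL[OF that(1)]] .
  have Xc: "X t (c t) = c' t" if "t \<in> {0..1}" for t
    using cL(1)[OF that] by (simp add: X_def \<beta>_def)
  have Lie: "fd (\<lambda>y. \<eta> y a b) (c t) (c' t) = - \<eta> (c t) (X' t a) b - \<eta> (c t) a (X' t b)"
    if t: "t \<in> {0..1}" and ab: "a \<in> L" "b \<in> L" for t a b
    unfolding Xc[OF t, symmetric]
    by (rule lie_derivative_closed_form[OF \<eta> open_U subspace_L cL(1)[OF t] cL(2)[OF t] dX[OF t] _ ab])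
       (use ker[OF t] in \<open>auto intro!: kill simp: X_def \<beta>_def\<close>)
  \<comment> \<open>Being continuous on a compact interval, \<open>N\<close> supplies one constant
    \<open>C\<close> for all times and all basis vectors.\<close>
  define N where "N t = (\<Sum>a\<in>B. norm (X' t a))" for t
  have "continuous_on {0..1} N"
    unfolding N_def X'_def
    by (intro continuous_intros cont\<beta> contcomp smooth_on_fd smooth_Jinv)
  then have "bounded (N ` {0..1})"
    by (intro compact_imp_bounded compact_continuous_image) auto
  then obtain C where C: "\<And>t. t \<in> {0..1} \<Longrightarrow> N t \<le> C"
    unfolding bounded_iff by (metis abs_le_D1 imageI real_norm_def)
  have norm_X': "norm (X' t a) \<le> C" if "t \<in> {0..1}" "a \<in> B" for t a
  proof -
    have "norm (X' t a) \<le> N t" unfolding N_def using that(2) fin by (intro member_le_sum) auto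
    then show ?thesis using C[OF that(1)] by simp
  qed
  define f where "f = (\<lambda>(a, b) t. \<eta> (c t) a b)"
  define f' where "f' = (\<lambda>(a, b) t. fd (\<lambda>y. \<eta> y a b) (c t) (c' t))"
  define S where "S t = (\<Sum>p\<in>B\<times>B. \<bar>f p t\<bar>)" for t
  have half: "\<bar>\<eta> (c t) w b\<bar> \<le> C * S t" if t: "t \<in> {0..1}" and w: "w \<in> L" "norm w \<le> C" and b: "b \<in> B" for t w b
  proof -
    have lin: "linear (\<lambda>w. \<eta> (c t) w b)" using bil[OF cL(1)[OF t]] by (simp add: bilinear_def)
    have "\<eta> (c t) w b = \<eta> (c t) (\<Sum>e\<in>B. (w \<bullet> e) *\<^sub>R e) b"
      using expand[OF w(1)] by simp
    also have "\<dots> = (\<Sum>e\<in>B. (w \<bullet> e) * \<eta> (c t) e b)"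
      using linear_sum[OF lin, of "\<lambda>e. (w \<bullet> e) *\<^sub>R e" B] linear_scale[OF lin] by simp
    also have "\<bar>\<dots>\<bar> \<le> (\<Sum>e\<in>B. C * \<bar>f (e, b) t\<bar>)"
    proof (rule order_trans[OF sum_abs sum_mono])
      fix e assume e: "e \<in> B"
      have "\<bar>w \<bullet> e\<bar> \<le> C"
        using Cauchy_Schwarz_ineq2[of w e] B(3)[OF e] w(2) by simp
      then show "\<bar>(w \<bullet> e) * \<eta> (c t) e b\<bar> \<le> C * \<bar>f (e, b) t\<bar>"
        by (simp add: abs_mult f_def mult_right_mono)
    qed
    also have "\<dots> = C * (\<Sum>p\<in>B\<times>{b}. \<bar>f p t\<bar>)"
      by (simp add: sum_distrib_left sum.cartesian_product')
    also have "\<dots> \<le> C * S t"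
      unfolding S_def using fin b w(2) norm_ge_zero[of w]
      by (intro mult_left_mono sum_mono2) (auto simp del: norm_ge_zero)
    finally show ?thesis .
  qed
  have zero: "f p 1 = 0" if "p \<in> B \<times> B" for p
  proof (rule gronwall_zero_family[where J = "B \<times> B" and f = f and f' = f' and C = "2 * C" and t = 1])
    show "finite (B \<times> B)" using fin by simp
    fix p and t :: real assume p: "p \<in> B \<times> B" and t: "t \<in> {0..1}"
    obtain a b where ab: "p = (a, b)" "a \<in> B" "b \<in> B" using p by auto
    have "(f p has_vector_derivative f' p t) (at t)"
      unfolding ab f_def f'_def prod.case
      using vector_derivative_diff_chain_within[OF c[OF t], of "\<lambda>y. \<eta> y a b" "fd (\<lambda>y. \<eta> y a b) (c t)"]
        has_derivative_at_withinI[OF smooth_on_has_derivative[OF closed_form_onD(3)[OF \<eta>] cL(1)[OF t]]]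
      by (simp add: o_def)
    then show "(f p has_real_derivative f' p t) (at t)"
      by (simp add: has_real_derivative_iff_has_vector_derivative)
    have abL: "a \<in> L" "b \<in> L" using ab B(1) by auto
    have "\<bar>\<eta> (c t) (X' t a) b\<bar> \<le> C * S t"
      by (rule half[OF t X'L[OF t abL(1)] norm_X'[OF t ab(2)] ab(3)])
    moreover have "\<bar>\<eta> (c t) a (X' t b)\<bar> \<le> C * S t"
      using half[OF t X'L[OF t abL(2)] norm_X'[OF t ab(3)] ab(2)]
        closed_form_on_antisym[OF \<eta> cL(1)[OF t], of a "X' t b"] by simp
    ultimately show "\<bar>f' p t\<bar> \<le> 2 * C * (\<Sum>k\<in>B \<times> B. \<bar>f k t\<bar>)"
      unfolding S_def[symmetric] using Lie[OF t abL] by (simp add: ab f'_def)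
  qed (use that init B(1) in \<open>auto simp: f_def\<close>)
  have bil1: "bilinear (\<eta> (c 1))" using bil cL(1) by simp
  have "\<eta> (c 1) u v = \<eta> (c 1) (\<Sum>a\<in>B. (u \<bullet> a) *\<^sub>R a) (\<Sum>b\<in>B. (v \<bullet> b) *\<^sub>R b)"
    using expand uv by simp
  also have "\<dots> = (\<Sum>(a, b)\<in>B \<times> B. \<eta> (c 1) ((u \<bullet> a) *\<^sub>R a) ((v \<bullet> b) *\<^sub>R b))"
    using bilinear_sum[OF bil1] .
  also have "\<dots> = 0"
    using zero by (intro sum.neutral) (auto simp: f_def bilinear_lmul[OF bil1] bilinear_rmul[OF bil1])
  finally show ?thesis .
qed

end

section \<open>Integral curves of fields tangent to a subspace\<close>

lemma smooth_on_lipschitz_cball: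
  fixes f :: "'a::euclidean_space \<Rightarrow> 'b::euclidean_space"
  assumes f: "smooth_on V f" and V: "cball p r \<subseteq> V"
  obtains K where "\<And>x y. x \<in> cball p r \<Longrightarrow> y \<in> cball p r \<Longrightarrow> norm (f x - f y) \<le> K * norm (x - y)"
proof -
  define N where "N x = (\<Sum>i\<in>Basis. norm (fd f x i))" for x
  have "continuous_on (cball p r) N"
    unfolding N_def
    using continuous_on_subset[OF smooth_on_imp_continuous_on[OF smooth_on_fd[OF f]] V]
    by (intro continuous_intros) blast
  then have "bounded (N ` cball p r)"
    by (intro compact_imp_bounded compact_continuous_image compact_cball)
  then obtain K where K: "\<And>x. x \<in> cball p r \<Longrightarrow> N x \<le> K"
    unfolding bounded_iff by (metis abs_le_D1 imageI real_norm_def)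
  have "norm (f x - f y) \<le> K * norm (x - y)" if "x \<in> cball p r" "y \<in> cball p r" for x y
  proof (rule differentiable_bound[OF convex_cball _ _ that(1,2)])
    fix x assume x: "x \<in> cball p r"
    then have xV: "x \<in> V" using V by blast
    show "(f has_derivative fd f x) (at x within cball p r)"
      using has_derivative_at_withinI[OF smooth_on_has_derivative[OF f xV]] .
    have "norm (fd f x v) \<le> N x * norm v" for v
    proof -
      have "norm (fd f x v) \<le> (\<Sum>i\<in>Basis. norm ((v \<bullet> i) *\<^sub>R fd f x i))"
        by (subst linear_Basis_expand[OF smooth_on_linear_fd[OF f xV], of v]) (rule norm_sum)
      also have "\<dots> \<le> (\<Sum>i\<in>Basis. norm v * norm (fd f x i))"
        by (intro sum_mono) (simp add: Basis_le_norm mult_right_mono)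
      finally show ?thesis by (simp add: N_def sum_distrib_left mult.commute)
    qed
    then have "onorm (fd f x) \<le> N x" by (rule onorm_le)
    then show "onorm (fd f x) \<le> K" using K[OF x] by simp
  qed
  then show thesis by (rule that)
qed

text \<open>The component of the field orthogonal to \<open>S\<close> vanishes on \<open>S\<close>, so it is bounded by the distance
  to \<open>S\<close>.\<close>

lemma integral_curve_stays_in_subspace:
  fixes Z :: "'a::euclidean_space \<Rightarrow> 'b::euclidean_space \<Rightarrow> 'a"
  assumes S: "subspace S" "p \<in> S" and V: "cball p r \<subseteq> V"
    and Z: "\<And>b. smooth_on V (\<lambda>y. Z y b)" "\<And>y. y \<in> V \<Longrightarrow> linear (Z y)"
    and ZS: "\<And>y b. y \<in> V \<Longrightarrow> y \<in> S \<Longrightarrow> Z y b \<in> S"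
    and c: "\<And>t. t \<in> {0..1} \<Longrightarrow> (c has_vector_derivative Z (c t) (\<beta> t)) (at t)"
    and \<beta>: "continuous_on {0..1} \<beta>"
    and c_in: "\<And>t. t \<in> {0..1} \<Longrightarrow> c t \<in> cball p r" and "c 0 \<in> S" and t: "t \<in> {0..1}"
  shows "c t \<in> S"
proof -
  obtain P where P: "linear P" "\<And>x. P x \<in> S" "\<And>x. x \<in> S \<Longrightarrow> P x = x" "\<And>x. norm (P x) \<le> norm x"
    using orthogonal_projection[OF S(1)] by metis
  define q where "q x = x - P x" for x
  have lin_q: "linear q" unfolding q_def by (intro linear_compose_sub linear_ident P(1))
  then have bl_q: "bounded_linear q" by (simp add: linear_conv_bounded_linear)
  have q0: "q x = 0" if "x \<in> S" for x using P(3)[OF that] by (simp add: q_def)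
  have qle: "norm (q x) \<le> 2 * norm x" for x
    using norm_triangle_ineq4[of x "P x"] P(4)[of x] by (simp add: q_def)
  \<comment> \<open>The centre \<open>p\<close> lies in \<open>S\<close>, so projecting does not
    increase the distance to it, and the Lipschitz bound may be used between \<open>x\<close> and
    \<open>P x\<close>.\<close>
  have P_in: "P x \<in> cball p r" if "x \<in> cball p r" for x
  proof -
    have "norm (p - P x) \<le> norm (p - x)"
      using P(4)[of "p - x"] P(3)[OF S(2)] linear_diff[OF P(1)] by simp
    then show ?thesis using that by (simp add: dist_norm)
  qed
  have "\<exists>k. \<forall>x \<in> cball p r. \<forall>y \<in> cball p r. norm (Z x b - Z y b) \<le> k * norm (x - y)" for b
    by (rule smooth_on_lipschitz_cball[OF Z(1) V, of b]) blast
  then obtain K where K: "norm (Z x b - Z y b) \<le> K b * norm (x - y)"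
    if "x \<in> cball p r" "y \<in> cball p r" for b x y
    by metis
  have "bounded (\<beta> ` {0..1})"
    by (intro compact_imp_bounded compact_continuous_image \<beta>) auto
  then obtain C where C: "\<And>t. t \<in> {0..1} \<Longrightarrow> norm (\<beta> t) \<le> C"
    unfolding bounded_iff by blast
  define C' where "C' = (\<Sum>b\<in>Basis. C * (2 * \<bar>K b\<bar>))"
  have bound: "norm (q (Z (c t) (\<beta> t))) \<le> C' * norm (q (c t))" if t: "t \<in> {0..1}" for t
  proof -
    have cV: "c t \<in> V" using c_in[OF t] V by blast
    have PV: "P (c t) \<in> V" using P_in[OF c_in[OF t]] V by blast
    have "q (Z (c t) (\<beta> t)) = (\<Sum>b\<in>Basis. (\<beta> t \<bullet> b) *\<^sub>R q (Z (c t) b))"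
      by (subst linear_Basis_expand[OF Z(2)[OF cV], of "\<beta> t"])
         (simp add: linear_sum[OF lin_q] linear_scale[OF lin_q])
    then have "norm (q (Z (c t) (\<beta> t))) \<le> (\<Sum>b\<in>Basis. \<bar>\<beta> t \<bullet> b\<bar> * norm (q (Z (c t) b)))"
      using norm_sum[of "\<lambda>b. (\<beta> t \<bullet> b) *\<^sub>R q (Z (c t) b)" Basis] by simp
    also have "\<dots> \<le> (\<Sum>b\<in>Basis. C * (2 * \<bar>K b\<bar> * norm (q (c t))))"
    proof (intro sum_mono mult_mono)
      fix b :: 'b assume b: "b \<in> Basis"
      show "\<bar>\<beta> t \<bullet> b\<bar> \<le> C" using Basis_le_norm[OF b, of "\<beta> t"] C[OF t] by simp
      have "q (Z (c t) b) = q (Z (c t) b - Z (P (c t)) b)"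
        using q0[OF ZS[OF PV P(2)]] by (simp add: linear_diff[OF lin_q])
      then have "norm (q (Z (c t) b)) \<le> 2 * norm (Z (c t) b - Z (P (c t)) b)" using qle by simp
      also have "\<dots> \<le> 2 * (K b * norm (q (c t)))"
        using K[OF c_in[OF t] P_in[OF c_in[OF t]], of b] by (simp add: q_def)
      also have "\<dots> \<le> 2 * \<bar>K b\<bar> * norm (q (c t))"
        using mult_right_mono[OF abs_ge_self[of "K b"] norm_ge_zero[of "q (c t)"]] by simp
      finally show "norm (q (Z (c t) b)) \<le> 2 * \<bar>K b\<bar> * norm (q (c t))" .
      show "0 \<le> C" using C[OF t] norm_ge_zero[of "\<beta> t"] by linarith
    qed auto
    also have "\<dots> = C' * norm (q (c t))" by (simp add: C'_def sum_distrib_right mult.assoc)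
    finally show ?thesis .
  qed
  have "q (c t) = 0"
    by (rule gronwall_zero[where f = "\<lambda>t. q (c t)", OF bounded_linear.has_vector_derivative[OF bl_q c] bound q0[OF \<open>c 0 \<in> S\<close>] t])
  then show ?thesis using P(2)[of "c t"] by (simp add: q_def)
qed

context coisotropic_chart
begin

text \<open>\<open>Y\<close> is the Hamiltonian vector field, so that \<open>{x \<in> L. Y x \<in> L}\<close> is the hidden constraint set,
  which \<open>F\<close> leaves fixed. Its tangent space at \<open>y\<close> is a complement of the kernel in \<open>L\<close>: Brouwer's theorem
  provides a point of it at distance \<open>o(t)\<close> from \<open>y + t w\<close> whenever \<open>Y' w \<in> L\<close>.\<close>

lemma retraction_derivative:
  assumes y: "y \<in> U" "y \<in> L" and Y: "(Y has_derivative Y') (at y)" "continuous_on U Y" "Y y \<in> L"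
    and F: "(F has_derivative F') (at y)"
    and fix_F: "\<And>x. x \<in> U \<Longrightarrow> x \<in> L \<Longrightarrow> Y x \<in> L \<Longrightarrow> F x = x"
    and kill: "\<And>k. J y k \<in> L\<^sup>\<bottom> \<Longrightarrow> F' k = 0"
    and nondeg: "\<And>k. J y k \<in> L\<^sup>\<bottom> \<Longrightarrow> Y' k \<in> L \<Longrightarrow> k = 0"
    and u: "u \<in> L"
  shows "\<exists>k. J y k \<in> L\<^sup>\<bottom> \<and> F' u = u + k"
proof -
  obtain P where P: "linear P" "\<And>x. P x \<in> L" "\<And>x. x \<in> L \<Longrightarrow> P x = x" "\<And>x. x - P x \<in> L\<^sup>\<bottom>"
    using orthogonal_projection[OF subspace_L] by metis
  define q where "q x = x - P x" for x
  have lin_q: "linear q" unfolding q_def by (intro linear_compose_sub linear_ident P(1))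
  have q0: "q x = 0 \<longleftrightarrow> x \<in> L" for x using P(2,3)[of x] by (auto simp: q_def)
  have linY': "linear Y'" and linF': "linear F'"
    using Y(1) F has_derivative_linear by blast+
  define A where "A v = q (Y' v)" for v
  have lin_A: "linear A" unfolding A_def using linear_compose[OF linY' lin_q] by (simp add: o_def)
  define K where "K = Jinv y ` (L\<^sup>\<bottom>)"
  have K: "k \<in> K \<longleftrightarrow> J y k \<in> L\<^sup>\<bottom>" for k
  proof
    assume "k \<in> K"
    then obtain b where "b \<in> L\<^sup>\<bottom>" "k = Jinv y b" unfolding K_def by blast
    then show "J y k \<in> L\<^sup>\<bottom>" using y(1) by simp
  next
    assume "J y k \<in> L\<^sup>\<bottom>"
    then have "Jinv y (J y k) \<in> K" unfolding K_def by (rule imageI)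
    then show "k \<in> K" using y(1) by simp
  qed
  have subK: "subspace K"
    unfolding K_def by (intro linear_subspace_image linear_Jinv y subspace_orthogonal_comp)
  have KL: "k \<in> L" if "k \<in> K" for k using that coisotropic[OF y] K by blast
  have inj: "inj_on A K"
  proof (rule inj_onI)
    fix a b assume ab: "a \<in> K" "b \<in> K" "A a = A b"
    have "Y' (a - b) \<in> L" using ab(3) q0[of "Y' (a - b)"]
      by (simp add: A_def linear_diff[OF lin_q] linear_diff[OF linY'])
    moreover have "a - b \<in> K" using ab subK subspace_diff by blast
    ultimately show "a = b" using nondeg[of "a - b"] K by simp
  qed
  \<comment> \<open>\<open>A\<close> is injective on \<open>K\<close> by nondegeneracy, and
    \<open>K\<close> has the dimension of \<open>L\<^sup>\<bottom>\<close>, being its image under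
    \<open>Jinv y\<close>; equality of dimensions makes \<open>A\<close> onto.\<close>
  have AK: "A ` K = L\<^sup>\<bottom>"
  proof (rule subspace_dim_equal)
    show "subspace (A ` K)" by (intro linear_subspace_image lin_A subK)
    show "subspace (L\<^sup>\<bottom>)" by (rule subspace_orthogonal_comp)
    show "A ` K \<subseteq> L\<^sup>\<bottom>" using P(4) by (auto simp: A_def q_def)
    have inv: "inj (Jinv y)" by (rule inj_on_inverseI[of _ "J y"]) (simp add: y(1))
    have "dim K = dim (L\<^sup>\<bottom>)"
      unfolding K_def by (rule dim_image_eq[OF linear_Jinv[OF y(1)] inj_on_subset[OF inv subset_UNIV]])
    moreover have "dim (A ` K) = dim K"
      using inj by (intro dim_image_eq lin_A) (simp add: span_eq_iff[THEN iffD2, OF subK])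
    ultimately show "dim (L\<^sup>\<bottom>) \<le> dim (A ` K)" by simp
  qed
  have "- A u \<in> L\<^sup>\<bottom>"
    using subspace_neg[OF subspace_orthogonal_comp P(4)] by (simp only: A_def q_def)
  \<comment> \<open>The correction \<open>k0\<close> moves \<open>u\<close> along the kernel to the
    vector \<open>w\<close> with \<open>A w = 0\<close>, a direction tangent to the hidden set to
    first order.\<close>
  then obtain k0 where k0: "k0 \<in> K" "A k0 = - A u"
    unfolding AK[symmetric] by (metis imageE)
  obtain B where B: "range B \<subseteq> K" "linear B" "\<And>k. k \<in> K \<Longrightarrow> B (A k) = k"
    using linear_exists_left_inverse_on[OF lin_A subK inj] by blast
  have lin_Bq: "linear (\<lambda>v. B (q v))" using linear_compose[OF lin_q B(2)] by (simp add: o_def)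
  obtain b where b: "b > 0" "\<And>v. norm (B (q v)) \<le> b * norm v"
    using linear_bounded_pos[OF lin_Bq] by blast
  define w where "w = u + k0"
  have Aw: "A w = 0" using k0 by (simp add: w_def linear_add[OF lin_A])
  have wL: "w \<in> L" unfolding w_def by (intro subspace_add subspace_L u KL k0)
  \<comment> \<open>\<open>G w\<close> is the failure of \<open>F'\<close> to fix \<open>w\<close>;
    it will be bounded by arbitrarily small numbers.\<close>
  define G where "G v = F' v - v" for v
  have linG: "linear G" unfolding G_def by (intro linear_compose_sub linear_ident linF')
  obtain g where g: "g > 0" "\<And>v. norm (G v) \<le> g * norm v"
    using linear_bounded_pos[OF linG] by blast
  have Fy: "F y = y" using fix_F[OF y Y(3)] .
  obtain d3 where d3: "d3 > 0" "ball y d3 \<subseteq> U" using y(1) open_U openE by blast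
  have main: "norm (G w) \<le> \<epsilon> * (norm w + 1 + g)" if \<epsilon>: "0 < \<epsilon>" "\<epsilon> \<le> 1" for \<epsilon>
  proof -
    have w1: "norm w + 1 > 0" by (smt (verit) norm_ge_zero)
    \<comment> \<open>Chosen so that the remainder of \<open>Y\<close> at scale \<open>t\<close>,
      mapped by \<open>B\<close> after \<open>q\<close> with norm bound \<open>b\<close>, stays
      within the radius \<open>\<epsilon> * t\<close> of \<open>D\<close>.\<close>
    define \<eta> where "\<eta> = \<epsilon> / (b * (norm w + 1))"
    have \<eta>: "\<eta> > 0" using \<epsilon> b w1 by (simp add: \<eta>_def)
    obtain d1 where d1: "d1 > 0" "\<And>x. norm (x - y) < d1 \<Longrightarrow> norm (Y x - Y y - Y' (x - y)) \<le> \<eta> * norm (x - y)"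
      using Y(1) \<eta> unfolding has_derivative_at_alt by blast
    obtain d2 where d2: "d2 > 0" "\<And>x. norm (x - y) < d2 \<Longrightarrow> norm (F x - F y - F' (x - y)) \<le> \<epsilon> * norm (x - y)"
      using F \<epsilon> unfolding has_derivative_at_alt by blast
    define d where "d = min d1 (min d2 d3)"
    have d: "d > 0" using d1 d2 d3 by (simp add: d_def)
    define t where "t = d / 2 / (norm w + 1)"
    have t: "t > 0" using d w1 by (simp add: t_def)
    have "t * (norm w + 1) = d / 2"
      unfolding t_def using w1 by (intro nonzero_divide_eq_eq[THEN iffD1, symmetric] refl) simp
    then have td: "t * (norm w + 1) < d" using d by simp
    have small: "norm (t *\<^sub>R w + s) \<le> t * (norm w + \<epsilon>)" if "norm s \<le> \<epsilon> * t" for s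
      using norm_triangle_ineq[of "t *\<^sub>R w" s] that t by (simp add: algebra_simps)
    have small1: "norm (t *\<^sub>R w + s) \<le> t * (norm w + 1)" if "norm s \<le> \<epsilon> * t" for s
    proof -
      have "t * (norm w + \<epsilon>) \<le> t * (norm w + 1)" using \<epsilon> t by (intro mult_left_mono) auto
      then show ?thesis using small[OF that] by linarith
    qed
    define D where "D = K \<inter> cball 0 (\<epsilon> * t)"
    \<comment> \<open>A simplified Newton map: \<open>B\<close> inverts \<open>A\<close> on the
      kernel, and a fixed point \<open>s\<close> is a zero of
      \<open>B (q (Y (y + (t *\<^sub>R w + s))))\<close>. The derivative of \<open>Y\<close> is
      controlled only at \<open>y\<close>, so the fixed point comes from continuity and not from a
      contraction.\<close>
    define \<psi> where "\<psi> s = s - B (q (Y (y + (t *\<^sub>R w + s))))" for s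
    have in_U: "y + (t *\<^sub>R w + s) \<in> U" if "norm s \<le> \<epsilon> * t" for s
    proof -
      have "dist (y + (t *\<^sub>R w + s)) y < d3"
        using small1[OF that] td by (simp add: dist_norm d_def)
      then show ?thesis using d3(2) by (auto simp: dist_commute)
    qed
    obtain s where s: "s \<in> D" "\<psi> s = s"
    proof (rule brouwer[of D \<psi>])
      show "compact D" unfolding D_def
        by (intro closed_Int_compact closed_subspace subK compact_cball)
      show "convex D" unfolding D_def by (intro convex_Int subspace_imp_convex subK convex_cball)
      show "D \<noteq> {}" using subspace_0[OF subK] \<epsilon> t by (auto simp: D_def)
      have "continuous_on D (\<lambda>s. Y (y + (t *\<^sub>R w + s)))"
        by (rule continuous_on_compose2[OF Y(2)]) (use in_U in \<open>auto intro!: continuous_intros simp: D_def\<close>)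
      then show "continuous_on D \<psi>"
        unfolding \<psi>_def
        using linear_continuous_on_compose[OF _ lin_Bq] by (intro continuous_intros) blast
      show "\<psi> \<in> D \<rightarrow> D"
      proof
        fix s assume s: "s \<in> D"
        then have sK: "s \<in> K" and sn: "norm s \<le> \<epsilon> * t" by (auto simp: D_def)
        let ?h = "t *\<^sub>R w + s"
        define R where "R = Y (y + ?h) - Y y - Y' ?h"
        have "q (Y' ?h) = A s"
          by (simp add: A_def[symmetric] linear_add[OF lin_A] linear_scale[OF lin_A] Aw)
        moreover have "Y (y + ?h) = R + Y y + Y' ?h" by (simp add: R_def)
        ultimately have "q (Y (y + ?h)) = q R + A s"
          using q0[of "Y y"] Y(3) linear_add[OF lin_q] by simp
        then have \<psi>s: "\<psi> s = - B (q R)"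
          using B(3)[OF sK] linear_add[OF B(2)] by (simp add: \<psi>_def)
        have "norm R \<le> \<eta> * norm ?h"
          using d1(2)[of "y + ?h"] small1[OF sn] td by (simp add: R_def d_def)
        also have "\<dots> \<le> \<eta> * (t * (norm w + 1))" using small1[OF sn] \<eta> by (intro mult_left_mono) auto
        finally have R: "norm R \<le> \<eta> * (t * (norm w + 1))" .
        have "norm (\<psi> s) \<le> b * norm R" using b(2)[of R] by (simp add: \<psi>s)
        also have "\<dots> \<le> b * (\<eta> * (t * (norm w + 1)))" using R b(1) by (intro mult_left_mono) auto
        also have "\<dots> = \<epsilon> * t" using b w1 by (simp add: \<eta>_def)
        finally have "norm (\<psi> s) \<le> \<epsilon> * t" .
        moreover have "\<psi> s \<in> K" unfolding \<psi>s using B(1) subspace_neg[OF subK] by blast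
        ultimately show "\<psi> s \<in> D" by (simp add: D_def)
      qed
    qed
    then have sK: "s \<in> K" and sn: "norm s \<le> \<epsilon> * t" by (auto simp: D_def)
    let ?h = "t *\<^sub>R w + s"
    \<comment> \<open>Every value of \<open>q\<close> has the form \<open>A k\<close> with
      \<open>k\<close> in \<open>K\<close>, and \<open>B\<close> returns \<open>k\<close>; so a
      value of \<open>q\<close> annihilated by \<open>B\<close> is zero.\<close>
    have "B (q (Y (y + ?h))) = 0" using s(2) by (simp add: \<psi>_def)
    moreover obtain k where "k \<in> K" "q (Y (y + ?h)) = A k"
      using AK P(4)[of "Y (y + ?h)"] unfolding q_def by blast
    ultimately have "q (Y (y + ?h)) = 0" using B(3) linear_0[OF lin_A] by metis
    then have "Y (y + ?h) \<in> L" using q0 by blast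
    moreover have "y + ?h \<in> L"
      by (intro subspace_add subspace_L subspace_scale y wL KL sK)
    ultimately have "F (y + ?h) = y + ?h" using fix_F[OF in_U[OF sn]] by blast
    moreover have "norm (F (y + ?h) - F y - F' ?h) \<le> \<epsilon> * norm ?h"
      using d2(2)[of "y + ?h"] small1[OF sn] td by (simp add: d_def)
    ultimately have "norm (G ?h) \<le> \<epsilon> * norm ?h"
      by (simp add: Fy G_def norm_minus_commute)
    also have "\<dots> \<le> \<epsilon> * (t * (norm w + 1))" using small1[OF sn] \<epsilon> by (intro mult_left_mono) auto
    finally have Gh: "norm (G ?h) \<le> \<epsilon> * (t * (norm w + 1))" .
    have "norm (G s) \<le> g * (\<epsilon> * t)" using g(2)[of s] mult_left_mono[OF sn, of g] g(1) by linarith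
    moreover have "t *\<^sub>R G w = G ?h - G s" by (simp add: linear_add[OF linG] linear_scale[OF linG])
    ultimately have "t * norm (G w) \<le> \<epsilon> * (t * (norm w + 1)) + g * (\<epsilon> * t)"
      using Gh norm_triangle_ineq4[of "G ?h" "G s"] t by (metis (no_types, lifting) abs_of_pos add_mono norm_scaleR order_trans)
    then have "t * norm (G w) \<le> t * (\<epsilon> * (norm w + 1 + g))" by (simp add: algebra_simps)
    then show ?thesis using t by simp
  qed
  have "norm (G w) \<le> 0"
  proof (rule ccontr)
    assume "\<not> norm (G w) \<le> 0"
    then have pos: "norm (G w) > 0" by simp
    define M where "M = norm w + 1 + g"
    have M: "M > 0" using g(1) by (smt (verit) M_def norm_ge_zero)
    \<comment> \<open>With this choice the bound is at most half of \<open>norm (G w)\<close>; the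
      minimum respects the restriction \<open>\<epsilon> \<le> 1\<close>.\<close>
    define \<epsilon> where "\<epsilon> = min 1 (norm (G w) / (2 * M))"
    have "norm (G w) \<le> \<epsilon> * M"
      unfolding M_def using main[of \<epsilon>] pos M by (simp add: \<epsilon>_def)
    also have "\<dots> \<le> norm (G w) / (2 * M) * M"
      using M by (intro mult_right_mono) (auto simp: \<epsilon>_def)
    also have "\<dots> < norm (G w)" using pos M by simp
    finally show False by simp
  qed
  then have "F' w = w" by (simp add: G_def)
  then have "F' u = u + k0"
    using kill[of k0] K k0(1) by (simp add: w_def linear_add[OF linF'])
  then show ?thesis using K k0(1) by blast
qed

text \<open>With \<open>H'\<close> the Hamiltonian in coordinates adapted to the leaf and \<open>\<tau>\<close> the change of coordinates:
  on the leaf, \<open>d(H \<circ> \<tau>) v = \<omega>(Y, d\<tau> v)\<close> only sees the part of \<open>Y\<close> normal to \<open>L\<close>, which vanishes at the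
  critical point.\<close>

lemma hessian_zero_if_normal_derivative_zero:
  fixes \<tau> :: "'a \<Rightarrow> 'a"
  assumes V: "open V" "\<xi> \<in> V" "subspace N" "\<xi> \<in> N"
    and \<tau>: "smooth_on V \<tau>" "\<tau> ` V \<subseteq> U" "\<And>x. x \<in> V \<Longrightarrow> x \<in> N \<Longrightarrow> \<tau> x \<in> L"
    and ker: "\<And>x v. x \<in> V \<Longrightarrow> x \<in> N \<Longrightarrow> v \<in> N \<Longrightarrow> J (\<tau> x) (fd \<tau> x v) \<in> L\<^sup>\<bottom>"
    and H: "smooth_on V H'" "\<And>x v. x \<in> V \<Longrightarrow> fd H' x v = J (\<tau> x) (Y (\<tau> x)) \<bullet> fd \<tau> x v"
    and Y: "(Y has_derivative Y') (at (\<tau> \<xi>))" "Y (\<tau> \<xi>) \<in> L" "Y' (fd \<tau> \<xi> u) \<in> L"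
    and uv: "u \<in> N" "v \<in> N"
  shows "fd (\<lambda>x. fd H' x v) \<xi> u = 0"
proof -
  obtain P where P: "linear P" "\<And>x. P x \<in> L" "\<And>x. x \<in> L \<Longrightarrow> P x = x"
    using orthogonal_projection[OF subspace_L] by metis
  define q where "q x = x - P x" for x
  have lin_q: "linear q" unfolding q_def by (intro linear_compose_sub linear_ident P(1))
  have bl_q: "bounded_linear q" using lin_q by (simp add: linear_conv_bounded_linear)
  have q0: "q x = 0" if "x \<in> L" for x using P(3)[OF that] by (simp add: q_def)
  have \<tau>U: "\<tau> x \<in> U" if "x \<in> V" for x using \<tau>(2) that by blast
  define B where "B x a b = J (\<tau> x) a \<bullet> b" for x a b
  have bil: "bilinear (B x)" if "x \<in> V" for x
    unfolding B_def bilinear_def using linear_J[OF \<tau>U[OF that]]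
    by (auto intro!: linearI simp: linear_add linear_scale inner_add_left inner_add_right)
  have smB: "smooth_on V (\<lambda>x. B x a b)" for a b
    unfolding B_def
    by (intro smooth_on_bounded_linear_compose[OF bounded_linear_inner_left] V(1)
        smooth_on_compose[OF smooth_J \<tau>(1) V(1) open_U \<tau>(2)])
  have dq: "((\<lambda>x. q (Y (\<tau> x))) has_derivative (\<lambda>u. q (Y' (fd \<tau> \<xi> u)))) (at \<xi>)"
    by (rule bounded_linear.has_derivative[OF bl_q],
        rule has_derivative_compose[OF smooth_on_has_derivative[OF \<tau>(1) V(2)] Y(1)])
  have dB: "((\<lambda>x. B x (q (Y (\<tau> x))) (fd \<tau> x v)) has_derivative
      (\<lambda>u. fd (\<lambda>x. B x (q (Y (\<tau> \<xi>))) (fd \<tau> \<xi> v)) \<xi> u + B \<xi> (q (Y' (fd \<tau> \<xi> u))) (fd \<tau> \<xi> v)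
        + B \<xi> (q (Y (\<tau> \<xi>))) (fd (\<lambda>x. fd \<tau> x v) \<xi> u))) (at \<xi>)"
    by (rule has_derivative_bilinear_family[where B = B and f = "\<lambda>x. q (Y (\<tau> x))", OF V(1,2) bil
          smooth_on_imp_differentiable[OF smB V(2)] dq
          smooth_on_has_derivative[OF smooth_on_fd[OF \<tau>(1)] V(2)]])
  have dH: "((\<lambda>x. fd H' x v) has_derivative fd (\<lambda>x. fd H' x v) \<xi>) (at \<xi>)"
    by (rule smooth_on_has_derivative[OF smooth_on_fd[OF H(1)] V(2)])
  \<comment> \<open>By skew-symmetry the projection of \<open>Y\<close> to \<open>L\<close> pairs to
    zero with the kernel vector \<open>fd \<tau> x v\<close>, so only the normal component
    \<open>q\<close> survives.\<close>
  have eq: "fd H' x v - B x (q (Y (\<tau> x))) (fd \<tau> x v) = 0" if x: "x \<in> V" "x \<in> N" for x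
  proof -
    have "J (\<tau> x) (P (Y (\<tau> x))) \<bullet> fd \<tau> x v = 0"
      using ker[OF x uv(2)] P(2) skew[OF \<tau>U[OF x(1)], of "P (Y (\<tau> x))" "fd \<tau> x v"]
      by (simp add: mem_orthogonal_comp)
    then show ?thesis
      using linear_diff[OF linear_J[OF \<tau>U[OF x(1)]], of "Y (\<tau> x)" "P (Y (\<tau> x))"]
      by (simp add: H(2)[OF x(1)] B_def q_def inner_diff_left)
  qed
  have "fd (\<lambda>x. fd H' x v) \<xi> u - (fd (\<lambda>x. B x (q (Y (\<tau> \<xi>))) (fd \<tau> \<xi> v)) \<xi> u
      + B \<xi> (q (Y' (fd \<tau> \<xi> u))) (fd \<tau> \<xi> v)
        + B \<xi> (q (Y (\<tau> \<xi>))) (fd (\<lambda>x. fd \<tau> x v) \<xi> u)) = 0"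
    by (rule has_derivative_zero_along_subspace[OF has_derivative_diff[OF dH dB] V(1,2,4) uv(1) V(3) eq])
  \<comment> \<open>The vectors \<open>q (Y (\<tau> \<xi>))\<close> and
    \<open>q (Y' (fd \<tau> \<xi> u))\<close> are zero, so all three terms of the product rule
    vanish; this is the first of them.\<close>
  moreover have "fd (\<lambda>x. B x 0 (fd \<tau> \<xi> v)) \<xi> u = 0"
  proof -
    have "((\<lambda>x. B x 0 (fd \<tau> \<xi> v)) has_derivative (\<lambda>u. 0)) (at \<xi>)"
      by (rule has_derivative_transform_within_open[OF has_derivative_const V(1,2)])
         (use bil in \<open>simp add: bilinear_lzero\<close>)
    then show ?thesis by (rule fun_cong[OF fd_eqI])
  qed
  ultimately show ?thesis
    using bilinear_lzero[OF bil[OF V(2)]] by (simp add: q0[OF Y(2)] q0[OF Y(3)])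
qed

end

section \<open>Charts and tangent vectors\<close>

lemma is_chartD:
  assumes "is_chart c"
  shows "open (fst c)" "open (chart_img c)" "continuous_on (fst c) (snd c)"
    "continuous_on (chart_img c) (chart_inv c)"
    "p \<in> fst c \<Longrightarrow> chart_inv c (snd c p) = p" "y \<in> chart_img c \<Longrightarrow> snd c (chart_inv c y) = y"
    "p \<in> fst c \<Longrightarrow> snd c p \<in> chart_img c" "y \<in> chart_img c \<Longrightarrow> chart_inv c y \<in> fst c"
  using assms unfolding is_chart_def homeomorphism_def chart_img_def by auto

lemma chart_overlap:
  assumes "is_chart c"
  shows "snd c ` (fst c \<inter> B) = {y \<in> chart_img c. chart_inv c y \<in> B}"
proof (rule set_eqI, rule iffI)
  fix y assume "y \<in> {y \<in> chart_img c. chart_inv c y \<in> B}"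
  then show "y \<in> snd c ` (fst c \<inter> B)"
    using is_chartD(6,8)[OF assms] by (intro image_eqI[where x = "chart_inv c y"]) auto
qed (use is_chartD(5,7)[OF assms] in auto)

lemma open_chart_overlap:
  assumes "is_chart c" "open B"
  shows "open (snd c ` (fst c \<inter> B))"
  using continuous_open_preimage[OF is_chartD(4,2)[OF assms(1)] assms(2)]
  unfolding chart_overlap[OF assms(1)] by (simp add: vimage_def Int_def)

lemma open_chart_preimage:
  assumes "is_chart c" "open V"
  shows "open {p \<in> fst c. snd c p \<in> V}"
  using continuous_open_preimage[OF is_chartD(3,1)[OF assms(1)] assms(2)]
  by (simp add: vimage_def Int_def)

lemma smooth_chart_is_chart: "smooth_chart A c \<Longrightarrow> is_chart c"
  by (simp add: smooth_chart_def)

lemma slice_chart_iff: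
  assumes "slice_chart A S c L" "p \<in> fst c"
  shows "p \<in> S \<longleftrightarrow> snd c p \<in> L"
proof -
  have c: "is_chart c" using assms(1) by (simp add: slice_chart_def smooth_chart_def)
  have eq: "snd c ` (S \<inter> fst c) = chart_img c \<inter> L" using assms(1) by (simp add: slice_chart_def)
  show ?thesis
  proof
    assume "snd c p \<in> L"
    then have "snd c p \<in> snd c ` (S \<inter> fst c)" using eq is_chartD(7)[OF c assms(2)] by blast
    then obtain r where r: "r \<in> S" "r \<in> fst c" "snd c p = snd c r" by blast
    then have "p = r" using is_chartD(5)[OF c r(2)] is_chartD(5)[OF c assms(2)] by simp
    then show "p \<in> S" using r(1) by simp
  qed (use eq assms(2) in blast)
qed

lemma slice_chart_inv:
  assumes "slice_chart A S c L" "y \<in> chart_img c"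
  shows "chart_inv c y \<in> S \<longleftrightarrow> y \<in> L"
proof -
  have c: "is_chart c" using assms(1) by (simp add: slice_chart_def smooth_chart_def)
  show ?thesis
    using slice_chart_iff[OF assms(1) is_chartD(8)[OF c assms(2)]] is_chartD(6)[OF c assms(2)] by simp
qed

lemma smooth_map_on_subset:
  assumes f: "smooth_map_on A B S f" and "T \<subseteq> S"
  shows "smooth_map_on A B T f"
  unfolding smooth_map_on_def
proof (intro ballI impI)
  fix p c d assume p: "p \<in> T" "c \<in> A" "d \<in> B" "p \<in> fst c \<and> f p \<in> fst d"
  then have "p \<in> S" using assms(2) by blast
  from f[unfolded smooth_map_on_def, rule_format, OF this p(2-4)]
  obtain U F where "open U" "snd c p \<in> U" "smooth_on U F"
    "\<forall>x \<in> S \<inter> fst c. snd c x \<in> U \<longrightarrow> f x \<in> fst d \<and> F (snd c x) = snd d (f x)"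
    by blast
  moreover have "T \<inter> fst c \<subseteq> S \<inter> fst c" using assms(2) by blast
  ultimately show "\<exists>U F. open U \<and> snd c p \<in> U \<and> smooth_on U F \<and>
      (\<forall>x \<in> T \<inter> fst c. snd c x \<in> U \<longrightarrow> f x \<in> fst d \<and> F (snd c x) = snd d (f x))"
    by blast
qed

locale manifold =
  fixes A :: "('p::{t2_space, second_countable_topology}, 'e::euclidean_space) chart set"
  assumes atlas: "smooth_atlas A"
begin

lemma atlas_smooth_chart: "c \<in> A \<Longrightarrow> smooth_chart A c"
  using atlas by (simp add: smooth_atlas_def smooth_chart_def)

lemma chart_at: "chart_at A p \<in> A" "p \<in> fst (chart_at A p)" "smooth_chart A (chart_at A p)"
proof -
  have "\<exists>c. c \<in> A \<and> p \<in> fst c" using atlas unfolding smooth_atlas_def by blast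
  then have "chart_at A p \<in> A \<and> p \<in> fst (chart_at A p)"
    unfolding chart_at_def by (rule someI_ex)
  then show "chart_at A p \<in> A" "p \<in> fst (chart_at A p)" "smooth_chart A (chart_at A p)"
    by (simp_all add: atlas_smooth_chart)
qed

text \<open>A chart of the maximal atlas is compatible by definition only with the charts of
  \<open>A\<close>; near each point the transition therefore factors through a chart of
  \<open>A\<close>.\<close>

lemma smooth_transition:
  assumes c: "smooth_chart A c" and d: "smooth_chart A d"
  shows "smooth_on (snd c ` (fst c \<inter> fst d)) (snd d \<circ> chart_inv c)"
proof (rule smooth_on_local)
  note cc = smooth_chart_is_chart[OF c] and dd = smooth_chart_is_chart[OF d]
  fix y assume "y \<in> snd c ` (fst c \<inter> fst d)"
  then obtain p where p: "p \<in> fst c" "p \<in> fst d" "y = snd c p" by blast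
  let ?a = "chart_at A p"
  note aa = smooth_chart_is_chart[OF chart_at(3)[of p]]
  let ?V = "snd c ` (fst c \<inter> (fst d \<inter> fst ?a))"
  have V: "open ?V"
    by (rule open_chart_overlap[OF cc]) (intro open_Int is_chartD(1)[OF dd] is_chartD(1)[OF aa])
  have s1: "smooth_on (snd c ` (fst c \<inter> fst ?a)) (snd ?a \<circ> chart_inv c)"
    "smooth_on (snd ?a ` (fst ?a \<inter> fst d)) (snd d \<circ> chart_inv ?a)"
    using c d chart_at(1)[of p] unfolding smooth_chart_def smooth_transition_def by auto
  have "smooth_on ?V (\<lambda>x. (snd d \<circ> chart_inv ?a) ((snd ?a \<circ> chart_inv c) x))"
    by (rule smooth_on_compose[OF s1(2) smooth_on_subset[OF s1(1)] V open_chart_overlap[OF aa is_chartD(1)[OF dd]]])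
       (auto simp: is_chartD[OF cc])
  then have "smooth_on ?V (snd d \<circ> chart_inv c)"
    by (rule smooth_on_cong[OF V, rotated]) (auto simp: is_chartD[OF cc] is_chartD[OF aa])
  then show "\<exists>V. open V \<and> y \<in> V \<and> smooth_on V (snd d \<circ> chart_inv c)"
    using V p chart_at(2)[of p] by blast
qed

lemma transition_has_derivative:
  assumes "smooth_chart A c" "smooth_chart A d" "p \<in> fst c" "p \<in> fst d"
  shows "((snd d \<circ> chart_inv c) has_derivative fd (snd d \<circ> chart_inv c) (snd c p)) (at (snd c p))"
  using smooth_on_has_derivative[OF smooth_transition[OF assms(1,2)]] assms(3,4) by blast

text \<open>The chain rule through a change of charts, stated for a general \<open>g\<close> because
  it serves for the coordinates of a third chart as well as for the Hamiltonian.\<close>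

lemma fd_coordinate_change:
  assumes c: "smooth_chart A c" "p \<in> fst c" and d: "smooth_chart A d" "p \<in> fst d"
    and g: "((g \<circ> chart_inv d) has_derivative g') (at (snd d p))"
  shows "g' (fd (snd d \<circ> chart_inv c) (snd c p) v) = fd (g \<circ> chart_inv c) (snd c p) v"
proof -
  note cc = smooth_chart_is_chart[OF c(1)] and dd = smooth_chart_is_chart[OF d(1)]
  have 1: "((\<lambda>y. (g \<circ> chart_inv d) ((snd d \<circ> chart_inv c) y)) has_derivative
      (\<lambda>v. g' (fd (snd d \<circ> chart_inv c) (snd c p) v))) (at (snd c p))"
  proof (rule has_derivative_compose[OF transition_has_derivative[OF c(1) d(1) c(2) d(2)]])
    have "(snd d \<circ> chart_inv c) (snd c p) = snd d p" by (simp add: is_chartD(5)[OF cc c(2)])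
    then show "((g \<circ> chart_inv d) has_derivative g') (at ((snd d \<circ> chart_inv c) (snd c p)))"
      using g by (simp only:)
  qed
  have "((g \<circ> chart_inv c) has_derivative (\<lambda>v. g' (fd (snd d \<circ> chart_inv c) (snd c p) v))) (at (snd c p))"
    by (rule has_derivative_transform_within_open[OF 1 open_chart_overlap[OF cc is_chartD(1)[OF dd]]])
       (use c d in \<open>auto simp: is_chartD[OF cc] is_chartD[OF dd]\<close>)
  then show ?thesis by (rule fun_cong[OF fd_eqI, symmetric])
qed

lemma fd_transition_compose:
  assumes c: "smooth_chart A c" "p \<in> fst c" and d: "smooth_chart A d" "p \<in> fst d"
    and e: "smooth_chart A e" "p \<in> fst e"
  shows "fd (snd e \<circ> chart_inv d) (snd d p) (fd (snd d \<circ> chart_inv c) (snd c p) v)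
    = fd (snd e \<circ> chart_inv c) (snd c p) v"
  by (rule fd_coordinate_change[OF c d transition_has_derivative[OF d(1) e(1) d(2) e(2)]])

lemma fd_transition_refl:
  assumes c: "smooth_chart A c" "p \<in> fst c"
  shows "fd (snd c \<circ> chart_inv c) (snd c p) v = v"
proof -
  note cc = smooth_chart_is_chart[OF c(1)]
  have "((snd c \<circ> chart_inv c) has_derivative (\<lambda>v. v)) (at (snd c p))"
    by (rule has_derivative_transform_within_open[OF has_derivative_ident is_chartD(2)[OF cc]])
       (use c in \<open>auto simp: is_chartD[OF cc]\<close>)
  then show ?thesis by (simp add: fun_cong[OF fd_eqI])
qed

lemma fd_transition_inverse:
  assumes "smooth_chart A c" "p \<in> fst c" "smooth_chart A d" "p \<in> fst d"
  shows "fd (snd c \<circ> chart_inv d) (snd d p) (fd (snd d \<circ> chart_inv c) (snd c p) v) = v"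
  using fd_transition_compose[OF assms assms(1,2)] fd_transition_refl[OF assms(1,2)] by simp

lemma linear_fd_transition:
  assumes "smooth_chart A c" "smooth_chart A d" "p \<in> fst c" "p \<in> fst d"
  shows "linear (fd (snd d \<circ> chart_inv c) (snd c p))"
  using transition_has_derivative[OF assms] has_derivative_linear by blast

text \<open>Translates the coordinates of a tangent vector in \<open>c\<close> into those of
  \<open>chart_at A p\<close>, the chart by which the tangent space at \<open>p\<close> is
  identified with the model space.\<close>

definition to_std :: "('p, 'e) chart \<Rightarrow> 'p \<Rightarrow> 'e \<Rightarrow> 'e" where
  "to_std c p = fd (snd (chart_at A p) \<circ> chart_inv c) (snd c p)"

lemma linear_to_std: "smooth_chart A c \<Longrightarrow> p \<in> fst c \<Longrightarrow> linear (to_std c p)"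
  unfolding to_std_def by (rule linear_fd_transition[OF _ chart_at(3) _ chart_at(2)])

lemma to_std_transition:
  assumes "smooth_chart A c" "p \<in> fst c" "smooth_chart A d" "p \<in> fst d"
  shows "to_std d p (fd (snd d \<circ> chart_inv c) (snd c p) v) = to_std c p v"
  unfolding to_std_def by (rule fd_transition_compose[OF assms chart_at(3,2)])

lemma inj_to_std: "smooth_chart A c \<Longrightarrow> p \<in> fst c \<Longrightarrow> inj (to_std c p)"
  unfolding to_std_def
  by (rule inj_on_inverseI, rule fd_transition_inverse[OF _ _ chart_at(3,2)])

lemma surj_to_std: "smooth_chart A c \<Longrightarrow> p \<in> fst c \<Longrightarrow> surj (to_std c p)"
  by (rule linear_injective_imp_surjective[OF linear_to_std inj_to_std]) auto

lemma velocity_eqI: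
  assumes c: "smooth_chart A c" and "e > 0" "\<And>t. \<bar>t\<bar> < e \<Longrightarrow> \<gamma> t \<in> fst c"
    and v: "((\<lambda>t. snd c (\<gamma> t)) has_vector_derivative v) (at 0)"
  shows "velocity A \<gamma> 0 = to_std c (\<gamma> 0) v"
proof -
  note cc = smooth_chart_is_chart[OF c(1)]
  let ?d = "chart_at A (\<gamma> 0)"
  have \<gamma>0: "\<gamma> 0 \<in> fst c" using assms(2,3) by simp
  have "((\<lambda>t. (snd ?d \<circ> chart_inv c) (snd c (\<gamma> t))) has_vector_derivative to_std c (\<gamma> 0) v) (at 0)"
    using vector_derivative_diff_chain_within[OF v, of "snd ?d \<circ> chart_inv c" "to_std c (\<gamma> 0)"]
      has_derivative_at_withinI[OF transition_has_derivative[OF c chart_at(3) \<gamma>0 chart_at(2)]]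
    unfolding to_std_def comp_def .
  then have "((snd ?d \<circ> \<gamma>) has_vector_derivative to_std c (\<gamma> 0) v) (at 0)"
    by (rule has_vector_derivative_transform_within_open[where S = "ball 0 e"])
       (use assms(2,3) in \<open>auto simp: is_chartD(5)[OF cc]\<close>)
  then show ?thesis
    unfolding velocity_def by (rule vector_derivative_at)
qed

lemma curve_in_coord:
  assumes \<gamma>: "curve_in A S x \<gamma>" and c: "smooth_chart A c" "x \<in> fst c"
  obtains e v where "e > 0" "\<And>t. \<bar>t\<bar> < e \<Longrightarrow> \<gamma> t \<in> fst c \<inter> S"
    "((\<lambda>t. snd c (\<gamma> t)) has_vector_derivative v) (at 0)"
proof -
  note cc = smooth_chart_is_chart[OF c(1)]
  let ?d = "chart_at A x"
  note dd = smooth_chart_is_chart[OF chart_at(3)[of x]]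
  obtain e where e: "e > 0" "smooth_map_on std_atlas A {-e<..<e} \<gamma>" "\<gamma> ` {-e<..<e} \<subseteq> S" and x: "\<gamma> 0 = x"
    using \<gamma> unfolding curve_in_def by blast
  have "0 \<in> {-e<..<e}" "(UNIV, id) \<in> std_atlas" using e(1) by (auto simp: std_atlas_def)
  then obtain U F where U: "open U" "0 \<in> U" "smooth_on U F"
    and F: "\<And>t. t \<in> {-e<..<e} \<Longrightarrow> t \<in> U \<Longrightarrow> \<gamma> t \<in> fst ?d \<and> F t = snd ?d (\<gamma> t)"
    using e(2) chart_at(1,2)[of x] x unfolding smooth_map_on_def by fastforce
  let ?B = "snd ?d ` (fst ?d \<inter> fst c)"
  have B: "open ?B" by (rule open_chart_overlap[OF dd is_chartD(1)[OF cc]])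
  have F0: "F 0 = snd ?d x" using F[of 0] U(2) e(1) x by simp
  have dF: "(F has_derivative fd F 0) (at 0)" using smooth_on_has_derivative[OF U(3,2)] .
  have "open (F -` ?B \<inter> U)"
    using continuous_open_preimage[OF smooth_on_imp_continuous_on[OF U(3)] U(1) B] by (simp add: Int_commute)
  moreover have "0 \<in> F -` ?B \<inter> U" using F0 U(2) c(2) chart_at(2) by auto
  ultimately obtain r where r: "r > 0" "ball 0 r \<subseteq> F -` ?B \<inter> U" using openE by blast
  define e' where "e' = min e r"
  have e': "e' > 0" using e r by (simp add: e'_def)
  have near: "\<gamma> t \<in> fst c \<inter> S \<and> \<gamma> t \<in> fst ?d \<and> F t = snd ?d (\<gamma> t)" if "\<bar>t\<bar> < e'" for t
  proof -
    have t: "t \<in> {-e<..<e}" "t \<in> ball 0 r" using that by (auto simp: e'_def)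
    then have "t \<in> U" "F t \<in> ?B" using r(2) by auto
    with F[OF t(1)] have 1: "\<gamma> t \<in> fst ?d" "snd ?d (\<gamma> t) \<in> ?B" "F t = snd ?d (\<gamma> t)" by auto
    then have "chart_inv ?d (snd ?d (\<gamma> t)) \<in> fst c" unfolding chart_overlap[OF dd] by blast
    then show ?thesis using 1 e(3) t(1) is_chartD(5)[OF dd 1(1)] by auto
  qed
  have "((\<lambda>t. (snd c \<circ> chart_inv ?d) (F t)) has_vector_derivative
      fd (snd c \<circ> chart_inv ?d) (F 0) (fd F 0 1)) (at 0)"
  proof -
    have 1: "((\<lambda>t. (snd c \<circ> chart_inv ?d) (F t)) has_derivative
        (\<lambda>r. fd (snd c \<circ> chart_inv ?d) (F 0) (fd F 0 r))) (at 0)"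
      by (rule has_derivative_compose[OF dF])
         (use transition_has_derivative[OF chart_at(3) c(1) chart_at(2) c(2)] in \<open>simp only: F0\<close>)
    have 2: "fd (snd c \<circ> chart_inv ?d) (F 0) (fd F 0 r) = r *\<^sub>R fd (snd c \<circ> chart_inv ?d) (F 0) (fd F 0 1)" for r
    proof -
      have "fd F 0 r = r *\<^sub>R fd F 0 1"
        using linear_scale[OF has_derivative_linear[OF dF], of r 1] by simp
      then show ?thesis
        using linear_scale[OF linear_fd_transition[OF chart_at(3) c(1) chart_at(2) c(2)], of r "fd F 0 1"]
        by (simp only: F0)
    qed
    show ?thesis
      unfolding has_vector_derivative_def using has_derivative_eq_rhs[OF 1 ext[OF 2]] .
  qed
  then have "((\<lambda>t. snd c (\<gamma> t)) has_vector_derivative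
      fd (snd c \<circ> chart_inv ?d) (F 0) (fd F 0 1)) (at 0)"
    by (rule has_vector_derivative_transform_within_open[where S = "ball 0 e'"])
       (use e' near in \<open>auto simp: is_chartD(5)[OF dd]\<close>)
  with e' near show thesis using that by blast
qed

lemma curve_in_line:
  assumes c: "smooth_chart A c" "x \<in> fst c"
    and "e > 0" and line: "\<And>t. \<bar>t\<bar> < e \<Longrightarrow> snd c x + t *\<^sub>R v \<in> chart_img c \<and> chart_inv c (snd c x + t *\<^sub>R v) \<in> S"
  shows "curve_in A S x (\<lambda>t. chart_inv c (snd c x + t *\<^sub>R v))"
  unfolding curve_in_def
proof (intro conjI exI[of _ e])
  note cc = smooth_chart_is_chart[OF c(1)]
  let ?g = "\<lambda>t. snd c x + t *\<^sub>R v"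
  show "chart_inv c (snd c x + 0 *\<^sub>R v) = x" using c is_chartD(5)[OF cc] by simp
  show "(\<lambda>t. chart_inv c (?g t)) ` {-e<..<e} \<subseteq> S" using line by auto
  have sg: "smooth_on UNIV ?g"
    by (intro smooth_on_add smooth_on_const smooth_on_scaleR open_UNIV
        smooth_on_linear[OF bounded_linear_ident])
  show "smooth_map_on std_atlas A {-e<..<e} (\<lambda>t. chart_inv c (?g t))"
    unfolding smooth_map_on_def
  proof (intro ballI impI)
    fix s :: real and a :: "(real, real) chart" and d
    assume s: "s \<in> {-e<..<e}" and a: "a \<in> std_atlas" and d: "d \<in> A"
      and "s \<in> fst a \<and> chart_inv c (?g s) \<in> fst d"
    then have sd: "chart_inv c (?g s) \<in> fst d" by blast
    have a: "a = (UNIV, id)" using a by (simp add: std_atlas_def)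
    note ds = atlas_smooth_chart[OF d]
    note dd = smooth_chart_is_chart[OF ds]
    let ?B = "snd c ` (fst c \<inter> fst d)"
    have B: "open ?B" by (rule open_chart_overlap[OF cc is_chartD(1)[OF dd]])
    let ?U = "?g -` ?B"
    have U: "open ?U"
      using continuous_open_preimage[OF smooth_on_imp_continuous_on[OF sg] open_UNIV B] by simp
    have "\<bar>s\<bar> < e" using s by auto
    then have "s \<in> ?U" using sd line[of s] by (simp add: chart_overlap[OF cc])
    moreover have "smooth_on ?U (\<lambda>t. (snd d \<circ> chart_inv c) (?g t))"
      by (rule smooth_on_compose[OF smooth_transition[OF c(1) ds] smooth_on_subset[OF sg] U B]) auto
    ultimately show "\<exists>U F. open U \<and> snd a s \<in> U \<and> smooth_on U F \<and>
        (\<forall>x \<in> {-e<..<e} \<inter> fst a. snd a x \<in> U \<longrightarrow> chart_inv c (?g x) \<in> fst d \<and> F (snd a x) = snd d (chart_inv c (?g x)))"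
      using U unfolding a
      by (intro exI[of _ ?U] exI[of _ "\<lambda>t. (snd d \<circ> chart_inv c) (?g t)"])
         (simp add: chart_overlap[OF cc])
  qed
qed (use assms(3) in simp)

lemma slice_chart_curve_velocity:
  assumes S: "slice_chart A S c L" and x: "x \<in> fst c" and \<gamma>: "curve_in A S x \<gamma>"
  obtains v e where "v \<in> L" "((\<lambda>t. snd c (\<gamma> t)) has_vector_derivative v) (at 0)" "velocity A \<gamma> 0 = to_std c x v"
    "e > 0" "\<And>t. \<bar>t\<bar> < e \<Longrightarrow> \<gamma> t \<in> fst c \<inter> S"
proof -
  have c: "smooth_chart A c" and L: "subspace L" using S by (auto simp: slice_chart_def)
  obtain e v where e: "e > 0" "\<And>t. \<bar>t\<bar> < e \<Longrightarrow> \<gamma> t \<in> fst c \<inter> S"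
    and v: "((\<lambda>t. snd c (\<gamma> t)) has_vector_derivative v) (at 0)"
    using curve_in_coord[OF \<gamma> c x] by metis
  have "v \<in> L"
    by (rule has_vector_derivative_in_subspace[OF v L e(1)]) (use e(2) slice_chart_iff[OF S] in auto)
  moreover have "velocity A \<gamma> 0 = to_std c x v"
    using velocity_eqI[OF c e(1) _ v] e(2) \<gamma> by (simp add: curve_in_def)
  ultimately show thesis using that v e by blast
qed

lemma slice_chart_line:
  assumes S: "slice_chart A S c L" and x: "x \<in> fst c" "x \<in> S" and v: "v \<in> L"
  shows "curve_in A S x (\<lambda>t. chart_inv c (snd c x + t *\<^sub>R v))"
    "velocity A (\<lambda>t. chart_inv c (snd c x + t *\<^sub>R v)) 0 = to_std c x v"
proof -
  have c: "smooth_chart A c" and L: "subspace L" using S by (auto simp: slice_chart_def)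
  note cc = smooth_chart_is_chart[OF c]
  have xL: "snd c x \<in> L" using slice_chart_iff[OF S x(1)] x(2) by simp
  obtain e where e: "e > 0" "\<And>t. \<bar>t\<bar> < e \<Longrightarrow> snd c x + t *\<^sub>R v \<in> chart_img c"
    using line_in_open[OF is_chartD(2,7)[OF cc]] x(1) by metis
  show "curve_in A S x (\<lambda>t. chart_inv c (snd c x + t *\<^sub>R v))"
    by (rule curve_in_line[OF c x(1) e(1)])
       (use e(2) slice_chart_inv[OF S] xL v L in \<open>auto intro!: subspace_add subspace_scale\<close>)
  have "((\<lambda>t. snd c x + t *\<^sub>R v) has_vector_derivative v) (at 0)"
    by (auto intro!: derivative_eq_intros)
  then have "((\<lambda>t. snd c (chart_inv c (snd c x + t *\<^sub>R v))) has_vector_derivative v) (at 0)"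
    by (rule has_vector_derivative_transform_within_open[where S = "ball 0 e"])
       (use e in \<open>auto simp: is_chartD[OF cc]\<close>)
  from velocity_eqI[OF c e(1) _ this]
  show "velocity A (\<lambda>t. chart_inv c (snd c x + t *\<^sub>R v)) 0 = to_std c x v"
    using e(2) is_chartD(5,8)[OF cc] x(1) by simp
qed

lemma tangent_space_slice_chart:
  assumes S: "slice_chart A S c L" and x: "x \<in> fst c" "x \<in> S"
  shows "tangent_space A S x = to_std c x ` L"
proof
  show "tangent_space A S x \<subseteq> to_std c x ` L"
    unfolding tangent_space_def
    using slice_chart_curve_velocity[OF S x(1)] by (smt (verit, best) imageI mem_Collect_eq subsetI)
  show "to_std c x ` L \<subseteq> tangent_space A S x"
    unfolding tangent_space_def using slice_chart_line[OF S x] by (auto simp: image_subset_iff) metis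
qed

text \<open>\<open>smooth_map_on\<close> refers to charts of \<open>A\<close>, whereas slice charts
  belong to the maximal atlas; composing with two transitions carries the local extension
  over.\<close>

lemma smooth_map_on_coord:
  assumes f: "smooth_map_on A A S f" and c: "smooth_chart A c" "p \<in> fst c" and d: "smooth_chart A d" "f p \<in> fst d"
    and p: "p \<in> S"
  obtains U F where "open U" "snd c p \<in> U" "U \<subseteq> chart_img c" "smooth_on U F"
    "\<And>x. x \<in> S \<Longrightarrow> x \<in> fst c \<Longrightarrow> snd c x \<in> U \<Longrightarrow> f x \<in> fst d \<and> F (snd c x) = snd d (f x)"
proof -
  note cc = smooth_chart_is_chart[OF c(1)] and dd = smooth_chart_is_chart[OF d(1)]
  let ?a = "chart_at A p" and ?b = "chart_at A (f p)"
  note aa = smooth_chart_is_chart[OF chart_at(3)[of p]] and bb = smooth_chart_is_chart[OF chart_at(3)[of "f p"]]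
  obtain U F where U: "open U" "snd ?a p \<in> U" "smooth_on U F"
    and F: "\<And>x. x \<in> S \<Longrightarrow> x \<in> fst ?a \<Longrightarrow> snd ?a x \<in> U \<Longrightarrow> f x \<in> fst ?b \<and> F (snd ?a x) = snd ?b (f x)"
    using f p chart_at(1,2)[of p] chart_at(1,2)[of "f p"] unfolding smooth_map_on_def by (metis Int_iff)
  let ?B = "snd ?b ` (fst ?b \<inter> fst d)"
  have B: "open ?B" by (rule open_chart_overlap[OF bb is_chartD(1)[OF dd]])
  define U1 where "U1 = F -` ?B \<inter> U"
  have U1: "open U1" unfolding U1_def
    using continuous_open_preimage[OF smooth_on_imp_continuous_on[OF U(3)] U(1) B] by (simp add: Int_commute)
  have pU1: "snd ?a p \<in> U1"
    using U(2) F[OF p chart_at(2) U(2)] d(2) by (auto simp: U1_def)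
  have s1: "smooth_on U1 (\<lambda>y. (snd d \<circ> chart_inv ?b) (F y))"
    by (rule smooth_on_compose[OF smooth_transition[OF chart_at(3) d(1)] smooth_on_subset[OF U(3)] U1 B])
       (auto simp: U1_def)
  define U2 where "U2 = (snd ?a \<circ> chart_inv c) -` U1 \<inter> snd c ` (fst c \<inter> fst ?a)"
  have st: "smooth_on (snd c ` (fst c \<inter> fst ?a)) (snd ?a \<circ> chart_inv c)"
    by (rule smooth_transition[OF c(1) chart_at(3)])
  have U2: "open U2" unfolding U2_def
    using continuous_open_preimage[OF smooth_on_imp_continuous_on[OF st] open_chart_overlap[OF cc is_chartD(1)[OF aa]] U1]
    by (simp add: Int_commute)
  have s2: "smooth_on U2 (\<lambda>y. (snd d \<circ> chart_inv ?b) (F ((snd ?a \<circ> chart_inv c) y)))"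
    by (rule smooth_on_compose[OF s1 smooth_on_subset[OF st] U2 U1]) (auto simp: U2_def)
  show thesis
  proof (rule that[OF U2 _ _ s2])
    show "snd c p \<in> U2" using pU1 c(2) chart_at(2) by (simp add: U2_def is_chartD(5)[OF cc])
    show "U2 \<subseteq> chart_img c" by (auto simp: U2_def chart_img_def)
    fix x assume x: "x \<in> S" "x \<in> fst c" "snd c x \<in> U2"
    then have "chart_inv c (snd c x) \<in> fst ?a" unfolding U2_def chart_overlap[OF cc] by blast
    then have xa: "x \<in> fst ?a" using x(2) by (simp add: is_chartD(5)[OF cc])
    have xU1: "snd ?a x \<in> U1" using x by (simp add: U2_def is_chartD(5)[OF cc])
    then have fx: "f x \<in> fst ?b" "F (snd ?a x) = snd ?b (f x)" using F[OF x(1) xa] by (auto simp: U1_def)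
    have "chart_inv ?b (F (snd ?a x)) \<in> fst d" using xU1 unfolding U1_def chart_overlap[OF bb] by blast
    then show "f x \<in> fst d \<and> (snd d \<circ> chart_inv ?b) (F ((snd ?a \<circ> chart_inv c) (snd c x))) = snd d (f x)"
      using fx x(2) by (simp add: is_chartD(5)[OF cc] is_chartD(5)[OF bb])
  qed
qed

lemma smooth_map_on_compose:
  assumes f: "smooth_map_on B A S f" and g: "smooth_map_on A A T g" and "f ` S \<subseteq> T"
  shows "smooth_map_on B A S (g \<circ> f)"
  unfolding smooth_map_on_def
proof (intro ballI impI)
  fix p c d assume p: "p \<in> S" and c: "c \<in> B" and d: "d \<in> A" and pcd: "p \<in> fst c \<and> (g \<circ> f) p \<in> fst d"
  let ?b = "chart_at A (f p)"
  from f[unfolded smooth_map_on_def, rule_format, OF p c chart_at(1)[of "f p"]] pcd chart_at(2)[of "f p"]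
  obtain U F where U: "open U" "snd c p \<in> U" "smooth_on U F"
    and F: "\<And>x. x \<in> S \<Longrightarrow> x \<in> fst c \<Longrightarrow> snd c x \<in> U \<Longrightarrow> f x \<in> fst ?b \<and> F (snd c x) = snd ?b (f x)"
    by auto
  have fp: "f p \<in> T" using p assms(3) by blast
  obtain V G where V: "open V" "snd ?b (f p) \<in> V" "V \<subseteq> chart_img ?b" "smooth_on V G"
    and G: "\<And>x. x \<in> T \<Longrightarrow> x \<in> fst ?b \<Longrightarrow> snd ?b x \<in> V \<Longrightarrow> g x \<in> fst d \<and> G (snd ?b x) = snd d (g x)"
    using smooth_map_on_coord[OF g chart_at(3,2) atlas_smooth_chart[OF d] _ fp] pcd by auto
  have W: "open (F -` V \<inter> U)"
    using continuous_open_preimage[OF smooth_on_imp_continuous_on[OF U(3)] U(1) V(1)] by (simp add: Int_commute)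
  show "\<exists>U F. open U \<and> snd c p \<in> U \<and> smooth_on U F \<and>
     (\<forall>x\<in>S \<inter> fst c. snd c x \<in> U \<longrightarrow> (g \<circ> f) x \<in> fst d \<and> F (snd c x) = snd d ((g \<circ> f) x))"
  proof (intro exI[of _ "F -` V \<inter> U"] exI[of _ "\<lambda>y. G (F y)"] conjI)
    show "smooth_on (F -` V \<inter> U) (\<lambda>y. G (F y))"
      by (rule smooth_on_compose[OF V(4) smooth_on_subset[OF U(3)] W V(1)]) auto
    show "snd c p \<in> F -` V \<inter> U" using U(2) V(2) F[OF p _ U(2)] pcd by simp
    show "\<forall>x\<in>S \<inter> fst c. snd c x \<in> F -` V \<inter> U \<longrightarrow>
        (g \<circ> f) x \<in> fst d \<and> G (F (snd c x)) = snd d ((g \<circ> f) x)"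
      using F G assms(3) by (auto simp: image_subset_iff)
  qed (rule W)
qed

lemma curve_in_image:
  assumes \<gamma>: "curve_in A S x \<gamma>" and f: "smooth_map_on A A S f" and fS: "f ` S \<subseteq> T"
  shows "curve_in A T (f x) (f \<circ> \<gamma>)"
proof -
  obtain e where e: "e > 0" "smooth_map_on std_atlas A {-e<..<e} \<gamma>" "\<gamma> ` {-e<..<e} \<subseteq> S" and x: "\<gamma> 0 = x"
    using \<gamma> unfolding curve_in_def by blast
  have "(f \<circ> \<gamma>) ` {-e<..<e} \<subseteq> T" using e(3) fS by (auto simp: image_subset_iff)
  then show ?thesis using e(1) x smooth_map_on_compose[OF e(2) f e(3)] unfolding curve_in_def by auto
qed

end

section \<open>The symplectic form in charts\<close>

locale symplectic_mfd =
  fixes A :: "('p::{t2_space, second_countable_topology}, 'e::euclidean_space) chart set"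
    and \<omega> :: "'p \<Rightarrow> 'e \<Rightarrow> 'e \<Rightarrow> real"
  assumes symplectic: "symplectic_manifold A \<omega>"

sublocale symplectic_mfd \<subseteq> manifold A
  using symplectic by unfold_locales (simp add: symplectic_manifold_def)

context symplectic_mfd
begin

lemma bilinear_\<omega>: "bilinear (\<omega> p)" and alternating_\<omega>: "\<omega> p u u = 0"
  using symplectic by (auto simp: symplectic_manifold_def smooth_2form_def)

lemma nondegenerate_\<omega>: "(\<And>v. \<omega> p u v = 0) \<Longrightarrow> u = 0"
  using symplectic unfolding symplectic_manifold_def by blast

abbreviation form :: "('p, 'e) chart \<Rightarrow> 'e \<Rightarrow> 'e \<Rightarrow> 'e \<Rightarrow> real" where
  "form \<equiv> form_in_chart A \<omega>"

lemma form_at: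
  assumes "smooth_chart A c" "p \<in> fst c"
  shows "form c (snd c p) u v = \<omega> p (to_std c p u) (to_std c p v)"
  using is_chartD(5)[OF smooth_chart_is_chart[OF assms(1)] assms(2)]
  by (simp add: form_in_chart_def to_std_def Let_def)

lemma form_inv:
  assumes "smooth_chart A c" "y \<in> chart_img c"
  shows "form c y u v = \<omega> (chart_inv c y) (to_std c (chart_inv c y) u) (to_std c (chart_inv c y) v)"
  using form_at[OF assms(1) is_chartD(8)[OF smooth_chart_is_chart[OF assms(1)] assms(2)]]
    is_chartD(6)[OF smooth_chart_is_chart[OF assms(1)] assms(2)] by simp

lemma bilinear_form:
  assumes c: "smooth_chart A c" "y \<in> chart_img c"
  shows "bilinear (form c y)" "form c y u u = 0"
proof -
  note cc = smooth_chart_is_chart[OF c(1)]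
  note lin = linear_to_std[OF c(1) is_chartD(8)[OF cc c(2)]]
  have "bilinear (\<lambda>u v. \<omega> (chart_inv c y) (to_std c (chart_inv c y) u) (to_std c (chart_inv c y) v))"
    using bilinear_\<omega>[of "chart_inv c y"] lin
    unfolding bilinear_def by (auto intro: linear_compose[unfolded o_def])
  then show "bilinear (form c y)" by (simp add: form_inv[OF c, abs_def])
  show "form c y u u = 0" by (simp add: form_inv[OF c] alternating_\<omega>)
qed

lemma closed_form_atlas:
  assumes "c \<in> A"
  shows "closed_form_on (chart_img c) (form c)"
proof -
  have "smooth_on (chart_img c) (\<lambda>y. form c y u v)" for u v
    using symplectic assms unfolding symplectic_manifold_def smooth_2form_def by blast
  moreover have "fd (\<lambda>y. form c y v w) y u + fd (\<lambda>y. form c y w u) y v + fd (\<lambda>y. form c y u v) y w = 0"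
    if "y \<in> chart_img c" for y u v w
    using symplectic assms that unfolding symplectic_manifold_def closed_2form_def by blast
  ultimately show ?thesis
    using bilinear_form[OF atlas_smooth_chart[OF assms]] unfolding closed_form_on_def by blast
qed

lemma form_transition:
  assumes "smooth_chart A c" "p \<in> fst c" "smooth_chart A d" "p \<in> fst d"
  shows "form d (snd d p) (fd (snd d \<circ> chart_inv c) (snd c p) u) (fd (snd d \<circ> chart_inv c) (snd c p) v)
    = form c (snd c p) u v"
  by (simp add: form_at assms to_std_transition)

text \<open>Smoothness and closedness are given in the charts of \<open>A\<close>; in any other
  chart the form is locally the pull-back of one of these under a transition map.\<close>

lemma closed_form_chart:
  assumes c: "smooth_chart A c"
  shows "closed_form_on (chart_img c) (form c)"
proof (rule closed_form_on_local)
  note cc = smooth_chart_is_chart[OF c]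
  fix y assume y: "y \<in> chart_img c"
  let ?a = "chart_at A (chart_inv c y)"
  note aa = smooth_chart_is_chart[OF chart_at(3)[of "chart_inv c y"]]
  let ?V = "snd c ` (fst c \<inter> fst ?a)"
  have V: "open ?V" by (rule open_chart_overlap[OF cc is_chartD(1)[OF aa]])
  have "closed_form_on ?V (\<lambda>x u v. form ?a ((snd ?a \<circ> chart_inv c) x)
      (fd (snd ?a \<circ> chart_inv c) x u) (fd (snd ?a \<circ> chart_inv c) x v))"
    by (rule closed_form_on_pullback[OF closed_form_atlas[OF chart_at(1)] smooth_transition[OF c chart_at(3)] V is_chartD(2)[OF aa]])
       (auto simp: is_chartD[OF cc] is_chartD[OF aa])
  then have "closed_form_on ?V (form c)"
  proof (rule closed_form_on_cong[OF V, rotated])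
    fix x u v assume "x \<in> ?V"
    then obtain p where "p \<in> fst c" "p \<in> fst ?a" "x = snd c p" by blast
    then show "form ?a ((snd ?a \<circ> chart_inv c) x) (fd (snd ?a \<circ> chart_inv c) x u)
        (fd (snd ?a \<circ> chart_inv c) x v) = form c x u v"
      using form_transition[OF c _ chart_at(3)] by (simp add: is_chartD(5)[OF cc])
  qed
  moreover have "y \<in> ?V" using y chart_at(2) by (simp add: chart_overlap[OF cc])
  ultimately show "\<exists>V. open V \<and> y \<in> V \<and> closed_form_on V (form c)" using V by blast
qed

text \<open>The vector representing the covector \<open>\<omega>(v, \<cdot>)\<close> through the
  Euclidean inner product. Annihilators thereby become orthogonal complements, and the form becomes
  a family of endomorphisms that can be inverted.\<close>

definition flat :: "('p, 'e) chart \<Rightarrow> 'e \<Rightarrow> 'e \<Rightarrow> 'e" where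
  "flat c y v = (\<Sum>b\<in>Basis. form c y v b *\<^sub>R b)"

lemma flat_inner:
  assumes "smooth_chart A c" "y \<in> chart_img c"
  shows "flat c y v \<bullet> w = form c y v w"
proof -
  have lin: "linear (form c y v)"
    using bilinear_form(1)[OF assms] by (simp add: bilinear_def)
  have "flat c y v \<bullet> w = (\<Sum>b\<in>Basis. (w \<bullet> b) * form c y v b)"
    by (simp add: flat_def inner_sum_left inner_commute[of w] mult.commute)
  then show ?thesis using linear_Basis_expand[OF lin, of w] by simp
qed

lemma invertible_family_flat:
  assumes c: "smooth_chart A c"
  shows "invertible_family (chart_img c) (flat c)"
proof (rule invertible_family.intro)
  note cc = smooth_chart_is_chart[OF c]
  show "open (chart_img c)" by (rule is_chartD(2)[OF cc])
  show lin: "linear (flat c y)" if "y \<in> chart_img c" for y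
    unfolding flat_def
    using bilinear_form(1)[OF c that]
    by (intro linearI) (simp_all add: bilinear_ladd bilinear_lmul scaleR_add_left sum.distrib scaleR_sum_right)
  show "inj (flat c y)" if y: "y \<in> chart_img c" for y
  proof -
    let ?p = "chart_inv c y"
    have p: "?p \<in> fst c" by (rule is_chartD(8)[OF cc y])
    have "v = 0" if "flat c y v = 0" for v
    proof -
      have "\<omega> ?p (to_std c ?p v) w = 0" for w
      proof -
        obtain w' where "w = to_std c ?p w'" using surj_to_std[OF c p] by (metis surjD)
        then show ?thesis
          using flat_inner[OF c y, of v w'] form_inv[OF c y] that by simp
      qed
      then have "to_std c ?p v = 0" by (rule nondegenerate_\<omega>)
      then show "v = 0" using linear_injective_0[OF linear_to_std[OF c p]] inj_to_std[OF c p] by blast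
    qed
    then show ?thesis using linear_injective_0[OF lin[OF y]] by blast
  qed
  show "smooth_on (chart_img c) (\<lambda>y. flat c y v)" for v
    unfolding flat_def
    by (intro smooth_on_sum smooth_on_scaleR smooth_on_const is_chartD(2)[OF cc]
        closed_form_onD(3)[OF closed_form_chart[OF c]])
qed

end

locale coisotropic_mfd = symplectic_mfd A \<omega>
  for A :: "('p::{t2_space, second_countable_topology}, 'e::euclidean_space) chart set" and \<omega> +
  fixes M :: "'p set"
  assumes coiso: "coisotropic A \<omega> M"
begin

lemma slice_chart_M:
  assumes "p \<in> M"
  obtains c L where "slice_chart A M c L" "p \<in> fst c"
  using coiso assms unfolding coisotropic_def embedded_submanifold_def by blast

lemma coisotropic_chart_flat:
  assumes S: "slice_chart A M c L"
  shows "coisotropic_chart (chart_img c) (flat c) L"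
proof -
  have c: "smooth_chart A c" and L: "subspace L" using S by (auto simp: slice_chart_def)
  note cc = smooth_chart_is_chart[OF c]
  interpret invertible_family "chart_img c" "flat c" by (rule invertible_family_flat[OF c])
  show ?thesis
  proof
    show "subspace L" by (rule L)
    show "flat c x v \<bullet> w = - (flat c x w \<bullet> v)" if "x \<in> chart_img c" for x v w
      unfolding flat_inner[OF c that] by (rule bilinear_alternating_antisym[OF bilinear_form[OF c that]])
    fix y k assume y: "y \<in> chart_img c" "y \<in> L" and k: "flat c y k \<in> L\<^sup>\<bottom>"
    let ?p = "chart_inv c y"
    have p: "?p \<in> fst c" by (rule is_chartD(8)[OF cc y(1)])
    have pM: "?p \<in> M" using slice_chart_inv[OF S y(1)] y(2) by simp
    have T: "tangent_space A M ?p = to_std c ?p ` L" by (rule tangent_space_slice_chart[OF S p pM])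
    have "\<omega> ?p (to_std c ?p k) v = 0" if "v \<in> tangent_space A M ?p" for v
      using that k flat_inner[OF c y(1)] form_inv[OF c y(1)] unfolding T by (auto simp: mem_orthogonal_comp)
    then have "to_std c ?p k \<in> tangent_space A M ?p"
      using coiso pM unfolding coisotropic_def by blast
    then show "k \<in> L" unfolding T using inj_to_std[OF c p] by (simp add: inj_image_mem_iff)
  qed
qed

text \<open>The tangency demanded by \<open>ker_form\<close> follows from coisotropy, so membership
  reduces to a single linear condition on \<open>flat\<close>.\<close>

lemma ker_form_iff:
  assumes S: "slice_chart A M c L" and p: "p \<in> fst c" "p \<in> M"
  shows "to_std c p k \<in> ker_form A \<omega> M p \<longleftrightarrow> flat c (snd c p) k \<in> L\<^sup>\<bottom>"
proof -
  have c: "smooth_chart A c" using S by (auto simp: slice_chart_def)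
  note cc = smooth_chart_is_chart[OF c]
  interpret coisotropic_chart "chart_img c" "flat c" L by (rule coisotropic_chart_flat[OF S])
  have y: "snd c p \<in> chart_img c" "snd c p \<in> L"
    using is_chartD(7)[OF cc p(1)] slice_chart_iff[OF S p(1)] p(2) by auto
  have T: "tangent_space A M p = to_std c p ` L" by (rule tangent_space_slice_chart[OF S p])
  have "(\<forall>v \<in> tangent_space A M p. \<omega> p (to_std c p k) v = 0) \<longleftrightarrow> flat c (snd c p) k \<in> L\<^sup>\<bottom>"
    unfolding T by (simp add: mem_orthogonal_comp flat_inner[OF c y(1)] form_at[OF c p(1)])
  moreover have "to_std c p k \<in> tangent_space A M p \<longleftrightarrow> k \<in> L"
    unfolding T using inj_to_std[OF c p(1)] by (simp add: inj_image_mem_iff)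
  ultimately show ?thesis
    using coisotropic[OF y] unfolding ker_form_def by blast
qed

text \<open>Lets vectors tangent to a plaque be recognised in a slice chart of \<open>M\<close>,
  where \<open>flat\<close> sends the kernel to a subspace that does not depend on the
  point.\<close>

lemma integral_tangent_iff:
  assumes S: "slice_chart A M cM LM" "p \<in> fst cM" and N: "integral_manifold A \<omega> M N" "slice_chart A N c L" "p \<in> fst c" "p \<in> N"
  shows "flat cM (snd cM p) (fd (snd cM \<circ> chart_inv c) (snd c p) v) \<in> LM\<^sup>\<bottom> \<longleftrightarrow> v \<in> L"
proof -
  have c: "smooth_chart A c" and cM: "smooth_chart A cM" using S N by (auto simp: slice_chart_def)
  have pM: "p \<in> M" using N unfolding integral_manifold_def by blast
  have "v \<in> L \<longleftrightarrow> to_std c p v \<in> tangent_space A N p"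
    unfolding tangent_space_slice_chart[OF N(2,3,4)] using inj_to_std[OF c N(3)] by (simp add: inj_image_mem_iff)
  also have "\<dots> \<longleftrightarrow> to_std c p v \<in> ker_form A \<omega> M p" using N(1,4) unfolding integral_manifold_def by simp
  also have "to_std c p v = to_std cM p (fd (snd cM \<circ> chart_inv c) (snd c p) v)"
    by (simp add: to_std_transition[OF c N(3) cM S(2)])
  finally show ?thesis using ker_form_iff[OF S pM] by simp
qed

section \<open>The leaf topology\<close>

text \<open>A segment in the slice of \<open>N\<close> has its velocity in the kernel. Read in the
  slice chart of \<open>N2\<close> it follows fields that are tangent to \<open>L2\<close> along
  \<open>L2\<close>, and since it starts in \<open>L2\<close> it never leaves.\<close>

lemma integral_manifolds_overlap_open:
  assumes N: "integral_manifold A \<omega> M N" "slice_chart A N c L" "p \<in> fst c" "p \<in> N"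
    and N2: "integral_manifold A \<omega> M N2" "p \<in> N2"
  obtains e where "e > 0" "ball (snd c p) e \<subseteq> chart_img c"
    "\<And>y. y \<in> ball (snd c p) e \<Longrightarrow> y \<in> L \<Longrightarrow> chart_inv c y \<in> N2"
proof -
  have pM: "p \<in> M" using N unfolding integral_manifold_def by blast
  obtain cM LM where SM: "slice_chart A M cM LM" and pcM: "p \<in> fst cM" using slice_chart_M[OF pM] .
  obtain c2 L2 where S2: "slice_chart A N2 c2 L2" and pc2: "p \<in> fst c2"
    using N2 unfolding integral_manifold_def embedded_submanifold_def by blast
  have c: "smooth_chart A c" and cM: "smooth_chart A cM" and c2: "smooth_chart A c2"
    and L: "subspace L" and LM: "subspace LM" and L2: "subspace L2"
    using SM N S2 by (auto simp: slice_chart_def)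
  note cc = smooth_chart_is_chart[OF c] and ccM = smooth_chart_is_chart[OF cM] and cc2 = smooth_chart_is_chart[OF c2]
  interpret coisotropic_chart "chart_img cM" "flat cM" LM by (rule coisotropic_chart_flat[OF SM])
  obtain P where P: "linear P" "\<And>x. P x \<in> LM" "\<And>x. x \<in> LM \<Longrightarrow> P x = x" "\<And>x. x - P x \<in> LM\<^sup>\<bottom>"
    using orthogonal_projection[OF LM] by metis
  define q where "q x = x - P x" for x
  have lin_q: "linear q" unfolding q_def by (intro linear_compose_sub linear_ident P(1))
  have q_id: "q b = b" if "b \<in> LM\<^sup>\<bottom>" for b
  proof -
    have "b \<bullet> P b = 0" "(b - P b) \<bullet> P b = 0"
      using that P(4)[of b] P(2)[of b] by (simp_all only: mem_orthogonal_comp)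
    then have "P b \<bullet> P b = 0" by (simp add: inner_diff_left)
    then show ?thesis by (simp add: q_def)
  qed
  let ?V = "snd c2 ` (fst c2 \<inter> fst cM)"
  have V: "open ?V" by (rule open_chart_overlap[OF cc2 is_chartD(1)[OF ccM]])
  let ?s = "snd cM \<circ> chart_inv c2" and ?t = "snd c2 \<circ> chart_inv cM"
  have ss: "smooth_on ?V ?s" by (rule smooth_transition[OF c2 cM])
  have st: "smooth_on (snd cM ` (fst cM \<inter> fst c2)) ?t" by (rule smooth_transition[OF cM c2])
  have ost: "open (snd cM ` (fst cM \<inter> fst c2))" by (rule open_chart_overlap[OF ccM is_chartD(1)[OF cc2]])
  have s_in: "?s y \<in> snd cM ` (fst cM \<inter> fst c2)" if "y \<in> ?V" for y
    using that by (auto simp: is_chartD[OF cc2])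
  have s_in': "?s y \<in> chart_img cM" if "y \<in> ?V" for y
    using that by (auto simp: is_chartD[OF cc2] is_chartD[OF ccM])
  \<comment> \<open>The field with constant covector \<open>q b\<close>, written in the chart of
    \<open>N2\<close>. Inserting the projection \<open>q\<close> makes it linear in an unrestricted
    \<open>b\<close> while every value satisfies the kernel condition.\<close>
  define Z where "Z y b = fd ?t (?s y) (Jinv (?s y) (q b))" for y b
  have Z_at: "Z (snd c2 r) b = fd ?t (snd cM r) (Jinv (snd cM r) (q b))" if "r \<in> fst c2" for r b
    using that by (simp add: Z_def is_chartD(5)[OF cc2])
  have linZ: "linear (Z y)" if "y \<in> ?V" for y
    unfolding Z_def
    using linear_compose[OF linear_compose[OF lin_q linear_Jinv[OF s_in'[OF that]]] smooth_on_linear_fd[OF st s_in[OF that]]]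
    by (simp add: o_def)
  have smZ: "smooth_on ?V (\<lambda>y. Z y b)" for b
    unfolding Z_def
  proof (rule smooth_on_linear_family[where A = "\<lambda>y. fd ?t (?s y)" and f = "\<lambda>y. Jinv (?s y) (q b)", OF V])
    show "linear (fd ?t (?s y))" if "y \<in> ?V" for y by (rule smooth_on_linear_fd[OF st s_in[OF that]])
    show "smooth_on ?V (\<lambda>y. fd ?t (?s y) v)" for v
      by (rule smooth_on_compose[OF smooth_on_fd[OF st] ss V ost]) (use s_in in blast)
    show "smooth_on ?V (\<lambda>y. Jinv (?s y) (q b))"
      by (rule smooth_on_compose[OF smooth_Jinv ss V open_U]) (use s_in' in blast)
  qed
  have ZL2: "Z y b \<in> L2" if y: "y \<in> ?V" "y \<in> L2" for y b
  proof -
    obtain r where r: "r \<in> fst c2" "r \<in> fst cM" "y = snd c2 r" using y by blast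
    have rN: "r \<in> N2" using slice_chart_iff[OF S2 r(1)] y(2) r(3) by simp
    let ?k = "Jinv (snd cM r) (q b)"
    have im: "snd cM r \<in> chart_img cM" by (rule is_chartD(7)[OF ccM r(2)])
    have "flat cM (snd cM r) (fd (snd cM \<circ> chart_inv c2) (snd c2 r) (Z y b)) \<in> LM\<^sup>\<bottom>"
      using fd_transition_inverse[OF cM r(2) c2 r(1)] P(4)[of b] im
      by (simp add: r(3) Z_at[OF r(1)] q_def)
    then show ?thesis using integral_tangent_iff[OF SM r(2) N2(1) S2 r(1) rN] by blast
  qed
  have p2: "snd c2 p \<in> ?V" using pcM pc2 by blast
  obtain \<rho> where \<rho>: "\<rho> > 0" "cball (snd c2 p) \<rho> \<subseteq> ?V" using open_contains_cball V p2 by blast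
  have p2L: "snd c2 p \<in> L2" using slice_chart_iff[OF S2 pc2] N2(2) by simp
  \<comment> \<open>Inside \<open>?D\<close> the segments stay in the charts \<open>cM\<close> and
    \<open>c2\<close> and in the ball of radius \<rho>, on whose closure the field is defined and
    Lipschitz.\<close>
  let ?D = "fst cM \<inter> {r \<in> fst c2. snd c2 r \<in> ball (snd c2 p) \<rho>}"
  have D: "open ?D" by (intro open_Int is_chartD(1)[OF ccM] open_chart_preimage[OF cc2] open_ball)
  have "open (snd c ` (fst c \<inter> ?D))" by (rule open_chart_overlap[OF cc D])
  moreover have "snd c p \<in> snd c ` (fst c \<inter> ?D)" using N(3) pcM pc2 \<rho>(1) by simp
  ultimately obtain e where e: "e > 0" "ball (snd c p) e \<subseteq> snd c ` (fst c \<inter> ?D)" by (meson openE)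
  have inD: "y \<in> chart_img c" "chart_inv c y \<in> ?D" if "y \<in> ball (snd c p) e" for y
    using that e(2) unfolding chart_overlap[OF cc] by blast+
  show thesis
  proof (rule that[OF e(1)])
    show "ball (snd c p) e \<subseteq> chart_img c" using inD(1) by blast
    fix y assume y: "y \<in> ball (snd c p) e" "y \<in> L"
    let ?x = "snd c p"
    define w where "w = y - ?x"
    have xL: "?x \<in> L" using slice_chart_iff[OF N(2,3)] N(4) by simp
    have wL: "w \<in> L" unfolding w_def by (rule subspace_diff[OF L y(2) xL])
    have line: "?x + t *\<^sub>R w \<in> ball ?x e" if "t \<in> {0..1}" for t
    proof -
      have "norm (t *\<^sub>R w) \<le> norm w" using that by (simp add: mult_left_le_one_le)
      then show ?thesis using y(1) by (simp add: w_def dist_norm norm_minus_commute)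
    qed
    have lineL: "?x + t *\<^sub>R w \<in> L" for t by (intro subspace_add[OF L] subspace_scale[OF L] xL wL)
    define r where "r t = chart_inv c (?x + t *\<^sub>R w)" for t
    have r: "r t \<in> fst c" "r t \<in> fst cM" "r t \<in> fst c2" "snd c (r t) = ?x + t *\<^sub>R w" "r t \<in> N"
      "snd c2 (r t) \<in> ball (snd c2 p) \<rho>" if "t \<in> {0..1}" for t
      using inD[OF line[OF that]] slice_chart_inv[OF N(2)] lineL by (auto simp: r_def is_chartD[OF cc])
    let ?m = "snd cM \<circ> chart_inv c"
    \<comment> \<open>The covector of the velocity of the segment; tangency of \<open>N\<close> to
      the kernel puts it into \<open>LM\<^sup>\<bottom>\<close>, where \<open>q\<close> acts as the
      identity.\<close>
    define \<beta> where "\<beta> t = flat cM (snd cM (r t)) (fd ?m (?x + t *\<^sub>R w) w)" for t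
    have \<beta>_in: "\<beta> t \<in> LM\<^sup>\<bottom>" if "t \<in> {0..1}" for t
      using integral_tangent_iff[OF SM r(2) N(1,2) r(1) r(5)] that wL by (simp add: \<beta>_def r(4))
    have "continuous_on {0..1} (\<lambda>t. (\<lambda>x. flat cM (?m x) (fd ?m x w)) (?x + t *\<^sub>R w))"
    proof (rule continuous_on_compose2[where g = "\<lambda>x. flat cM (?m x) (fd ?m x w)" and f = "\<lambda>t. ?x + t *\<^sub>R w"])
      have sm: "smooth_on (ball ?x e) ?m"
        by (rule smooth_on_subset[OF smooth_transition[OF c cM]]) (use e(2) in blast)
      have m_in: "?m x \<in> chart_img cM" if "x \<in> ball ?x e" for x
        using inD(2)[OF that] by (simp add: is_chartD[OF ccM])
      have "smooth_on (ball ?x e) (\<lambda>x. flat cM (?m x) (fd ?m x w))"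
      proof (rule smooth_on_linear_family[where A = "\<lambda>x. flat cM (?m x)" and f = "\<lambda>x. fd ?m x w", OF open_ball])
        show "linear (flat cM (?m x))" if "x \<in> ball ?x e" for x by (rule linear_J[OF m_in[OF that]])
        show "smooth_on (ball ?x e) (\<lambda>x. flat cM (?m x) b)" for b
          by (rule smooth_on_compose[OF smooth_J sm open_ball open_U]) (use m_in in blast)
        show "smooth_on (ball ?x e) (\<lambda>x. fd ?m x w)" by (rule smooth_on_fd[OF sm])
      qed
      then show "continuous_on (ball ?x e) (\<lambda>x. flat cM (?m x) (fd ?m x w))" by (rule smooth_on_imp_continuous_on)
      show "continuous_on {0..1} (\<lambda>t. ?x + t *\<^sub>R w)" by (intro continuous_intros)
      show "(\<lambda>t. ?x + t *\<^sub>R w) ` {0..1} \<subseteq> ball ?x e" using line by blast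
    qed
    then have cont\<beta>: "continuous_on {0..1} \<beta>" by (simp add: \<beta>_def[abs_def] r_def)
    have "snd c2 (r 1) \<in> L2"
    proof (rule integral_curve_stays_in_subspace[where c = "\<lambda>t. snd c2 (r t)" and \<beta> = \<beta>, OF L2 p2L \<rho>(2) smZ linZ ZL2 _ cont\<beta>])
      fix t :: real assume t: "t \<in> {0..1}"
      have "((\<lambda>t. (snd c2 \<circ> chart_inv c) (?x + t *\<^sub>R w)) has_vector_derivative
          fd (snd c2 \<circ> chart_inv c) (?x + t *\<^sub>R w) w) (at t)"
      proof -
        have "((\<lambda>t. ?x + t *\<^sub>R w) has_vector_derivative w) (at t)" by (auto intro!: derivative_eq_intros)
        from vector_derivative_diff_chain_within[OF this, of "snd c2 \<circ> chart_inv c"]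
        show ?thesis
          using has_derivative_at_withinI[OF transition_has_derivative[OF c c2 r(1)[OF t] r(3)[OF t]]]
          unfolding r(4)[OF t] comp_def by blast
      qed
      moreover have "fd (snd c2 \<circ> chart_inv c) (?x + t *\<^sub>R w) w = Z (snd c2 (r t)) (\<beta> t)"
        using fd_transition_compose[OF c r(1)[OF t] cM r(2)[OF t] c2 r(3)[OF t], of w]
        by (simp add: Z_at[OF r(3)[OF t]] q_id[OF \<beta>_in[OF t]] r(4)[OF t])
           (simp add: \<beta>_def Jinv_J[OF is_chartD(7)[OF ccM r(2)[OF t]]])
      ultimately show "((\<lambda>t. snd c2 (r t)) has_vector_derivative Z (snd c2 (r t)) (\<beta> t)) (at t)"
        by (simp add: r_def)
      show "snd c2 (r t) \<in> cball (snd c2 p) \<rho>" using r(6)[OF t] by simp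
    next
      show "snd c2 (r 0) \<in> L2" using p2L N(3) by (simp add: r_def is_chartD(5)[OF cc])
    qed auto
    then have "r 1 \<in> N2" using slice_chart_iff[OF S2 r(3)] by simp
    then show "chart_inv c y \<in> N2" by (simp add: r_def w_def)
  qed
qed

end

section \<open>Plaques and local fibres\<close>

lemma connectedin_locally_constant:
  assumes C: "connectedin X C"
    and loc: "\<And>x. x \<in> C \<Longrightarrow> \<exists>U. openin X U \<and> x \<in> U \<and> (\<forall>y \<in> U \<inter> C. Q y \<longleftrightarrow> Q x)"
    and xy: "x \<in> C" "y \<in> C"
  shows "Q x \<longleftrightarrow> Q y"
proof (rule ccontr)
  assume ne: "\<not> ?thesis"
  define E where "E b = \<Union>{U. openin X U \<and> (\<forall>y \<in> U \<inter> C. Q y \<longleftrightarrow> b)}" for b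
  have op: "openin X (E b)" for b unfolding E_def by (intro openin_Union) blast
  have mem: "z \<in> E (Q z)" if "z \<in> C" for z using loc[OF that] unfolding E_def by blast
  have val: "Q z \<longleftrightarrow> b" if "z \<in> C" "z \<in> E b" for z b using that unfolding E_def by blast
  have "C \<subseteq> E True \<union> E False" using mem by (metis (full_types) UnCI subsetI)
  moreover have "E True \<inter> E False \<inter> C = {}" using val by blast
  moreover have "E True \<inter> C \<noteq> {}" "E False \<inter> C \<noteq> {}"
    using mem[OF xy(1)] mem[OF xy(2)] xy ne by (cases "Q x"; cases "Q y"; auto)+
  ultimately show False using C op unfolding connectedin by blast
qed

lemma curve_in_mono: "curve_in A S x \<gamma> \<Longrightarrow> S \<subseteq> T \<Longrightarrow> curve_in A T x \<gamma>"
  unfolding curve_in_def by blast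

context manifold
begin

lemma smooth_chart_restrict:
  assumes c: "smooth_chart A c" and D: "open D" "D \<subseteq> fst c"
  shows "smooth_chart A (D, snd c)" "chart_img (D, snd c) = snd c ` D"
proof -
  note cc = smooth_chart_is_chart[OF c]
  show img: "chart_img (D, snd c) = snd c ` D" by (simp add: chart_img_def)
  have inv: "chart_inv (D, snd c) (snd c p) = p" if "p \<in> D" for p
    unfolding chart_inv_def fst_conv snd_conv
    by (rule inv_into_f_f[OF inj_on_inverseI[of _ "chart_inv c"] that])
       (use D(2) is_chartD(5)[OF cc] in blast)
  have inv': "chart_inv (D, snd c) y = chart_inv c y" if "y \<in> snd c ` D" for y
    using that inv is_chartD(5)[OF cc] D(2) by auto
  have op: "open (snd c ` E)" if "open E" "E \<subseteq> fst c" for E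
    using open_chart_overlap[OF cc that(1)] that(2) by (simp add: inf.absorb2)
  have "is_chart (D, snd c)"
    unfolding is_chart_def img homeomorphism_def
    using D op[OF D] inv continuous_on_subset[OF is_chartD(3)[OF cc] D(2)]
      continuous_on_eq[OF continuous_on_subset[OF is_chartD(4)[OF cc], of "snd c ` D"] inv'[symmetric]]
      is_chartD(7)[OF cc]
    by (auto simp: image_iff subset_iff)
  moreover have "smooth_transition (D, snd c) d \<and> smooth_transition d (D, snd c)" if "d \<in> A" for d
  proof
    note ds = atlas_smooth_chart[OF that]
    note dd = smooth_chart_is_chart[OF ds]
    have "smooth_on (snd c ` (D \<inter> fst d)) (snd d \<circ> chart_inv c)"
      by (rule smooth_on_subset[OF smooth_transition[OF c ds]]) (use D(2) in blast)
    then show "smooth_transition (D, snd c) d"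
      unfolding smooth_transition_def fst_conv snd_conv
    proof (rule smooth_on_cong[rotated 2])
      show "open (snd c ` (D \<inter> fst d))"
        by (rule op) (use D is_chartD(1)[OF dd] in auto)
      show "(snd d \<circ> chart_inv c) y = (snd d \<circ> chart_inv (D, snd c)) y" if "y \<in> snd c ` (D \<inter> fst d)" for y
        using inv'[of y] that by auto
    qed
    show "smooth_transition d (D, snd c)"
      unfolding smooth_transition_def fst_conv snd_conv
      by (rule smooth_on_subset[OF smooth_transition[OF ds c]]) (use D(2) in blast)
  qed
  ultimately show "smooth_chart A (D, snd c)" unfolding smooth_chart_def by blast
qed

lemma slice_chart_restrict:
  assumes S: "slice_chart A S c L" and D: "open D" "D \<subseteq> fst c" and T: "T \<inter> D = S \<inter> D"
  shows "slice_chart A T (D, snd c) L"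
proof -
  have c: "smooth_chart A c" and L: "subspace L" using S by (auto simp: slice_chart_def)
  have "snd c ` (T \<inter> D) = snd c ` D \<inter> L"
    unfolding T using slice_chart_iff[OF S] D(2) by blast
  then show ?thesis
    unfolding slice_chart_def using smooth_chart_restrict[OF c D] L by simp
qed

end

context coisotropic_mfd
begin

text \<open>The chart is shrunk until its image is a ball, so that the plaque is a convex piece of a
  subspace; this serves for its connectedness and for joining its points by segments.\<close>

lemma integral_manifold_plaque:
  assumes N: "integral_manifold A \<omega> M N" "x \<in> N" and B: "open B" "x \<in> B"
  obtains c L r where "r > 0" "x \<in> fst c" "fst c \<subseteq> B" "chart_img c = ball (snd c x) r"
    "slice_chart A (N \<inter> fst c) c L" "integral_manifold A \<omega> M (N \<inter> fst c)"
proof -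
  obtain c L where S: "slice_chart A N c L" and x: "x \<in> fst c"
    using N unfolding integral_manifold_def embedded_submanifold_def by blast
  have c: "smooth_chart A c" using S by (simp add: slice_chart_def)
  note cc = smooth_chart_is_chart[OF c]
  have "snd c x \<in> snd c ` (fst c \<inter> B)" using x B by blast
  then obtain r where r: "r > 0" "ball (snd c x) r \<subseteq> snd c ` (fst c \<inter> B)"
    using open_chart_overlap[OF cc B(1)] by (meson openE)
  define D where "D = {p \<in> fst c. snd c p \<in> ball (snd c x) r}"
  have D: "open D" "D \<subseteq> fst c"
    unfolding D_def using open_chart_preimage[OF cc open_ball] by auto
  let ?c = "(D, snd c)"
  have DB: "D \<subseteq> B"
  proof
    fix p assume p: "p \<in> D"
    then have "snd c p \<in> snd c ` (fst c \<inter> B)" using r(2) by (auto simp: D_def)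
    then have "chart_inv c (snd c p) \<in> B" unfolding chart_overlap[OF cc] by blast
    then show "p \<in> B" using p D(2) is_chartD(5)[OF cc] by auto
  qed
  have "snd c ` D = ball (snd c x) r"
  proof
    show "ball (snd c x) r \<subseteq> snd c ` D"
    proof
      fix y assume y: "y \<in> ball (snd c x) r"
      then obtain p where "p \<in> fst c" "y = snd c p" using r(2) by blast
      then show "y \<in> snd c ` D" using y by (auto simp: D_def)
    qed
  qed (auto simp: D_def)
  then have img: "chart_img ?c = ball (snd c x) r" using smooth_chart_restrict(2)[OF c D] by simp
  have S1: "slice_chart A N ?c L" by (rule slice_chart_restrict[OF S D]) simp
  have S2: "slice_chart A (N \<inter> D) ?c L" by (rule slice_chart_restrict[OF S D]) blast
  have "embedded_submanifold A (N \<inter> D)"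
    unfolding embedded_submanifold_def using S2 by (intro exI[of _ "dim L"]) auto
  moreover have "tangent_space A (N \<inter> D) y = ker_form A \<omega> M y" if "y \<in> N \<inter> D" for y
    using tangent_space_slice_chart[OF S2] tangent_space_slice_chart[OF S1] that N(1)
    unfolding integral_manifold_def by auto
  ultimately have "integral_manifold A \<omega> M (N \<inter> D)"
    using N(1) unfolding integral_manifold_def by auto
  then show thesis
    using that[of r ?c L] r(1) x S2 img DB by (simp add: D_def)
qed

abbreviation leaf :: "'p topology" where "leaf \<equiv> leaf_topology A \<omega> M"

lemma openin_leaf: "integral_manifold A \<omega> M N \<Longrightarrow> openin leaf N"
  unfolding leaf_topology_def by (rule topology_generated_by_Basis) simp

lemma topspace_leafD:
  assumes "x \<in> topspace leaf"
  obtains N where "integral_manifold A \<omega> M N" "x \<in> N"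
  using assms unfolding leaf_topology_def topology_generated_by_topspace by blast

text \<open>The inverse chart is continuous from the convex slice into the leaf topology: the
  preimage of each generating integral manifold is open, because integral manifolds agree near a
  common point.\<close>

lemma connectedin_plaque:
  assumes N: "integral_manifold A \<omega> M N" "slice_chart A N c L" "N \<subseteq> fst c" and img: "chart_img c = ball y r"
  shows "connectedin leaf N"
proof -
  have c: "smooth_chart A c" and L: "subspace L" using N(2) by (auto simp: slice_chart_def)
  note cc = smooth_chart_is_chart[OF c]
  let ?T = "chart_img c \<inter> L"
  have NT: "N = chart_inv c ` ?T"
  proof
    show "N \<subseteq> chart_inv c ` ?T"
    proof
      fix p assume p: "p \<in> N"
      then have pc: "p \<in> fst c" using N(3) by blast
      then have "snd c p \<in> ?T" using p slice_chart_iff[OF N(2)] is_chartD(7)[OF cc] by blast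
      then show "p \<in> chart_inv c ` ?T" using is_chartD(5)[OF cc pc] by (metis imageI)
    qed
    show "chart_inv c ` ?T \<subseteq> N" using slice_chart_inv[OF N(2)] by blast
  qed
  have "continuous_map (top_of_set ?T) leaf (chart_inv c)"
    unfolding leaf_topology_def
  proof (rule continuous_on_generated_topo)
    fix N2 assume "N2 \<in> {N. integral_manifold A \<omega> M N}"
    then have N2: "integral_manifold A \<omega> M N2" by simp
    show "openin (top_of_set ?T) (chart_inv c -` N2 \<inter> topspace (top_of_set ?T))"
      unfolding openin_contains_ball
    proof (intro conjI ballI)
      fix z assume z: "z \<in> chart_inv c -` N2 \<inter> topspace (top_of_set ?T)"
      then have zT: "z \<in> ?T" and zN2: "chart_inv c z \<in> N2" by auto
      have p: "chart_inv c z \<in> fst c" "snd c (chart_inv c z) = z" using is_chartD(6,8)[OF cc] zT by auto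
      have pN: "chart_inv c z \<in> N" using zT NT by blast
      obtain e where e: "e > 0" "\<And>y. y \<in> ball z e \<Longrightarrow> y \<in> L \<Longrightarrow> chart_inv c y \<in> N2"
        by (rule integral_manifolds_overlap_open[OF N(1,2) p(1) pN N2 zN2]) (auto simp: p(2))
      then show "\<exists>e>0. ball z e \<inter> ?T \<subseteq> chart_inv c -` N2 \<inter> topspace (top_of_set ?T)"
        by (intro exI[of _ e]) auto
    qed auto
  next
    show "chart_inv c ` topspace (top_of_set ?T) \<subseteq> \<Union> {N. integral_manifold A \<omega> M N}"
      using NT N(1) by auto
  qed
  moreover have "connectedin (top_of_set ?T) ?T"
    unfolding img using convex_connected[OF convex_Int[OF convex_ball subspace_imp_convex[OF L]]]
    by (simp add: connectedin_subtopology connectedin_iff_connected)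
  ultimately show ?thesis unfolding NT by (rule connectedin_continuous_map_image)
qed

abbreviation lfib :: "'p set \<Rightarrow> 'p \<Rightarrow> 'p set" where "lfib W \<equiv> local_fibre A \<omega> M W"

lemma lfib_subset: "lfib W z \<subseteq> fibre A \<omega> M z \<inter> W \<inter> topspace leaf"
proof -
  have "lfib W z \<subseteq> topspace (subtopology leaf (fibre A \<omega> M z \<inter> W))"
    unfolding local_fibre_def by (rule connected_component_of_subset_topspace)
  then show ?thesis by (auto simp: topspace_subtopology)
qed

lemma connectedin_lfib: "connectedin leaf (lfib W z)"
  using connectedin_connected_component_of[of "subtopology leaf (fibre A \<omega> M z \<inter> W)" z]
  unfolding local_fibre_def connectedin_subtopology by blast

text \<open>The component of a point outside the space is empty. Hence a single point in a local
  fibre already shows that some integral manifold passes through \<open>z\<close>.\<close>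

lemma lfib_nonempty:
  assumes "y \<in> lfib W z"
  shows "z \<in> lfib W z"
proof -
  have "connected_component_of (subtopology leaf (fibre A \<omega> M z \<inter> W)) z y"
    using assms unfolding local_fibre_def by simp
  then have "z \<in> topspace (subtopology leaf (fibre A \<omega> M z \<inter> W))"
    by (rule connected_component_in_topspace[THEN conjunct1])
  then show ?thesis unfolding local_fibre_def by (simp add: connected_component_of_refl)
qed

lemma lfib_eq:
  assumes "y \<in> lfib W z"
  shows "lfib W y = lfib W z"
proof -
  have "connected_component_of leaf z y"
    using assms lfib_subset[of W z] unfolding fibre_def by auto
  then have "connected_component_of leaf z = connected_component_of leaf y"
    using connected_component_in_topspace[of leaf z y] by (simp add: connected_component_of_eq)
  then have f: "fibre A \<omega> M y = fibre A \<omega> M z" unfolding fibre_def by simp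
  have "connected_component_of (subtopology leaf (fibre A \<omega> M z \<inter> W)) z y"
    using assms unfolding local_fibre_def by simp
  then have "connected_component_of (subtopology leaf (fibre A \<omega> M z \<inter> W)) z
      = connected_component_of (subtopology leaf (fibre A \<omega> M z \<inter> W)) y"
    using connected_component_in_topspace[of "subtopology leaf (fibre A \<omega> M z \<inter> W)" z y]
    by (simp add: connected_component_of_eq)
  then show ?thesis unfolding local_fibre_def f by simp
qed

lemma connected_subset_lfib:
  assumes "connectedin leaf N" "x \<in> N" "N \<subseteq> W"
  shows "N \<subseteq> lfib W x" "N \<subseteq> fibre A \<omega> M x"
proof -
  show f: "N \<subseteq> fibre A \<omega> M x"
    unfolding fibre_def by (rule connected_component_of_maximal[OF assms(1,2)])
  have "connectedin (subtopology leaf (fibre A \<omega> M x \<inter> W)) N"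
    using assms f by (simp add: connectedin_subtopology)
  then show "N \<subseteq> lfib W x"
    unfolding local_fibre_def by (rule connected_component_of_maximal[OF _ assms(2)])
qed

lemma slice_chart_open_subset:
  assumes W: "openin (top_of_set M) W" and x: "x \<in> W"
  obtains c L where "slice_chart A M c L" "slice_chart A W c L" "x \<in> fst c" "M \<inter> fst c \<subseteq> W"
proof -
  obtain W0 where W0: "open W0" "W = M \<inter> W0" using W unfolding openin_open by blast
  obtain c L where S: "slice_chart A M c L" "x \<in> fst c" using slice_chart_M x W0 by blast
  have c: "smooth_chart A c" using S by (simp add: slice_chart_def)
  let ?D = "fst c \<inter> W0"
  have D: "open ?D" "?D \<subseteq> fst c" using is_chartD(1)[OF smooth_chart_is_chart[OF c]] W0(1) by auto
  show thesis
  proof (rule that)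
    show "slice_chart A M (?D, snd c) L" by (rule slice_chart_restrict[OF S(1) D refl])
    show "slice_chart A W (?D, snd c) L" by (rule slice_chart_restrict[OF S(1) D]) (use W0(2) in blast)
  qed (use S(2) W0 x in auto)
qed

end

section \<open>Maps along the fibres\<close>

lemma coisotropic_chart_subset:
  assumes "coisotropic_chart V J L" "open U" "U \<subseteq> V"
  shows "coisotropic_chart U J L"
proof -
  interpret coisotropic_chart V J L by fact
  have "invertible_family U J"
    by (rule invertible_family.intro)
       (use assms(2,3) linear_J inj_J smooth_on_subset[OF smooth_J] in auto)
  moreover have "coisotropic_chart_axioms U J L"
    by (rule coisotropic_chart_axioms.intro) (use assms(3) subspace_L skew coisotropic in auto)
  ultimately show ?thesis by (rule coisotropic_chart.intro)
qed

text \<open>Meant for the projection onto the hidden constraint set. \<open>W_leaf\<close> is the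
  form in which an integral manifold through each point of \<open>W\<close> is supplied.\<close>

locale fibre_map = coisotropic_mfd A \<omega> M
  for A :: "('p::{t2_space, second_countable_topology}, 'e::euclidean_space) chart set" and \<omega> M +
  fixes W :: "'p set" and f :: "'p \<Rightarrow> 'p"
  assumes openin_W: "openin (top_of_set M) W"
    and smooth_f: "smooth_map_on A A W f"
    and W_leaf: "W \<subseteq> topspace leaf"
    and f_lfib: "x \<in> W \<Longrightarrow> y \<in> lfib W x \<Longrightarrow> f y = f x"
begin

lemma W_subset_M: "W \<subseteq> M"
  using openin_W by (auto simp: openin_open)

text \<open>Phrased without charts, through velocities of curves as in
  \<open>symplectic_map_on\<close>, because it is to be followed along a fibre that may leave every
  single chart.\<close>

definition preserves :: "'p \<Rightarrow> bool" where
  "preserves x \<longleftrightarrow> (\<forall>\<gamma> \<delta>. curve_in A W x \<gamma> \<and> curve_in A W x \<delta> \<longrightarrow>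
     \<omega> (f x) (velocity A (f \<circ> \<gamma>) 0) (velocity A (f \<circ> \<delta>) 0) = \<omega> x (velocity A \<gamma> 0) (velocity A \<delta> 0))"

lemma plaque_in_W:
  assumes x: "x \<in> W" and B: "open B" "x \<in> B"
  obtains N c L r where "integral_manifold A \<omega> M N" "slice_chart A N c L" "x \<in> N" "N \<subseteq> fst c"
    "fst c \<subseteq> B" "r > 0" "chart_img c = ball (snd c x) r" "N \<subseteq> lfib W x" "N \<subseteq> fibre A \<omega> M x"
proof -
  obtain W0 where W0: "open W0" "W = M \<inter> W0" using openin_W unfolding openin_open by blast
  obtain N where N: "integral_manifold A \<omega> M N" "x \<in> N" using topspace_leafD x W_leaf by blast
  have B': "open (B \<inter> W0)" "x \<in> B \<inter> W0" using B W0 x by auto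
  obtain c L r where c: "r > 0" "x \<in> fst c" "fst c \<subseteq> B \<inter> W0" "chart_img c = ball (snd c x) r"
    "slice_chart A (N \<inter> fst c) c L" "integral_manifold A \<omega> M (N \<inter> fst c)"
    by (rule integral_manifold_plaque[OF N B'])
  have NW: "N \<inter> fst c \<subseteq> W" using c(3,6) W0(2) unfolding integral_manifold_def by blast
  have con: "connectedin leaf (N \<inter> fst c)" by (rule connectedin_plaque[OF c(6,5) _ c(4)]) blast
  have xN: "x \<in> N \<inter> fst c" using N(2) c(2) by blast
  show thesis
    by (rule that[OF c(6,5) xN _ _ c(1,4) connected_subset_lfib[OF con xN NW]]) (use c(3) in blast)+
qed

end

text \<open>\<open>F\<close> extends the coordinate expression of \<open>f\<close> to an open set,
  which makes calculus available; only its values on \<open>L\<close> are determined by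
  \<open>f\<close>.\<close>

locale fibre_map_chart = fibre_map A \<omega> M W f
  for A :: "('p::{t2_space, second_countable_topology}, 'e::euclidean_space) chart set" and \<omega> M W f +
  fixes c :: "('p, 'e) chart" and L :: "'e set" and d :: "('p, 'e) chart" and U :: "'e set" and F :: "'e \<Rightarrow> 'e"
  assumes slice_M: "slice_chart A M c L" and slice_W: "slice_chart A W c L" and chart_d: "smooth_chart A d"
    and open_U': "open U" and U_img: "U \<subseteq> chart_img c" and smooth_F: "smooth_on U F"
    and F_img: "F ` U \<subseteq> chart_img d"
    and F_eq: "\<And>x. x \<in> W \<Longrightarrow> x \<in> fst c \<Longrightarrow> snd c x \<in> U \<Longrightarrow> f x \<in> fst d \<and> F (snd c x) = snd d (f x)"

sublocale fibre_map_chart \<subseteq> coisotropic_chart U "flat c" L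
  by (rule coisotropic_chart_subset[OF coisotropic_chart_flat[OF slice_M] open_U' U_img])

context fibre_map
begin

lemma fibre_map_chart_exists:
  assumes S: "slice_chart A M c L" "slice_chart A W c L" and d: "smooth_chart A d" "f x \<in> fst d"
    and x: "x \<in> W" "x \<in> fst c"
  obtains U F where "fibre_map_chart A \<omega> M W f c L d U F" "snd c x \<in> U"
proof -
  have c: "smooth_chart A c" using S by (simp add: slice_chart_def)
  note dd = smooth_chart_is_chart[OF d(1)]
  obtain U F where U: "open U" "snd c x \<in> U" "U \<subseteq> chart_img c" "smooth_on U F"
    and F: "\<And>x. x \<in> W \<Longrightarrow> x \<in> fst c \<Longrightarrow> snd c x \<in> U \<Longrightarrow> f x \<in> fst d \<and> F (snd c x) = snd d (f x)"
    using smooth_map_on_coord[OF smooth_f c x(2) d x(1)] by blast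
  let ?U = "F -` chart_img d \<inter> U"
  have oU: "open ?U"
    using continuous_open_preimage[OF smooth_on_imp_continuous_on[OF U(4)] U(1) is_chartD(2)[OF dd]]
    by (simp add: Int_commute)
  have "fibre_map_chart A \<omega> M W f c L d ?U F"
    by unfold_locales (use S d(1) oU U(3) F smooth_on_subset[OF U(4)] in auto)
  moreover have "snd c x \<in> ?U" using U(2) F[OF x U(2)] is_chartD(7)[OF dd] by auto
  ultimately show thesis by (rule that)
qed

end

context fibre_map_chart
begin

lemma chart_c: "smooth_chart A c"
  using slice_M by (simp add: slice_chart_def)

lemma velocity_image:
  assumes z: "z \<in> W" "z \<in> fst c" "snd c z \<in> U" and \<gamma>: "curve_in A W z \<gamma>"
  obtains v where "v \<in> L" "velocity A \<gamma> 0 = to_std c z v"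
    "velocity A (f \<circ> \<gamma>) 0 = to_std d (f z) (fd F (snd c z) v)"
proof -
  obtain v e where v: "v \<in> L" "((\<lambda>t. snd c (\<gamma> t)) has_vector_derivative v) (at 0)"
    "velocity A \<gamma> 0 = to_std c z v" and e: "e > 0" "\<And>t. \<bar>t\<bar> < e \<Longrightarrow> \<gamma> t \<in> fst c \<inter> W"
    using slice_chart_curve_velocity[OF slice_W z(2) \<gamma>] by metis
  have \<gamma>0: "\<gamma> 0 = z" using \<gamma> by (simp add: curve_in_def)
  have "isCont (\<lambda>t. snd c (\<gamma> t)) 0" using v(2) by (rule has_vector_derivative_continuous)
  then have "\<forall>\<^sub>F t in at 0. snd c (\<gamma> t) \<in> U"
    using open_U' z(3) \<gamma>0 by (intro topological_tendstoD) (auto simp: isCont_def)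
  then obtain e2 where e2: "e2 > 0" "\<And>t. t \<noteq> 0 \<Longrightarrow> \<bar>t\<bar> < e2 \<Longrightarrow> snd c (\<gamma> t) \<in> U"
    unfolding eventually_at by (auto simp: dist_norm)
  define e' where "e' = min e e2"
  have e': "e' > 0" using e(1) e2(1) by (simp add: e'_def)
  have near: "\<gamma> t \<in> W \<and> \<gamma> t \<in> fst c \<and> snd c (\<gamma> t) \<in> U" if "\<bar>t\<bar> < e'" for t
    using e(2)[of t] e2(2)[of t] that z(3) \<gamma>0 by (cases "t = 0") (auto simp: e'_def)
  have "((\<lambda>t. F (snd c (\<gamma> t))) has_vector_derivative fd F (snd c z) v) (at 0)"
    using vector_derivative_diff_chain_within[OF v(2), of F "fd F (snd c z)"]
      has_derivative_at_withinI[OF smooth_on_has_derivative[OF smooth_F z(3)]] \<gamma>0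
    unfolding comp_def by simp
  then have "((\<lambda>t. snd d ((f \<circ> \<gamma>) t)) has_vector_derivative fd F (snd c z) v) (at 0)"
    by (rule has_vector_derivative_transform_within_open[where S = "ball 0 e'"])
       (use e' near F_eq in auto)
  from velocity_eqI[where \<gamma> = "f \<circ> \<gamma>", OF chart_d e' _ this] have "velocity A (f \<circ> \<gamma>) 0 = to_std d (f z) (fd F (snd c z) v)"
    using near F_eq \<gamma>0 by simp
  with v show thesis using that by blast
qed

lemma tangent_line:
  assumes z: "z \<in> W" "z \<in> fst c" and v: "v \<in> L"
  obtains \<gamma> where "curve_in A W z \<gamma>" "velocity A \<gamma> 0 = to_std c z v"
  using slice_chart_line[OF slice_W z(2,1) v] that by blast

lemma leaf_tangent:
  assumes z: "z \<in> fst c" and k: "flat c (snd c z) k \<in> L\<^sup>\<bottom>"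
    and N: "integral_manifold A \<omega> M N" "slice_chart A N c3 L3" "z \<in> N" "z \<in> fst c3"
  shows "fd (snd c3 \<circ> chart_inv c) (snd c z) k \<in> L3"
    "fd (snd c \<circ> chart_inv c3) (snd c3 z) (fd (snd c3 \<circ> chart_inv c) (snd c z) k) = k"
proof -
  have c3: "smooth_chart A c3" using N(2) by (simp add: slice_chart_def)
  show "fd (snd c \<circ> chart_inv c3) (snd c3 z) (fd (snd c3 \<circ> chart_inv c) (snd c z) k) = k"
    by (rule fd_transition_inverse[OF chart_c z c3 N(4)])
  then show "fd (snd c3 \<circ> chart_inv c) (snd c z) k \<in> L3"
    using integral_tangent_iff[OF slice_M z N(1,2,4,3)] k by metis
qed

text \<open>A kernel vector is the velocity of a curve inside a plaque, and \<open>f\<close> is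
  constant along that curve.\<close>

lemma fd_F_kernel:
  assumes z: "z \<in> W" "z \<in> fst c" "snd c z \<in> U" and k: "flat c (snd c z) k \<in> L\<^sup>\<bottom>"
  shows "fd F (snd c z) k = 0"
proof -
  obtain N c3 L3 r where N: "integral_manifold A \<omega> M N" "slice_chart A N c3 L3" "z \<in> N" "N \<subseteq> fst c3"
    and lf: "N \<subseteq> lfib W z"
    using plaque_in_W[OF z(1) open_UNIV UNIV_I] by metis
  have c3: "smooth_chart A c3" using N(2) by (simp add: slice_chart_def)
  have z3: "z \<in> fst c3" using N by blast
  note cc3 = smooth_chart_is_chart[OF c3]
  define w where "w = fd (snd c3 \<circ> chart_inv c) (snd c z) k"
  have w: "w \<in> L3" "fd (snd c \<circ> chart_inv c3) (snd c3 z) w = k"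
    using leaf_tangent[OF z(2) k N(1-3) z3] by (simp_all add: w_def)
  obtain \<gamma> where \<gamma>: "curve_in A N z \<gamma>" "velocity A \<gamma> 0 = to_std c3 z w"
    using slice_chart_line[OF N(2) z3 N(3) w(1)] by blast
  have NW: "N \<subseteq> W" using lf lfib_subset by blast
  have vel: "velocity A \<gamma> 0 = to_std c z k"
    using \<gamma>(2) to_std_transition[OF c3 z3 chart_c z(2), of w] w(2) by simp
  obtain v where v: "velocity A \<gamma> 0 = to_std c z v" "velocity A (f \<circ> \<gamma>) 0 = to_std d (f z) (fd F (snd c z) v)"
    using velocity_image[OF z curve_in_mono[OF \<gamma>(1) NW]] by metis
  have "v = k" using v(1) vel inj_to_std[OF chart_c z(2)] by (metis injD)
  obtain e where e: "e > 0" "\<And>t. \<bar>t\<bar> < e \<Longrightarrow> \<gamma> t \<in> N"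
    using \<gamma>(1) unfolding curve_in_def by (metis abs_less_iff greaterThanLessThan_iff image_subset_iff minus_less_iff)
  have const: "(f \<circ> \<gamma>) t = f z" if "\<bar>t\<bar> < e" for t
    using f_lfib[OF z(1)] lf e(2)[OF that] by auto
  have fz: "f z \<in> fst d" using F_eq[OF z] by blast
  have "((\<lambda>t. snd d ((f \<circ> \<gamma>) t)) has_vector_derivative 0) (at 0)"
    by (rule has_vector_derivative_transform_within_open[where S = "ball 0 e", OF has_vector_derivative_const])
       (use e(1) const in auto)
  from velocity_eqI[where \<gamma> = "f \<circ> \<gamma>", OF chart_d e(1) _ this] have "velocity A (f \<circ> \<gamma>) 0 = to_std d (f z) 0"
    using const fz e(1) by simp
  then have "to_std d (f z) (fd F (snd c z) k) = to_std d (f z) 0" using v(2) \<open>v = k\<close> by simp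
  then show ?thesis using inj_to_std[OF chart_d fz] by (metis injD)
qed

text \<open>The form \<eta> of the overview in coordinates. It is closed on all of \<open>U\<close>,
  but its vanishing is of interest only at points of \<open>L\<close> and for vectors of
  \<open>L\<close>.\<close>

definition defect :: "'e \<Rightarrow> 'e \<Rightarrow> 'e \<Rightarrow> real" where
  "defect y u v = form d (F y) (fd F y u) (fd F y v) - form c y u v"

lemma closed_defect: "closed_form_on U defect"
  unfolding defect_def[abs_def]
  by (intro closed_form_on_diff open_U' closed_form_on_subset[OF closed_form_chart[OF chart_c] U_img]
      closed_form_on_pullback[OF closed_form_chart[OF chart_d] smooth_F open_U' _ F_img]
      is_chartD(2)[OF smooth_chart_is_chart[OF chart_d]])

lemma preserves_iff:
  assumes z: "z \<in> W" "z \<in> fst c" "snd c z \<in> U"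
  shows "preserves z \<longleftrightarrow> (\<forall>u\<in>L. \<forall>v\<in>L. defect (snd c z) u v = 0)"
proof -
  have fz: "f z \<in> fst d" "F (snd c z) = snd d (f z)" using F_eq[OF z] by auto
  have eq: "defect (snd c z) u v =
      \<omega> (f z) (to_std d (f z) (fd F (snd c z) u)) (to_std d (f z) (fd F (snd c z) v))
      - \<omega> z (to_std c z u) (to_std c z v)" for u v
    unfolding defect_def fz(2) by (simp add: form_at[OF chart_d fz(1)] form_at[OF chart_c z(2)])
  show ?thesis
  proof
    assume P: "preserves z"
    show "\<forall>u\<in>L. \<forall>v\<in>L. defect (snd c z) u v = 0"
    proof (intro ballI)
      fix u v assume "u \<in> L" "v \<in> L"
      then obtain \<gamma> \<delta> where \<gamma>: "curve_in A W z \<gamma>" "velocity A \<gamma> 0 = to_std c z u"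
        and \<delta>: "curve_in A W z \<delta>" "velocity A \<delta> 0 = to_std c z v"
        using tangent_line[OF z(1,2)] by metis
      obtain u' where u': "velocity A \<gamma> 0 = to_std c z u'"
        "velocity A (f \<circ> \<gamma>) 0 = to_std d (f z) (fd F (snd c z) u')"
        using velocity_image[OF z \<gamma>(1)] by metis
      obtain v' where v': "velocity A \<delta> 0 = to_std c z v'"
        "velocity A (f \<circ> \<delta>) 0 = to_std d (f z) (fd F (snd c z) v')"
        using velocity_image[OF z \<delta>(1)] by metis
      have "u' = u" "v' = v"
        using u'(1) v'(1) \<gamma>(2) \<delta>(2) inj_to_std[OF chart_c z(2)] by (metis injD)+
      then show "defect (snd c z) u v = 0"
        using P[unfolded preserves_def, rule_format, OF conjI[OF \<gamma>(1) \<delta>(1)]] \<gamma>(2) \<delta>(2) u'(2) v'(2)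
        unfolding eq by simp
    qed
  next
    assume D: "\<forall>u\<in>L. \<forall>v\<in>L. defect (snd c z) u v = 0"
    show "preserves z"
      unfolding preserves_def
    proof (intro allI impI, elim conjE)
      fix \<gamma> \<delta> assume \<gamma>: "curve_in A W z \<gamma>" and \<delta>: "curve_in A W z \<delta>"
      obtain u where u: "u \<in> L" "velocity A \<gamma> 0 = to_std c z u"
        "velocity A (f \<circ> \<gamma>) 0 = to_std d (f z) (fd F (snd c z) u)"
        using velocity_image[OF z \<gamma>] by metis
      obtain v where v: "v \<in> L" "velocity A \<delta> 0 = to_std c z v"
        "velocity A (f \<circ> \<delta>) 0 = to_std d (f z) (fd F (snd c z) v)"
        using velocity_image[OF z \<delta>] by metis
      show "\<omega> (f z) (velocity A (f \<circ> \<gamma>) 0) (velocity A (f \<circ> \<delta>) 0) = \<omega> z (velocity A \<gamma> 0) (velocity A \<delta> 0)"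
        using D u(1) v(1) unfolding u(2,3) v(2,3) eq by auto
    qed
  qed
qed

lemma defect_kernel:
  assumes y: "y \<in> U" "y \<in> L" and k: "flat c y k \<in> L\<^sup>\<bottom>" and v: "v \<in> L"
  shows "defect y k v = 0"
proof -
  note cc = smooth_chart_is_chart[OF chart_c]
  have yi: "y \<in> chart_img c" using y(1) U_img by blast
  define z where "z = chart_inv c y"
  have z: "z \<in> fst c" "snd c z = y" using is_chartD(6,8)[OF cc yi] by (auto simp: z_def)
  have zW: "z \<in> W" using slice_chart_inv[OF slice_W yi] y(2) by (simp add: z_def)
  have "fd F y k = 0" using fd_F_kernel[OF zW z(1)] z(2) y(1) k by simp
  moreover have "F y \<in> chart_img d" using F_img y(1) by blast
  moreover have "form c y k v = 0"
    using k v flat_inner[OF chart_c yi, of k v] by (simp add: mem_orthogonal_comp)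
  ultimately show ?thesis
    using bilinear_lzero[OF bilinear_form(1)[OF chart_d]] by (simp add: defect_def)
qed

text \<open>As the chart image is a ball, \<open>x\<close> and \<open>y\<close> are joined by a
  segment of the slice, a curve in the leaf along which the closed form \<open>defect\<close> can be
  transported.\<close>

lemma preserves_plaque:
  assumes N: "integral_manifold A \<omega> M N" "slice_chart A N c3 L3" "N \<subseteq> fst c3" "N \<subseteq> W"
    and img: "chart_img c3 = ball q r" and c3_in: "\<And>p. p \<in> fst c3 \<Longrightarrow> p \<in> fst c \<and> snd c p \<in> U"
    and x: "x \<in> N" and y: "y \<in> N" and "preserves x"
  shows "preserves y"
proof -
  note cc = smooth_chart_is_chart[OF chart_c]
  have c3: "smooth_chart A c3" and L3: "subspace L3" using N(2) by (auto simp: slice_chart_def)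
  note cc3 = smooth_chart_is_chart[OF c3]
  have xy3: "x \<in> fst c3" "y \<in> fst c3" using N(3) x y by auto
  let ?a = "snd c3 x" and ?b = "snd c3 y"
  define w where "w = ?b - ?a"
  have ab: "?a \<in> L3" "?b \<in> L3" using slice_chart_iff[OF N(2)] xy3 x y by auto
  have wL: "w \<in> L3" unfolding w_def by (rule subspace_diff[OF L3 ab(2,1)])
  have ab_img: "?a \<in> chart_img c3" "?b \<in> chart_img c3" using is_chartD(7)[OF cc3] xy3 by auto
  have line: "?a + t *\<^sub>R w \<in> chart_img c3" if "t \<in> {0..1}" for t
  proof -
    have "(1 - t) *\<^sub>R ?a + t *\<^sub>R ?b \<in> ball q r"
      by (rule convexD[OF convex_ball]) (use that ab_img img in auto)
    then show ?thesis unfolding img w_def by (simp add: algebra_simps)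
  qed
  have lineL: "?a + t *\<^sub>R w \<in> L3" for t by (intro subspace_add[OF L3] subspace_scale[OF L3] ab wL)
  define s where "s t = chart_inv c3 (?a + t *\<^sub>R w)" for t
  have s: "s t \<in> fst c3" "snd c3 (s t) = ?a + t *\<^sub>R w" "s t \<in> N" "s t \<in> fst c" "snd c (s t) \<in> U" "s t \<in> W"
    if t: "t \<in> {0..1}" for t
  proof -
    show 1: "s t \<in> fst c3" "snd c3 (s t) = ?a + t *\<^sub>R w"
      using is_chartD(6,8)[OF cc3 line[OF t]] by (auto simp: s_def)
    show 2: "s t \<in> N" using slice_chart_inv[OF N(2) line[OF t]] lineL by (simp add: s_def)
    show "s t \<in> W" using 2 N(4) by blast
    show "s t \<in> fst c" "snd c (s t) \<in> U" using c3_in[OF 1(1)] by auto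
  qed
  have s01: "s 0 = x" "s 1 = y" using is_chartD(5)[OF cc3] xy3 by (simp_all add: s_def w_def)
  let ?m = "snd c \<circ> chart_inv c3"
  have sm: "smooth_on (chart_img c3) ?m"
    by (rule smooth_on_subset[OF smooth_transition[OF c3 chart_c]])
       (use c3_in is_chartD(8)[OF cc3] in \<open>auto simp: chart_overlap[OF cc3]\<close>)
  define g where "g t = fd ?m (?a + t *\<^sub>R w) w" for t
  have "defect (snd c (s 1)) u v = 0" if uv: "u \<in> L" "v \<in> L" for u v
  proof (rule closed_form_transport[where c = "\<lambda>t. snd c (s t)" and c' = g, OF closed_defect])
    fix t :: real assume t: "t \<in> {0..1}"
    have "((\<lambda>t. ?m (?a + t *\<^sub>R w)) has_vector_derivative g t) (at t)"
    proof -
      have "((\<lambda>t. ?a + t *\<^sub>R w) has_vector_derivative w) (at t)" by (auto intro!: derivative_eq_intros)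
      from vector_derivative_diff_chain_within[OF this, of ?m]
      show ?thesis
        using has_derivative_at_withinI[OF smooth_on_has_derivative[OF sm line[OF t]]]
        unfolding g_def comp_def by blast
    qed
    then show "((\<lambda>t. snd c (s t)) has_vector_derivative g t) (at t)" by (simp add: s_def)
    show "snd c (s t) \<in> U" by (rule s(5)[OF t])
    show "snd c (s t) \<in> L" using slice_chart_iff[OF slice_W s(4)[OF t]] s(6)[OF t] by simp
    show "flat c (snd c (s t)) (g t) \<in> L\<^sup>\<bottom>"
      using integral_tangent_iff[OF slice_M s(4)[OF t] N(1,2) s(1,3)[OF t]] wL
      by (simp add: g_def s(2)[OF t])
  next
    show "continuous_on {0..1} g"
      unfolding g_def
      by (rule continuous_on_compose2[OF smooth_on_imp_continuous_on[OF smooth_on_fd[OF sm]], where f = "\<lambda>t. ?a + t *\<^sub>R w"])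
         (use line in \<open>auto intro!: continuous_intros\<close>)
    show "defect y k v = 0" if "y \<in> U" "y \<in> L" "flat c y k \<in> L\<^sup>\<bottom>" "v \<in> L" for y k v
      by (rule defect_kernel[OF that])
    show "defect (snd c (s 0)) u v = 0" if "u \<in> L" "v \<in> L" for u v
      using assms(9) preserves_iff[OF s(6,4,5)[of 0]] that unfolding s01(1) by simp
  qed (rule uv)+
  then show ?thesis
    using preserves_iff[OF s(6,4,5)[of 1]] unfolding s01(2) by simp
qed

end

context fibre_map
begin

lemma preserves_locally_constant:
  assumes x: "x \<in> W"
  shows "\<exists>N. openin leaf N \<and> x \<in> N \<and> (\<forall>y\<in>N. preserves y \<longleftrightarrow> preserves x)"
proof -
  obtain c L where S: "slice_chart A M c L" "slice_chart A W c L" and xc: "x \<in> fst c"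
    using slice_chart_open_subset[OF openin_W x] by metis
  have c: "smooth_chart A c" using S by (simp add: slice_chart_def)
  obtain U F where "fibre_map_chart A \<omega> M W f c L (chart_at A (f x)) U F" and xU: "snd c x \<in> U"
    using fibre_map_chart_exists[OF S chart_at(3,2) x xc] .
  interpret fibre_map_chart A \<omega> M W f c L "chart_at A (f x)" U F by fact
  let ?B = "{p \<in> fst c. snd c p \<in> U}"
  have B: "open ?B" "x \<in> ?B" using open_chart_preimage[OF smooth_chart_is_chart[OF c] open_U'] xc xU by auto
  obtain N c3 L3 r where N: "integral_manifold A \<omega> M N" "slice_chart A N c3 L3" "x \<in> N" "N \<subseteq> fst c3"
    "fst c3 \<subseteq> ?B" "r > 0" "chart_img c3 = ball (snd c3 x) r" "N \<subseteq> lfib W x" "N \<subseteq> fibre A \<omega> M x"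
    by (rule plaque_in_W[OF x B])
  have NW: "N \<subseteq> W" using N(8) lfib_subset by blast
  have c3B: "p \<in> fst c \<and> snd c p \<in> U" if "p \<in> fst c3" for p using N(5) that by blast
  have "preserves y \<longleftrightarrow> preserves x" if "y \<in> N" for y
    using preserves_plaque[OF N(1,2,4) NW N(7) c3B] N(3) that by blast
  then show ?thesis using openin_leaf[OF N(1)] N(3) by blast
qed

lemma preserves_lfib:
  assumes x: "x \<in> W" and y: "y \<in> lfib W x"
  shows "preserves x \<longleftrightarrow> preserves y"
proof (rule connectedin_locally_constant[OF connectedin_lfib _ lfib_nonempty[OF y] y])
  fix z assume "z \<in> lfib W x"
  then have "z \<in> W" using lfib_subset by blast
  from preserves_locally_constant[OF this]
  show "\<exists>U. openin leaf U \<and> z \<in> U \<and> (\<forall>y\<in>U \<inter> lfib W x. preserves y \<longleftrightarrow> preserves z)" by blast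
qed

end

section \<open>The hidden constraint set\<close>

context manifold
begin

lemma smooth_function_in_chart:
  assumes H: "smooth_map_on A std_atlas UNIV H" and c: "smooth_chart A c"
  shows "smooth_on (chart_img c) (H \<circ> chart_inv c)"
proof (rule smooth_on_local)
  note cc = smooth_chart_is_chart[OF c]
  fix y assume y: "y \<in> chart_img c"
  let ?p = "chart_inv c y"
  let ?a = "chart_at A ?p"
  note aa = smooth_chart_is_chart[OF chart_at(3)[of ?p]]
  have "(UNIV, id) \<in> std_atlas" by (simp add: std_atlas_def)
  from H[unfolded smooth_map_on_def, rule_format, OF UNIV_I chart_at(1)[of ?p] this, of ?p] chart_at(2)[of ?p]
  obtain U F where U: "open U" "snd ?a ?p \<in> U" "smooth_on U F"
    and F: "\<And>x. x \<in> fst ?a \<Longrightarrow> snd ?a x \<in> U \<Longrightarrow> F (snd ?a x) = H x"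
    by auto
  let ?t = "snd ?a \<circ> chart_inv c" and ?D = "snd c ` (fst c \<inter> fst ?a)"
  have st: "smooth_on ?D ?t" by (rule smooth_transition[OF c chart_at(3)])
  let ?V = "?t -` U \<inter> ?D"
  have V: "open ?V"
    using continuous_open_preimage[OF smooth_on_imp_continuous_on[OF st] open_chart_overlap[OF cc is_chartD(1)[OF aa]] U(1)]
    by (simp add: Int_commute)
  have "smooth_on ?V (\<lambda>x. F (?t x))"
    by (rule smooth_on_compose[OF U(3) smooth_on_subset[OF st] V U(1)]) auto
  then have "smooth_on ?V (H \<circ> chart_inv c)"
    by (rule smooth_on_cong[OF V, rotated]) (auto simp: F is_chartD(5)[OF cc])
  moreover have "y \<in> ?V"
    using U(2) chart_at(2) y by (simp add: chart_overlap[OF cc])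
  ultimately show "\<exists>V. open V \<and> y \<in> V \<and> smooth_on V (H \<circ> chart_inv c)" using V by blast
qed

lemma fd_function_transition:
  fixes H :: "'p \<Rightarrow> real"
  assumes H: "smooth_map_on A std_atlas UNIV H" and c: "smooth_chart A c" "p \<in> fst c"
    and d: "smooth_chart A d" "p \<in> fst d"
  shows "fd (H \<circ> chart_inv d) (snd d p) (fd (snd d \<circ> chart_inv c) (snd c p) w)
    = fd (H \<circ> chart_inv c) (snd c p) w"
  by (rule fd_coordinate_change[OF c d smooth_on_has_derivative[OF smooth_function_in_chart[OF H d(1)]
      is_chartD(7)[OF smooth_chart_is_chart[OF d(1)] d(2)]]])

lemma differential_in_chart:
  assumes "smooth_map_on A std_atlas UNIV H" "smooth_chart A c" "p \<in> fst c"
  shows "differential A H p (to_std c p w) = fd (H \<circ> chart_inv c) (snd c p) w"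
  unfolding differential_def to_std_def by (rule fd_function_transition[OF assms chart_at(3,2)])

text \<open>\<open>vector_derivative\<close> depends only on which vectors are derivatives of the
  curve, and this is a local property.\<close>

lemma velocity_cong:
  assumes "e > 0" "\<And>t. \<bar>t\<bar> < e \<Longrightarrow> \<gamma> t = \<delta> t"
  shows "velocity A \<gamma> 0 = velocity A \<delta> 0"
proof -
  have "(g \<circ> \<gamma> has_vector_derivative v) (at 0) \<longleftrightarrow> (g \<circ> \<delta> has_vector_derivative v) (at 0)"
    for g :: "'p \<Rightarrow> 'e" and v
    using has_vector_derivative_transform_within_open[of "g \<circ> \<gamma>" v 0 "ball 0 e" "g \<circ> \<delta>"]
      has_vector_derivative_transform_within_open[of "g \<circ> \<delta>" v 0 "ball 0 e" "g \<circ> \<gamma>"] assms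
    by auto
  moreover have "\<gamma> 0 = \<delta> 0" using assms by simp
  ultimately show ?thesis unfolding velocity_def vector_derivative_def by simp
qed

end

context coisotropic_mfd
begin

abbreviation hid :: "('p \<Rightarrow> real) \<Rightarrow> 'p set" where "hid H \<equiv> hidden_constraint_set A \<omega> M H"

text \<open>The sum is the gradient of \<open>H\<close> in the chart, so this is the Hamiltonian
  vector field in coordinates, as one smooth map on the chart image.\<close>

definition ham :: "('p \<Rightarrow> real) \<Rightarrow> ('p, 'e) chart \<Rightarrow> 'e \<Rightarrow> 'e" where
  "ham H c y = invertible_family.Jinv (flat c) y (\<Sum>b\<in>Basis. fd (H \<circ> chart_inv c) y b *\<^sub>R b)"

lemma flat_ham:
  assumes H: "smooth_map_on A std_atlas UNIV H" and c: "smooth_chart A c" "y \<in> chart_img c"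
  shows "flat c y (ham H c y) \<bullet> w = fd (H \<circ> chart_inv c) y w"
proof -
  interpret invertible_family "chart_img c" "flat c" by (rule invertible_family_flat[OF c(1)])
  have lin: "linear (fd (H \<circ> chart_inv c) y)"
    by (rule smooth_on_linear_fd[OF smooth_function_in_chart[OF H c(1)] c(2)])
  have "flat c y (ham H c y) \<bullet> w = (\<Sum>b\<in>Basis. (w \<bullet> b) * fd (H \<circ> chart_inv c) y b)"
    using c(2) by (simp add: ham_def inner_sum_left inner_commute[of w] mult.commute)
  then show ?thesis using linear_Basis_expand[OF lin, of w] by simp
qed

lemma smooth_ham:
  assumes H: "smooth_map_on A std_atlas UNIV H" and c: "smooth_chart A c"
  shows "smooth_on (chart_img c) (ham H c)"
proof -
  interpret invertible_family "chart_img c" "flat c" by (rule invertible_family_flat[OF c])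
  have "smooth_on (chart_img c) (\<lambda>y. Jinv y (\<Sum>b\<in>Basis. fd (H \<circ> chart_inv c) y b *\<^sub>R b))"
  proof (rule smooth_on_linear_family[where A = Jinv, OF open_U linear_Jinv smooth_Jinv])
    show "smooth_on (chart_img c) (\<lambda>y. \<Sum>b\<in>Basis. fd (H \<circ> chart_inv c) y b *\<^sub>R b)"
      by (intro smooth_on_sum smooth_on_scaleR smooth_on_const open_U smooth_on_fd smooth_function_in_chart H c)
  qed
  then show ?thesis by (simp add: ham_def[abs_def])
qed

text \<open>If the differential of \<open>H\<close> and \<open>\<omega>(u, \<cdot>)\<close> agree on
  \<open>L\<close>, the Hamiltonian vector minus \<open>u\<close> satisfies the kernel condition, so
  it lies in \<open>L\<close> by coisotropy; with \<open>u\<close> in \<open>L\<close> the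
  Hamiltonian vector follows. Conversely it is its own witness.\<close>

lemma hidden_iff:
  assumes H: "smooth_map_on A std_atlas UNIV H" and S: "slice_chart A M c L" and z: "z \<in> fst c" "z \<in> M"
  shows "z \<in> hid H \<longleftrightarrow> ham H c (snd c z) \<in> L"
proof -
  have c: "smooth_chart A c" using S by (simp add: slice_chart_def)
  note cc = smooth_chart_is_chart[OF c]
  interpret coisotropic_chart "chart_img c" "flat c" L by (rule coisotropic_chart_flat[OF S])
  have y: "snd c z \<in> chart_img c" "snd c z \<in> L"
    using is_chartD(7)[OF cc z(1)] slice_chart_iff[OF S z(1)] z(2) by auto
  let ?Y = "ham H c (snd c z)"
  have T: "tangent_space A M z = to_std c z ` L" by (rule tangent_space_slice_chart[OF S z])
  have key: "flat c (snd c z) (?Y - u) \<bullet> v = fd (H \<circ> chart_inv c) (snd c z) v - form c (snd c z) u v" for u v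
    by (simp only: linear_diff[OF linear_J[OF y(1)]] inner_diff_left flat_ham[OF H c y(1)],
        simp only: flat_inner[OF c y(1)])
  have "z \<in> hid H \<longleftrightarrow> (\<exists>u\<in>L. \<forall>v\<in>L. fd (H \<circ> chart_inv c) (snd c z) v = form c (snd c z) u v)"
    unfolding hidden_constraint_set_def
    by (simp add: z(2) T differential_in_chart[OF H c z(1)] form_at[OF c z(1)])
  also have "\<dots> \<longleftrightarrow> (\<exists>u\<in>L. flat c (snd c z) (?Y - u) \<in> L\<^sup>\<bottom>)"
    by (simp add: mem_orthogonal_comp key)
  also have "\<dots> \<longleftrightarrow> ?Y \<in> L"
  proof
    assume "\<exists>u\<in>L. flat c (snd c z) (?Y - u) \<in> L\<^sup>\<bottom>"
    then obtain u where u: "u \<in> L" "?Y - u \<in> L" using coisotropic[OF y] by blast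
    then show "?Y \<in> L" using subspace_add[OF subspace_L u(2,1)] by simp
  next
    assume "?Y \<in> L"
    then show "\<exists>u\<in>L. flat c (snd c z) (?Y - u) \<in> L\<^sup>\<bottom>"
      by (intro bexI[of _ ?Y]) (simp_all add: linear_0[OF linear_J[OF y(1)]] mem_orthogonal_comp)
  qed
  finally show ?thesis .
qed

text \<open>Transversality of the hidden set to the leaf. A hidden point is critical for
  \<open>H\<close> on its plaque, and a kernel vector along which the normal part of the Hamiltonian
  field has zero derivative lies in the null space of the Hessian there.\<close>

lemma normal_derivative_nonzero:
  assumes H: "smooth_map_on A std_atlas UNIV H" and nondeg: "fibrewise_nondegenerate A \<omega> M H"
    and S: "slice_chart A M c L" and y: "y \<in> fst c" "y \<in> hid H"
    and N: "integral_manifold A \<omega> M N" "slice_chart A N c3 L3" "y \<in> N" "y \<in> fst c3" "N \<subseteq> fibre A \<omega> M y"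
      "fst c3 \<subseteq> fst c"
    and k: "flat c (snd c y) k \<in> L\<^sup>\<bottom>" "fd (ham H c) (snd c y) k \<in> L"
  shows "k = 0"
proof -
  have c: "smooth_chart A c" and c3: "smooth_chart A c3" and L3: "subspace L3"
    using S N by (auto simp: slice_chart_def)
  note cc = smooth_chart_is_chart[OF c] and cc3 = smooth_chart_is_chart[OF c3]
  interpret coisotropic_chart "chart_img c" "flat c" L by (rule coisotropic_chart_flat[OF S])
  have yM: "y \<in> M" using y(2) by (simp add: hidden_constraint_set_def)
  let ?Y = "ham H c (snd c y)"
  have YL: "?Y \<in> L" using hidden_iff[OF H S y(1) yM] y(2) by simp
  have yi: "snd c y \<in> chart_img c" by (rule is_chartD(7)[OF cc y(1)])
  have "critical_point A N H y"
    unfolding critical_point_def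
  proof
    fix u assume "u \<in> tangent_space A N y"
    then have u: "u \<in> ker_form A \<omega> M y" using N(1,3) unfolding integral_manifold_def by simp
    obtain k' where k': "u = to_std c y k'" using surj_to_std[OF c y(1)] by (metis surjD)
    have "flat c (snd c y) k' \<in> L\<^sup>\<bottom>" using u ker_form_iff[OF S y(1) yM] unfolding k' by simp
    then show "differential A H y u = 0"
      unfolding k' differential_in_chart[OF H c y(1)] flat_ham[OF H c yi, symmetric]
      using YL skew[OF yi, of ?Y k'] by (simp add: mem_orthogonal_comp)
  qed
  then have "nondegenerate_critical_point A N H y"
    using nondeg yM N(1,3,5) unfolding fibrewise_nondegenerate_def by blast
  then have nd: "u = 0" if "u \<in> L3" "\<And>v. v \<in> L3 \<Longrightarrow> hessian (H \<circ> chart_inv c3) (snd c3 y) u v = 0" for u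
    using that N(2,4) unfolding nondegenerate_critical_point_def by blast
  let ?m = "snd c \<circ> chart_inv c3"
  \<comment> \<open>The vector \<open>k\<close> in the coordinates of the plaque, in which the
    Hessian is nonsingular.\<close>
  define u where "u = fd (snd c3 \<circ> chart_inv c) (snd c y) k"
  have mu: "fd ?m (snd c3 y) u = k" unfolding u_def by (rule fd_transition_inverse[OF c y(1) c3 N(4)])
  have uL: "u \<in> L3" using integral_tangent_iff[OF S y(1) N(1,2,4,3), of u] k(1) by (simp add: mu)
  have sm: "smooth_on (chart_img c3) ?m"
    by (rule smooth_on_subset[OF smooth_transition[OF c3 c]])
       (use N(6) is_chartD(8)[OF cc3] in \<open>auto simp: chart_overlap[OF cc3]\<close>)
  have y3: "snd c3 y \<in> chart_img c3" "snd c3 y \<in> L3"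
    using is_chartD(7)[OF cc3 N(4)] slice_chart_iff[OF N(2,4)] N(3) by auto
  have my: "?m (snd c3 y) = snd c y" by (simp add: is_chartD(5)[OF cc3 N(4)])
  have "hessian (H \<circ> chart_inv c3) (snd c3 y) u v = 0" if v: "v \<in> L3" for v
    unfolding hessian_def
  proof (rule hessian_zero_if_normal_derivative_zero[OF is_chartD(2)[OF cc3] y3(1) L3 y3(2) sm _ _ _
        smooth_function_in_chart[OF H c3] _ _ _ _ uL v, where Y = "ham H c" and Y' = "fd (ham H c) (snd c y)"])
    show "?m ` chart_img c3 \<subseteq> chart_img c"
      using N(6) is_chartD(8)[OF cc3] is_chartD(7)[OF cc] by auto
    fix x assume x: "x \<in> chart_img c3"
    define p where "p = chart_inv c3 x"
    have p: "p \<in> fst c3" "snd c3 p = x" "p \<in> fst c" "?m x = snd c p"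
      using is_chartD(6,8)[OF cc3 x] N(6) by (auto simp: p_def)
    show "fd (H \<circ> chart_inv c3) x v = flat c (?m x) (ham H c (?m x)) \<bullet> fd ?m x v" for v
      using fd_function_transition[OF H c3 p(1) c p(3), of v] flat_ham[OF H c is_chartD(7)[OF cc p(3)]]
      unfolding p(2,4) by simp
    assume "x \<in> L3"
    then have pN: "p \<in> N" using slice_chart_iff[OF N(2) p(1)] p(2) by simp
    then have "p \<in> M" using N(1) unfolding integral_manifold_def by blast
    then show "?m x \<in> L" unfolding p(4) using slice_chart_iff[OF S p(3)] by simp
    show "flat c (?m x) (fd ?m x v) \<in> L\<^sup>\<bottom>" if "v \<in> L3" for v
      using integral_tangent_iff[OF S p(3) N(1,2) p(1) pN] that unfolding p(2,4) by simp
  next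
    show "(ham H c has_derivative fd (ham H c) (snd c y)) (at (?m (snd c3 y)))"
      unfolding my by (rule smooth_on_has_derivative[OF smooth_ham[OF H c] yi])
    show "ham H c (?m (snd c3 y)) \<in> L" unfolding my by (rule YL)
    show "fd (ham H c) (snd c y) (fd ?m (snd c3 y) u) \<in> L" unfolding mu by (rule k(2))
  qed
  then have "u = 0" by (rule nd[OF uL])
  then show "k = 0" using mu linear_0[OF smooth_on_linear_fd[OF sm y3(1)]] by simp
qed

end

context fibre_map
begin

lemma preserves_hidden:
  assumes H: "smooth_map_on A std_atlas UNIV H" and nondeg: "fibrewise_nondegenerate A \<omega> M H"
    and hid: "hid H \<subseteq> W" "\<And>z. z \<in> hid H \<Longrightarrow> f z = z" and y: "y \<in> hid H"
  shows "preserves y"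
proof -
  have yW: "y \<in> W" using y hid(1) by blast
  then have yM: "y \<in> M" using W_subset_M by blast
  obtain c L where S: "slice_chart A M c L" "slice_chart A W c L" and yc: "y \<in> fst c"
    using slice_chart_open_subset[OF openin_W yW] by metis
  have c: "smooth_chart A c" using S by (simp add: slice_chart_def)
  note cc = smooth_chart_is_chart[OF c]
  have fy: "f y = y" by (rule hid(2)[OF y])
  \<comment> \<open>Because \<open>f\<close> fixes \<open>y\<close>, one slice chart serves for
    source and target, and a vector can be compared with its image under the derivative.\<close>
  have fyc: "f y \<in> fst c" using yc fy by simp
  obtain U F where "fibre_map_chart A \<omega> M W f c L c U F" and yU: "snd c y \<in> U"
    using fibre_map_chart_exists[OF S c fyc yW yc] .
  interpret fibre_map_chart A \<omega> M W f c L c U F by fact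
  obtain N c3 L3 r where N: "integral_manifold A \<omega> M N" "slice_chart A N c3 L3" "y \<in> N" "N \<subseteq> fst c3"
    "fst c3 \<subseteq> fst c" "r > 0" "chart_img c3 = ball (snd c3 y) r" "N \<subseteq> lfib W y" "N \<subseteq> fibre A \<omega> M y"
    by (rule plaque_in_W[OF yW is_chartD(1)[OF cc] yc])
  have y3: "y \<in> fst c3" using N(3,4) by blast
  have yi: "snd c y \<in> chart_img c" using yU U_img by blast
  have yL: "snd c y \<in> L" using slice_chart_iff[OF S(1) yc] yM by simp
  have ret: "\<exists>k. flat c (snd c y) k \<in> L\<^sup>\<bottom> \<and> fd F (snd c y) u = u + k" if "u \<in> L" for u
  proof (rule retraction_derivative[OF yU yL _ _ _ smooth_on_has_derivative[OF smooth_F yU] _ _ _ that,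
        where Y = "ham H c" and Y' = "fd (ham H c) (snd c y)"])
    show "(ham H c has_derivative fd (ham H c) (snd c y)) (at (snd c y))"
      by (rule smooth_on_has_derivative[OF smooth_ham[OF H c] yi])
    show "continuous_on U (ham H c)"
      by (rule smooth_on_imp_continuous_on[OF smooth_on_subset[OF smooth_ham[OF H c] U_img]])
    show "ham H c (snd c y) \<in> L" using hidden_iff[OF H S(1) yc yM] y by simp
    show "fd F (snd c y) k = 0" if "flat c (snd c y) k \<in> L\<^sup>\<bottom>" for k
      by (rule fd_F_kernel[OF yW yc yU that])
    show "k = 0" if "flat c (snd c y) k \<in> L\<^sup>\<bottom>" "fd (ham H c) (snd c y) k \<in> L" for k
      by (rule normal_derivative_nonzero[OF H nondeg S(1) yc y N(1-3) y3 N(9,5) that])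
    fix x assume x: "x \<in> U" "x \<in> L" "ham H c x \<in> L"
    then have xi: "x \<in> chart_img c" using U_img by blast
    define p where "p = chart_inv c x"
    have p: "p \<in> fst c" "snd c p = x" using is_chartD(6,8)[OF cc xi] by (auto simp: p_def)
    have pM: "p \<in> M" using slice_chart_iff[OF S(1) p(1)] x(2) p(2) by simp
    have "p \<in> hid H" using hidden_iff[OF H S(1) p(1) pM] x(3) p(2) by simp
    then have "p \<in> W" "f p = p" using hid by auto
    then show "F x = x" using F_eq[of p] p x(1) by simp
  qed
  show ?thesis
    unfolding preserves_iff[OF yW yc yU]
  proof (intro ballI)
    fix u v assume u: "u \<in> L" and v: "v \<in> L"
    obtain k where k: "flat c (snd c y) k \<in> L\<^sup>\<bottom>" "fd F (snd c y) u = u + k" using ret[OF u] by blast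
    obtain l where l: "flat c (snd c y) l \<in> L\<^sup>\<bottom>" "fd F (snd c y) v = v + l" using ret[OF v] by blast
    have lL: "l \<in> L" by (rule coisotropic[OF yU yL l(1)])
    have Fy: "F (snd c y) = snd c y" using F_eq[OF yW yc yU] fy by simp
    note bil = bilinear_form(1)[OF c yi]
    have z: "form c (snd c y) k w = 0" if "w \<in> L" for w
      using k(1) that flat_inner[OF c yi, of k w] by (simp add: mem_orthogonal_comp)
    have z': "form c (snd c y) w l = 0" if "w \<in> L" for w
      using l(1) that flat_inner[OF c yi, of l w] bilinear_alternating_antisym[OF bilinear_form[OF c yi], of w l]
      by (simp add: mem_orthogonal_comp)
    \<comment> \<open>\<open>\<omega>(u + k, v + l)\<close> and \<open>\<omega>(u, v)\<close> differ
      by terms that pair a kernel vector with a vector of \<open>L\<close>; for the term with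
      \<open>k\<close> and \<open>l\<close> this uses that \<open>l\<close> lies in
      \<open>L\<close>.\<close>
    show "defect (snd c y) u v = 0"
      unfolding defect_def Fy k(2) l(2)
      by (simp add: bilinear_ladd[OF bil] bilinear_radd[OF bil] z z' u v lL)
  qed
qed

end

section \<open>Symplecticity of SHAKE and RATTLE\<close>

text \<open>Curves in \<open>S\<close> are curves in \<open>W\<close>, so both claims come down to
  identities on \<open>W\<close> and the invariance of the respective subset.\<close>

lemma symplectic_map_onI:
  assumes W: "S \<subseteq> W" and g: "g ` S \<subseteq> S" "smooth_map_on A A W g"
    and pres: "\<And>x \<gamma> \<delta>. x \<in> W \<Longrightarrow> curve_in A W x \<gamma> \<Longrightarrow> curve_in A W x \<delta> \<Longrightarrow>
      \<omega> (g x) (velocity A (g \<circ> \<gamma>) 0) (velocity A (g \<circ> \<delta>) 0) = \<omega> x (velocity A \<gamma> 0) (velocity A \<delta> 0)"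
  shows "symplectic_map_on A \<omega> S g"
  unfolding symplectic_map_on_def
proof (intro conjI ballI allI impI)
  show "smooth_map_on A A S g" by (rule smooth_map_on_subset[OF g(2) W])
  fix x \<gamma> \<delta> assume "x \<in> S" and c: "curve_in A S x \<gamma> \<and> curve_in A S x \<delta>"
  then have "x \<in> W" using W by blast
  then show "\<omega> (g x) (velocity A (g \<circ> \<gamma>) 0) (velocity A (g \<circ> \<delta>) 0) = \<omega> x (velocity A \<gamma> 0) (velocity A \<delta> 0)"
    using pres curve_in_mono[OF conjunct1[OF c] W] curve_in_mono[OF conjunct2[OF c] W] by blast
qed (rule g(1))

theorem corollary4p8:
  fixes A :: "('p::{t2_space, second_countable_topology}, 'e::euclidean_space) chart set"
    and \<omega> :: "'p \<Rightarrow> 'e \<Rightarrow> 'e \<Rightarrow> real"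
    and H :: "'p \<Rightarrow> real"
    and M W :: "'p set"
    and I :: "real set"
    and \<phi> :: "real \<Rightarrow> 'p \<Rightarrow> 'p"
    and h0 h :: real
  assumes "symplectic_manifold A \<omega>"
    and "smooth_map_on A std_atlas UNIV H"
    and "coisotropic A \<omega> M"
    and "fibrewise_nondegenerate A \<omega> M H"
    and "symplectic_method A \<omega> H I \<phi>"
    and "{-h0<..<h0} \<subseteq> I"
    and "shake_rattle_well_defined A \<omega> M H \<phi> W h0"
    and "0 < \<bar>h\<bar>" and "\<bar>h\<bar> < h0"
  shows "symplectic_map_on A \<omega> (modified_hidden_set A \<omega> M W (\<phi> h)) (shake_map A \<omega> M W (\<phi> h)) \<and>
         symplectic_map_on A \<omega> (hidden_constraint_set A \<omega> M H) (rattle_map A \<omega> M H W (\<phi> h))"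
proof -
  interpret coisotropic_mfd A \<omega> M
    by unfold_locales (fact assms(1), fact assms(3))
  note wd = assms(7)[unfolded shake_rattle_well_defined_def]
  note wdh = wd[THEN conjunct2, THEN conjunct2, THEN conjunct2, THEN conjunct2, rule_format,
      OF conjI[OF assms(8,9)]]
  have W: "openin (top_of_set M) W" "hid H \<subseteq> W"
    by (rule wd[THEN conjunct1], rule wd[THEN conjunct2, THEN conjunct1])
  have sm\<pi>: "smooth_map_on A A W (hidden_proj A \<omega> M H W)"
    by (rule wd[THEN conjunct2, THEN conjunct2, THEN conjunct2, THEN conjunct1])
  have ex\<pi>: "\<exists>!y. y \<in> lfib W x \<inter> hid H" if "x \<in> W" for x
    by (rule wd[THEN conjunct2, THEN conjunct2, THEN conjunct1, rule_format, OF that])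
  have ex\<Gamma>: "\<exists>!z'. z' \<in> lfib W z \<and> \<phi> h z' \<in> M" if "z \<in> W" for z
    by (rule wdh[THEN conjunct1, rule_format, OF that])
  have sm\<Gamma>: "smooth_map_on A A W (shake_shift A \<omega> M W (\<phi> h))"
    by (rule wdh[THEN conjunct2, THEN conjunct1])
  have SW: "\<phi> h ` shake_shift A \<omega> M W (\<phi> h) ` W \<subseteq> W"
    by (rule wdh[THEN conjunct2, THEN conjunct2])
  define \<pi> where "\<pi> = hidden_proj A \<omega> M H W"
  define \<Gamma> where "\<Gamma> = shake_shift A \<omega> M W (\<phi> h)"
  have \<pi>: "\<pi> x \<in> lfib W x" "\<pi> x \<in> hid H" if "x \<in> W" for x
    using theI'[OF ex\<pi>[OF that]] unfolding \<pi>_def hidden_proj_def by auto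
  have \<Gamma>: "\<Gamma> x \<in> lfib W x" if "x \<in> W" for x
    using theI'[OF ex\<Gamma>[OF that]] unfolding \<Gamma>_def shake_shift_def by auto
  \<comment> \<open>The hidden point makes the local fibre nonempty, so the fibre contains
    \<open>x\<close>; this is where every point of \<open>W\<close> obtains its integral
    manifold.\<close>
  have self: "x \<in> lfib W x" if "x \<in> W" for x by (rule lfib_nonempty[OF \<pi>(1)[OF that]])
  \<comment> \<open>The definite description involves the point only through its local fibre, which
    all points of the fibre share.\<close>
  have \<pi>_lfib: "\<pi> y = \<pi> x" if "x \<in> W" "y \<in> lfib W x" for x y
    unfolding \<pi>_def hidden_proj_def lfib_eq[OF that(2)] ..
  have \<pi>_hid: "\<pi> z = z" if "z \<in> hid H" for z
    unfolding \<pi>_def hidden_proj_def using that W(2) self by (intro the1_equality[OF ex\<pi>]) auto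
  have \<Gamma>W: "\<Gamma> ` W \<subseteq> W" using \<Gamma> lfib_subset by blast
  interpret \<pi>: fibre_map A \<omega> M W \<pi>
  proof unfold_locales
    show "W \<subseteq> topspace leaf" using self lfib_subset by blast
    show "smooth_map_on A A W \<pi>" unfolding \<pi>_def by (rule sm\<pi>)
  qed (use W(1) \<pi>_lfib in auto)
  have pres\<pi>: "\<omega> (\<pi> x) (velocity A (\<pi> \<circ> \<gamma>) 0) (velocity A (\<pi> \<circ> \<delta>) 0) = \<omega> x (velocity A \<gamma> 0) (velocity A \<delta> 0)"
    if x: "x \<in> W" and c: "curve_in A W x \<gamma>" "curve_in A W x \<delta>" for x \<gamma> \<delta>
    using \<pi>.preserves_lfib[OF x \<pi>(1)[OF x]] \<pi>.preserves_hidden[OF assms(2,4) W(2) \<pi>_hid \<pi>(2)[OF x]] c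
    unfolding \<pi>.preserves_def by blast
  have smG: "smooth_map_on A A W \<Gamma>" unfolding \<Gamma>_def by (rule sm\<Gamma>)
  have \<pi>\<Gamma>: "\<pi> (\<Gamma> x) = \<pi> x" if "x \<in> W" for x by (rule \<pi>_lfib[OF that \<Gamma>[OF that]])
  have pres\<Gamma>: "\<omega> (\<Gamma> x) (velocity A (\<Gamma> \<circ> \<gamma>) 0) (velocity A (\<Gamma> \<circ> \<delta>) 0) = \<omega> x (velocity A \<gamma> 0) (velocity A \<delta> 0)"
    if x: "x \<in> W" and c: "curve_in A W x \<gamma>" "curve_in A W x \<delta>" for x \<gamma> \<delta>
  proof -
    \<comment> \<open>Near 0 the curves \<gamma> and \<open>\<Gamma> \<circ> \<gamma>\<close> have
      the same image under \<pi>. So the invariance under \<pi>, used at \<open>x\<close> and at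
      \<open>\<Gamma> x\<close>, has the same left-hand side twice.\<close>
    have vel: "velocity A (\<pi> \<circ> (\<Gamma> \<circ> \<gamma>)) 0 = velocity A (\<pi> \<circ> \<gamma>) 0" if \<gamma>: "curve_in A W x \<gamma>" for \<gamma>
    proof -
      obtain e where e: "e > 0" "\<gamma> ` {-e<..<e} \<subseteq> W" using \<gamma> unfolding curve_in_def by blast
      show ?thesis
      proof (rule velocity_cong[OF e(1)])
        fix t :: real assume "\<bar>t\<bar> < e"
        then have "t \<in> {-e<..<e}" by auto
        then have "\<gamma> t \<in> W" using e(2) by blast
        then show "(\<pi> \<circ> (\<Gamma> \<circ> \<gamma>)) t = (\<pi> \<circ> \<gamma>) t" by (simp add: \<pi>\<Gamma>)
      qed
    qed
    have "\<Gamma> x \<in> W" using x \<Gamma>W by blast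
    from pres\<pi>[OF this curve_in_image[OF c(1) smG \<Gamma>W] curve_in_image[OF c(2) smG \<Gamma>W]]
    show ?thesis using pres\<pi>[OF x c] by (simp only: vel[OF c(1)] vel[OF c(2)] \<pi>\<Gamma>[OF x])
  qed
  have "h \<in> {-h0<..<h0}" using assms(9) by auto
  then have "h \<in> I" using assms(6) by blast
  then have symp: "symplectic_map_on A \<omega> UNIV (\<phi> h)"
    using assms(5) unfolding symplectic_method_def by blast
  have sm\<phi>: "smooth_map_on A A UNIV (\<phi> h)" using symp unfolding symplectic_map_on_def by blast
  define S where "S = \<phi> h \<circ> \<Gamma>"
  have S_eq: "shake_map A \<omega> M W (\<phi> h) = S" by (simp add: shake_map_def S_def \<Gamma>_def)
  have SW': "S ` W \<subseteq> W" using SW by (auto simp: S_def \<Gamma>_def)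
  have smS: "smooth_map_on A A W S" unfolding S_def by (rule smooth_map_on_compose[OF smG sm\<phi> subset_UNIV])
  have presS: "\<omega> (S x) (velocity A (S \<circ> \<gamma>) 0) (velocity A (S \<circ> \<delta>) 0) = \<omega> x (velocity A \<gamma> 0) (velocity A \<delta> 0)"
    if x: "x \<in> W" and c: "curve_in A W x \<gamma>" "curve_in A W x \<delta>" for x \<gamma> \<delta>
    using symp[unfolded symplectic_map_on_def, THEN conjunct2, THEN conjunct2, rule_format, OF UNIV_I
        conjI[OF curve_in_image[OF c(1) smG subset_UNIV] curve_in_image[OF c(2) smG subset_UNIV]]]
      pres\<Gamma>[OF x c]
    by (simp add: S_def comp_assoc)
  have presR: "\<omega> ((\<pi> \<circ> S) x) (velocity A ((\<pi> \<circ> S) \<circ> \<gamma>) 0) (velocity A ((\<pi> \<circ> S) \<circ> \<delta>) 0)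
      = \<omega> x (velocity A \<gamma> 0) (velocity A \<delta> 0)"
    if x: "x \<in> W" and c: "curve_in A W x \<gamma>" "curve_in A W x \<delta>" for x \<gamma> \<delta>
  proof -
    have "S x \<in> W" using x SW' by blast
    from pres\<pi>[OF this curve_in_image[OF c(1) smS SW'] curve_in_image[OF c(2) smS SW']]
    show ?thesis using presS[OF x c] by (simp add: comp_assoc)
  qed
  \<comment> \<open>The image of \<open>W\<close> under \<open>S\<close> lies in \<open>W\<close>,
    and therefore \<open>S\<close> maps this image into itself.\<close>
  have "symplectic_map_on A \<omega> (S ` W) S"
    by (rule symplectic_map_onI[where A = A and \<omega> = \<omega> and g = S and W = W, OF SW' _ smS presS]) (use SW' in auto)
  moreover have "symplectic_map_on A \<omega> (hid H) (\<pi> \<circ> S)"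
    by (rule symplectic_map_onI[where A = A and \<omega> = \<omega> and g = "\<pi> \<circ> S" and W = W, OF W(2) _ smooth_map_on_compose[OF smS \<pi>.smooth_f SW'] presR])
       (use SW' W(2) \<pi>(2) in auto)
  ultimately show ?thesis
    by (simp add: modified_hidden_set_def rattle_map_def S_eq \<pi>_def)
qed

end
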